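(* Let $D\ge2$ be fixed and $0<\lambda<\lambda_D$. Let $G\sim\mathcal G(n,\lambda/n)$ and $h>0$. Then with high probability: (1) if $h\le\underline h$, $G$ contains $\omega(1)$ complete $D$-ary trees of depth $h$; (2) if $h\ge \bar h+C$, where $C$ is a large enough constant, $G$ contains no complete $D$-ary tree of depth $h$.
   Context: $\psi_D(\mu)=\mathbb{P}(\mathrm{Poi}(\mu)\ge D)$; $p_*(D,\lambda)$ is the largest nonnegative root of $p=\psi_D(\lambda p)$; $\lambda_D=\sup\{\lambda>0:p_*(D,\lambda)=0\}$. A complete $D$-ary tree of depth $h$ has root at depth $0$ and each vertex at depth $<h$ has $D$ children. For a Galton–Watson tree $(T,o)$ with offspring law $\mathrm{Poi}(\lambda)$, $p_h$ is the probability that $T$ contains a complete $D$-ary tree of depth $h$ rooted at $o$. $\bar h=\inf\{h>0:p_h<1/n\}$ and $\underline h=\sup\{h>0:p_h>\ln(n)/n\}$. "With high probability" means with probability $1-o(1)$ as $n\to\infty$. *)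

theory Defs
  imports "HOL-Probability.Probability"
begin

text \<open>Poisson upper tail: psi_D(mu) = P(Poi(mu) >= D) (mu >= 0), written out via the Poisson pmf.\<close>
definition psi :: "nat \<Rightarrow> real \<Rightarrow> real" where
  "psi D mu = 1 - (\<Sum>k<D. mu ^ k / fact k * exp (- mu))"

definition p_star :: "nat \<Rightarrow> real \<Rightarrow> real" where
  "p_star D lam = Sup {p::real. 0 \<le> p \<and> p = psi D (lam * p)}"

definition lambda_crit :: "nat \<Rightarrow> real" where
  "lambda_crit D = Sup {lam::real. 0 < lam \<and> p_star D lam = 0}"

text \<open>Galton--Watson tree in Ulam--Harris labelling: X u is the number of children of
  vertex u (a list of child indices); vertex u@[i] exists iff u exists and i < X u.
  gw_contains D X h u: the subtree at u contains a complete D-ary tree of depth h rooted at u.\<close>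
fun gw_contains :: "nat \<Rightarrow> (nat list \<Rightarrow> nat) \<Rightarrow> nat \<Rightarrow> nat list \<Rightarrow> bool" where
  "gw_contains D X 0 u = True"
| "gw_contains D X (Suc h) u =
     (\<exists>S. S \<subseteq> {..<X u} \<and> card S = D \<and> (\<forall>i\<in>S. gw_contains D X h (u @ [i])))"

definition GW_measure :: "real \<Rightarrow> (nat list \<Rightarrow> nat) measure" where
  "GW_measure lam = PiM UNIV (\<lambda>_::nat list. measure_pmf (poisson_pmf lam))"

definition p_tree :: "nat \<Rightarrow> real \<Rightarrow> nat \<Rightarrow> real" where
  "p_tree D lam h = measure (GW_measure lam)
      {X \<in> space (GW_measure lam). gw_contains D X h []}"

definition h_bar :: "nat \<Rightarrow> real \<Rightarrow> nat \<Rightarrow> nat" where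
  "h_bar D lam n = Inf {h::nat. 0 < h \<and> p_tree D lam h < 1 / real n}"

definition h_low :: "nat \<Rightarrow> real \<Rightarrow> nat \<Rightarrow> nat" where
  "h_low D lam n = Sup {h::nat. 0 < h \<and> p_tree D lam h > ln (real n) / real n}"

definition gnp :: "nat \<Rightarrow> real \<Rightarrow> (nat \<times> nat \<Rightarrow> bool) pmf" where
  "gnp n p = Pi_pmf {(i, j). i < j \<and> j < n} False (\<lambda>_. bernoulli_pmf p)"

definition adj :: "(nat \<times> nat \<Rightarrow> bool) \<Rightarrow> nat \<Rightarrow> nat \<Rightarrow> bool" where
  "adj G u v \<longleftrightarrow> u \<noteq> v \<and> G (min u v, max u v)"

text \<open>Complete D-ary tree of depth h: vertices are words over {..<D} of length <= h,
  root [], and the children of u (length u < h) are u@[i], i<D.\<close>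
definition tree_verts :: "nat \<Rightarrow> nat \<Rightarrow> nat list set" where
  "tree_verts D h = {u. length u \<le> h \<and> set u \<subseteq> {..<D}}"

definition tree_embedding :: "nat \<Rightarrow> nat \<Rightarrow> nat \<Rightarrow> (nat \<times> nat \<Rightarrow> bool) \<Rightarrow> (nat list \<Rightarrow> nat) \<Rightarrow> bool" where
  "tree_embedding D h n G phi \<longleftrightarrow>
     inj_on phi (tree_verts D h) \<and> phi ` tree_verts D h \<subseteq> {..<n} \<and>
     (\<forall>u i. length u < h \<and> set u \<subseteq> {..<D} \<and> i < D \<longrightarrow> adj G (phi u) (phi (u @ [i])))"

definition tree_copy_edges :: "nat \<Rightarrow> nat \<Rightarrow> (nat list \<Rightarrow> nat) \<Rightarrow> nat set set" where
  "tree_copy_edges D h phi =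
     {{phi u, phi (u @ [i])} | u i. length u < h \<and> set u \<subseteq> {..<D} \<and> i < D}"

text \<open>Number of (distinct, as subgraphs) copies of the complete D-ary tree of depth h in G.\<close>
definition num_tree_copies :: "nat \<Rightarrow> nat \<Rightarrow> nat \<Rightarrow> (nat \<times> nat \<Rightarrow> bool) \<Rightarrow> nat" where
  "num_tree_copies D h n G =
     card {F. \<exists>phi. tree_embedding D h n G phi \<and> F = tree_copy_edges D h phi}"

definition contains_tree :: "nat \<Rightarrow> nat \<Rightarrow> nat \<Rightarrow> (nat \<times> nat \<Rightarrow> bool) \<Rightarrow> bool" where
  "contains_tree D h n G \<longleftrightarrow> (\<exists>phi. tree_embedding D h n G phi)"

end

theory Submission
  imports Defs "HOL-Real_Asymp.Real_Asymp"
begin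

text \<open>
  Poisson thinning gives the recursion \<open>p\<^bsub>h+1\<^esub> = psi D (lam p\<^sub>h)\<close>, and below criticality \<open>p\<^sub>h\<close> decays
  doubly exponentially, so that \<open>D\<^sup>h = O(ln n)\<close> as long as \<open>p\<^sub>h \<ge> 1/n\<close>.

  Upper bounds. If \<open>v\<close> is the root of a copy of depth \<open>h + 1\<close> in the random graph, then at least \<open>D\<close> of the
  events "\<open>vu\<close> is an edge and \<open>u\<close> is the root of a copy of depth \<open>h\<close>" occur disjointly. By the van den
  Berg--Kesten inequality this is at most as likely as for independent events, so the probability
  that \<open>v\<close> is a root satisfies the recursion of \<open>p\<^sub>h\<close> with \<open>lam\<close> replaced by \<open>lam (1 + O(1/n))\<close>. This
  proves the second part by a union bound.

  The first part is a second moment argument for the number of roots \<open>v\<close> of copies of depth \<open>h\<close>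
  whose non-backtracking walks of length at most \<open>3h\<close> are determined by their endpoints. The mean is
  \<open>(1 - o(1)) n p\<^sub>h \<ge> (1 - o(1)) ln n\<close>: summing over the labelled trees that can arise as neighbourhood of
  \<open>v\<close> compares it with the Galton--Watson tree, whose size has exponential tails. For a pair \<open>v, z\<close> of roots
  with disjoint copies the van den Berg--Kesten inequality gives \<open>p\<^sub>h\<^sup>2\<close>. If the copies meet, then
  there are disjointly a short path from \<open>v\<close> to \<open>z\<close>, \<open>D - 1\<close> subtrees of depth \<open>h - 1\<close> at each of \<open>v\<close> and \<open>z\<close>, and a
  further subtree of depth \<open>h - 2\<close>, which is much less likely than a single copy.
\<close>

section \<open>The Poisson tail and the recursion for the tree probabilities\<close>

text \<open>Two obstacles shape the proof. First, the depth grows with n and p_h is as small as 1/n,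
  so every error must be small relative to p_h. Replacing \<open>lam\<close> by
  \<open>lam_up lam n\<close> costs a factor (1 + O(1/n)) to the power 2 D^h, which is 1 + o(1)
  because D^h = O(ln n). Discarding explored trees with more than n^(1/3) vertices costs exp (-
  n^(1/3) / polylog n), because trees of depth 3h have polylogarithmic scale. As
  \<open>lam_up lam n\<close> varies with n, the decay of p_h is taken at one fixed
  \<open>lam'\<close> above \<open>lam\<close> that is still subcritical. Second, two copies can
  overlap in many ways, while the van den Berg--Kesten inequality asks for edge-disjoint witnesses.
  Uniqueness of walks resolves this: near such a root \<open>v\<close> an edge determines the walk
  from \<open>v\<close> that ends with it, so disjointness of edge sets reduces to walks being
  different. Uniqueness is not paid for separately, since an explored tree with distinct labels
  provides it together with the copy.\<close>

lemma psi_0 [simp]: "psi 0 x = 1"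
  by (simp add: psi_def)

lemma psi_Suc: "psi (Suc D) x = psi D x - x ^ D / fact D * exp (- x)"
  by (simp add: psi_def)

lemma psi_at_0: "D > 0 \<Longrightarrow> psi D 0 = 0"
  by (cases D) (simp_all add: psi_def lessThan_Suc_eq_insert_0 zero_notin_Suc_image sum.reindex)

lemma DERIV_power_fact:
  "((\<lambda>x::real. x ^ Suc D / fact (Suc D)) has_real_derivative x ^ D / fact D) (at x)"
proof -
  have "real (Suc D) * x ^ (Suc D - Suc 0) / fact (Suc D) = x ^ D / fact D"
    by (simp add: field_simps del: of_nat_Suc)
  with DERIV_cdivide[OF DERIV_pow[of "Suc D" x UNIV], of "fact (Suc D)"] show ?thesis by simp
qed

text \<open>The derivatives of the Poisson masses telescope. Comparing \<open>psi\<close> at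
  different means below goes through this formula and the sign of a derivative.\<close>

lemma DERIV_psi_Suc:
  "(psi (Suc D) has_real_derivative x ^ D / fact D * exp (- x)) (at x)"
proof (induction D)
  case 0
  have "psi (Suc 0) = (\<lambda>x. 1 - exp (- x))" by (auto simp: psi_def)
  then show ?case by (auto intro!: derivative_eq_intros)
next
  case (Suc D)
  have eq: "psi (Suc (Suc D)) = (\<lambda>x. psi (Suc D) x - x ^ Suc D / fact (Suc D) * exp (- x))"
    by (rule ext) (rule psi_Suc)
  have e: "((\<lambda>x. exp (- x)) has_real_derivative - exp (- x)) (at x)"
    by (auto intro!: derivative_eq_intros)
  show ?case unfolding eq
    using DERIV_diff[OF Suc.IH DERIV_mult[OF DERIV_power_fact[of D x] e]]
    by (rule DERIV_cong) (simp add: algebra_simps)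
qed

lemma psi_mono:
  assumes "0 \<le> x" "x \<le> y" shows "psi D x \<le> psi D y"
proof (cases D)
  case (Suc E)
  show ?thesis unfolding Suc
    by (rule DERIV_nonneg_imp_nondecreasing[OF assms(2)])
       (use DERIV_psi_Suc assms in \<open>fastforce intro!: exI mult_nonneg_nonneg divide_nonneg_pos\<close>)
qed simp

lemma psi_nonneg: "0 \<le> x \<Longrightarrow> 0 \<le> psi D x"
  using psi_mono[of 0 x D] by (cases "D = 0") (auto simp: psi_at_0)

lemma psi_le_1: "0 \<le> x \<Longrightarrow> psi D x \<le> 1"
  unfolding psi_def by (auto intro!: sum_nonneg)

lemma psi_antimono: "0 \<le> x \<Longrightarrow> psi (Suc D) x \<le> psi D x"
  by (simp add: psi_Suc)

lemma psi_lower: "0 \<le> x \<Longrightarrow> x ^ D / fact D * exp (- x) \<le> psi D x"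
  using psi_nonneg[of x "Suc D"] by (simp add: psi_Suc)

text \<open>x^D / D! is the expected number of D-subsets of a Poisson number of points, so this is a
  first moment bound; analytically the two derivatives differ by the factor exp (-t).\<close>

lemma psi_upper:
  assumes "0 \<le> x" shows "psi D x \<le> x ^ D / fact D"
proof (cases D)
  case (Suc E)
  have "(\<lambda>x. x ^ Suc E / fact (Suc E) - psi (Suc E) x) 0 \<le> (\<lambda>x. x ^ Suc E / fact (Suc E) - psi (Suc E) x) x"
  proof (rule DERIV_nonneg_imp_nondecreasing[OF assms])
    fix t :: real assume t: "0 \<le> t" "t \<le> x"
    have "((\<lambda>x. x ^ Suc E / fact (Suc E) - psi (Suc E) x) has_real_derivative
        t ^ E / fact E - t ^ E / fact E * exp (- t)) (at t)"
      by (rule DERIV_diff[OF DERIV_power_fact DERIV_psi_Suc])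
    moreover have "t ^ E / fact E * exp (- t) \<le> t ^ E / fact E * 1"
      using t by (intro mult_left_mono) auto
    ultimately show "\<exists>y. ((\<lambda>x. x ^ Suc E / fact (Suc E) - psi (Suc E) x) has_real_derivative y) (at t) \<and> 0 \<le> y"
      by fastforce
  qed
  then show ?thesis by (simp add: Suc psi_at_0 del: fact_Suc)
qed simp

lemma psi_upper_power: "0 \<le> x \<Longrightarrow> psi D x \<le> x ^ D"
  using psi_upper[of x D] by (rule order_trans) (auto simp: divide_le_eq mult_le_cancel_left1)

text \<open>In probabilistic terms: a Poisson variable of mean \<open>x + m\<close> is the sum of one of mean \<open>x\<close> and
  an independent one that is nonzero with probability \<open>1 - exp (- m)\<close>.\<close>
lemma psi_add_ge:
  assumes "0 \<le> x" "0 \<le> m"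
  shows "exp (- m) * psi (Suc D) x + (1 - exp (- m)) * psi D x \<le> psi (Suc D) (x + m)"
proof -
  \<comment> \<open>Up to the factor \<open>exp m\<close>, \<open>g m - g 0\<close> is the
    difference of the two sides. The factor makes the derivative collapse to
    \<open>exp t * (psi D (x + t) - psi D x)\<close>.\<close>
  define g where "g t = exp t * psi (Suc D) (x + t) - (exp t - 1) * psi D x" for t
  have "g 0 \<le> g m"
  proof (rule DERIV_nonneg_imp_nondecreasing[OF assms(2)])
    fix t :: real assume t: "0 \<le> t" "t \<le> m"
    have d: "((\<lambda>t. psi (Suc D) (x + t)) has_real_derivative (x + t) ^ D / fact D * exp (- (x + t)) * (0 + 1)) (at t)"
      by (rule DERIV_chain2[OF DERIV_psi_Suc]) (auto intro!: derivative_eq_intros)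
    have "(g has_real_derivative exp t * psi (Suc D) (x + t) +
        exp t * ((x + t) ^ D / fact D * exp (- (x + t))) - exp t * psi D x) (at t)"
      unfolding g_def by (rule derivative_eq_intros d refl | simp)+
    moreover have "exp t * psi (Suc D) (x + t) + exp t * ((x + t) ^ D / fact D * exp (- (x + t))) - exp t * psi D x
       = exp t * (psi D (x + t) - psi D x)"
      by (simp add: psi_Suc algebra_simps)
    moreover have "0 \<le> exp t * (psi D (x + t) - psi D x)"
      using psi_mono[of x "x + t" D] assms t by simp
    ultimately show "\<exists>y. (g has_real_derivative y) (at t) \<and> 0 \<le> y" by metis
  qed
  then have "psi (Suc D) x + (exp m - 1) * psi D x \<le> exp m * psi (Suc D) (x + m)"
    by (simp add: g_def)
  then have "(psi (Suc D) x + (exp m - 1) * psi D x) / exp m \<le> psi (Suc D) (x + m)"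
    by (simp add: pos_divide_le_eq mult.commute)
  then show ?thesis by (simp add: exp_minus field_simps)
qed

text \<open>The quotient of \<open>psi D y\<close> by y^D is nonincreasing: y times the derivative
  of \<open>psi D\<close> is D times the mass at D, which is at most D times the tail by
  \<open>psi_lower\<close>.\<close>

lemma psi_scale:
  assumes "0 \<le> x" "1 \<le> t" shows "psi D (t * x) \<le> t ^ D * psi D x"
proof (cases D)
  case (Suc E)
  define g where "g t = psi D (t * x) / t ^ D" for t
  have "g t \<le> g 1"
  proof (rule DERIV_nonpos_imp_nonincreasing[OF assms(2)])
    fix s :: real assume s: "1 \<le> s" "s \<le> t"
    have d: "((\<lambda>t. psi (Suc E) (t * x)) has_real_derivative (s * x) ^ E / fact E * exp (- (s * x)) * x) (at s)"
      by (rule DERIV_chain2[OF DERIV_psi_Suc]) (auto intro!: derivative_eq_intros)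
    have "(g has_real_derivative ((s * x) ^ E / fact E * exp (- (s * x)) * x * s ^ Suc E
        - psi (Suc E) (s * x) * (real (Suc E) * s ^ E)) / (s ^ Suc E * s ^ Suc E)) (at s)"
      unfolding g_def Suc
      by (rule derivative_eq_intros d refl | use s in simp)+
    moreover have "((s * x) ^ E / fact E * exp (- (s * x)) * x * s ^ Suc E
        - psi (Suc E) (s * x) * (real (Suc E) * s ^ E)) =
        real (Suc E) * s ^ E * ((s * x) ^ Suc E / fact (Suc E) * exp (- (s * x)) - psi (Suc E) (s * x))"
    proof -
      have "real (Suc E) * s ^ E * ((s * x) ^ Suc E / fact (Suc E) * exp (- (s * x))) =
        (real (Suc E) / fact (Suc E)) * (s * x) ^ Suc E * exp (- (s * x)) * s ^ E" by simp
      also have "real (Suc E) / fact (Suc E) = 1 / fact E"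
        by (simp add: field_simps del: of_nat_Suc)
      finally show ?thesis by (simp add: right_diff_distrib mult_ac)
    qed
    moreover have "real (Suc E) * s ^ E * ((s * x) ^ Suc E / fact (Suc E) * exp (- (s * x)) - psi (Suc E) (s * x)) \<le> 0"
      using psi_lower[of "s * x" "Suc E"] s assms by (intro mult_nonneg_nonpos) auto
    moreover have "0 \<le> s ^ Suc E * s ^ Suc E" using s by simp
    ultimately show "\<exists>y. (g has_real_derivative y) (at s) \<and> y \<le> 0"
      by (metis divide_nonpos_nonneg)
  qed
  then show ?thesis using assms by (simp add: g_def field_simps)
qed simp

section \<open>The recursion for p_h and its doubly exponential decay\<close>

text \<open>The recursion is kept apart from the Galton--Watson measure because it is also run at
  the parameter \<open>lam_up lam n\<close>, where it bounds probabilities in the random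
  graph.\<close>

primrec perc :: "nat \<Rightarrow> real \<Rightarrow> nat \<Rightarrow> real" where
  "perc D lam 0 = 1"
| "perc D lam (Suc h) = psi D (lam * perc D lam h)"

lemma perc_bounds: "0 \<le> lam \<Longrightarrow> 0 \<le> perc D lam h \<and> perc D lam h \<le> 1"
  by (induction h) (auto intro!: psi_nonneg psi_le_1)

lemmas perc_nonneg = perc_bounds[THEN conjunct1] and perc_le_1 = perc_bounds[THEN conjunct2]

lemma perc_antimono_Suc: "0 \<le> lam \<Longrightarrow> perc D lam (Suc h) \<le> perc D lam h"
proof (induction h)
  case 0 then show ?case using perc_le_1[of lam D "Suc 0"] by simp
next
  case (Suc h) then show ?case
    unfolding perc.simps(2)[of D lam "Suc h"] perc.simps(2)[of D lam h]
    by (intro psi_mono mult_left_mono mult_nonneg_nonneg psi_nonneg) (auto simp: perc_nonneg)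
qed

lemma perc_antimono: "0 \<le> lam \<Longrightarrow> h \<le> k \<Longrightarrow> perc D lam k \<le> perc D lam h"
  using lift_Suc_antimono_le[of "perc D lam" h k] perc_antimono_Suc by blast

lemma perc_mono_lam:
  assumes "0 \<le> a" "a \<le> b" shows "perc D a h \<le> perc D b h"
proof (induction h)
  case (Suc h)
  have "0 \<le> perc D a h" using assms perc_nonneg by blast
  then show ?case using Suc assms by (auto intro!: psi_mono mult_mono)
qed simp

text \<open>Used with t = 1 + O(1/n) and D^h = O(ln n), where the factor tends to 1. The exponent
  e_h = 2 D^h - 2 vanishes at h = 0 and satisfies D (e_h + 1) <= e_(h+1): the unit comes from
  \<open>t * lam\<close>, the multiplication by D from \<open>psi_scale\<close>.\<close>

lemma perc_scale:
  assumes "0 \<le> lam" "1 \<le> t" "2 \<le> D"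
  shows "perc D (t * lam) h \<le> t ^ (2 * D ^ h - 2) * perc D lam h"
proof (induction h)
  case (Suc h)
  have D1: "1 \<le> D ^ h" using assms(3) by simp
  let ?e = "2 * D ^ h - 2"
  have "perc D (t * lam) (Suc h) \<le> psi D (t * lam * (t ^ ?e * perc D lam h))"
    unfolding perc.simps using assms Suc
    by (intro psi_mono mult_left_mono) (auto simp: perc_nonneg)
  also have "\<dots> = psi D (t ^ Suc ?e * (lam * perc D lam h))" by (simp add: mult_ac)
  also have "\<dots> \<le> (t ^ Suc ?e) ^ D * psi D (lam * perc D lam h)"
    using assms by (intro psi_scale) (auto simp: perc_nonneg simp del: power_Suc)
  also have "(t ^ Suc ?e) ^ D = t ^ (Suc ?e * D)" by (rule power_mult[symmetric])
  also have "\<dots> \<le> t ^ (2 * D ^ Suc h - 2)"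
  proof (rule power_increasing[OF _ assms(2)])
    have "Suc ?e = 2 * D ^ h - 1" using D1 by simp
    moreover have "(2 * D ^ h - 1) * D = 2 * D ^ Suc h - D" by (simp add: diff_mult_distrib mult.commute[of D] mult.assoc)
    ultimately show "Suc ?e * D \<le> 2 * D ^ Suc h - 2" using assms(3) by simp
  qed
  finally show ?case using assms by (simp add: mult_right_mono psi_nonneg perc_nonneg)
qed simp

text \<open>Converts p_h < 1/n into a lower bound of order ln n for D^h.\<close>

lemma perc_lower:
  assumes "0 < lam" "2 \<le> D"
  shows "\<exists>c>0. \<forall>h. exp (- c * real D ^ h) \<le> perc D lam h"
proof -
  \<comment> \<open>With this \<open>k\<close>, \<open>psi_lower\<close> gives x_(h+1) >= k x_h^D,
    and then y = k x satisfies y_(h+1) >= y_h^D, because k^D <= k^2 for k < 1 and D >= 2.\<close>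
  define k where "k = min (1/2) (exp (- lam) * lam ^ D / fact D)"
  have k: "0 < k" "k < 1" using assms by (auto simp: k_def)
  have *: "k ^ (D ^ h) \<le> k * perc D lam h" for h
  proof (induction h)
    case (Suc h)
    let ?x = "perc D lam h"
    have x: "0 \<le> ?x" "?x \<le> 1" using assms perc_bounds[of lam D h] by auto
    have "k ^ (D ^ Suc h) = (k ^ (D ^ h)) ^ D" by (simp add: mult.commute flip: power_mult)
    also have "\<dots> \<le> (k * ?x) ^ D" using Suc k by (intro power_mono) auto
    also have "\<dots> = k ^ D * ?x ^ D" by (rule power_mult_distrib)
    also have "\<dots> \<le> k ^ 2 * ?x ^ D"
      using k x assms by (intro mult_right_mono power_decreasing) auto
    also have "\<dots> = k * (k * ?x ^ D)" by (simp add: power2_eq_square)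
    also have "k * ?x ^ D \<le> exp (- lam) * lam ^ D / fact D * ?x ^ D"
      using x by (intro mult_right_mono) (auto simp: k_def)
    also have "\<dots> = (lam * ?x) ^ D / fact D * exp (- lam)" by (simp add: power_mult_distrib)
    also have "\<dots> \<le> (lam * ?x) ^ D / fact D * exp (- (lam * ?x))"
      using x assms by (intro mult_left_mono) (auto simp: mult_le_cancel_left2)
    also have "\<dots> \<le> psi D (lam * ?x)" using x assms by (intro psi_lower) auto
    finally show ?case using k by simp
  qed (use k in simp)
  show ?thesis
  proof (intro exI[of _ "- ln k"] conjI allI)
    fix h
    have "exp (- (- ln k) * real D ^ h) = k ^ (D ^ h)"
      using k by (metis exp_ln exp_of_nat_mult minus_minus mult.commute of_nat_power)
    also have "\<dots> \<le> k * perc D lam h" by (rule *)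
    also have "\<dots> \<le> 1 * perc D lam h" using k assms by (intro mult_right_mono) (auto simp: perc_nonneg)
    finally show "exp (- (- ln k) * real D ^ h) \<le> perc D lam h" by simp
  qed (use k in simp)
qed

lemma perc_pos: "0 < lam \<Longrightarrow> 2 \<le> D \<Longrightarrow> 0 < perc D lam h"
  using perc_lower[of lam D] by (meson exp_gt_zero less_le_trans)

lemma continuous_psi: "continuous_on A (psi D)"
  unfolding psi_def by (intro continuous_intros) auto

text \<open>The limit exists by monotonicity and is a fixed point in [0, 1], which
  \<open>sub\<close> forces to be 0.\<close>

lemma perc_tendsto_0:
  assumes lam: "0 < lam" and sub: "\<And>p. 0 < p \<Longrightarrow> p \<le> 1 \<Longrightarrow> psi D (lam * p) < p"
  shows "perc D lam \<longlonglongrightarrow> 0"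
proof -
  have "convergent (perc D lam)"
  proof (rule Bseq_monoseq_convergent)
    show "Bseq (perc D lam)" using perc_bounds[of lam D] lam by (intro BseqI'[of _ 1]) auto
    show "monoseq (perc D lam)" using perc_antimono_Suc[of lam D] lam by (intro decseq_imp_monoseq decseq_SucI) auto
  qed
  then obtain l where l: "perc D lam \<longlonglongrightarrow> l" by (auto simp: convergent_def)
  have l0: "0 \<le> l" by (rule LIMSEQ_le_const[OF l]) (use lam perc_nonneg in auto)
  have l1: "l \<le> 1" by (rule LIMSEQ_le_const2[OF l]) (use lam perc_le_1 in auto)
  have "(\<lambda>h. psi D (lam * perc D lam h)) \<longlonglongrightarrow> psi D (lam * l)"
    by (intro continuous_on_tendsto_compose[OF continuous_psi[of UNIV]] tendsto_intros l) auto
  then have "(\<lambda>h. perc D lam (Suc h)) \<longlonglongrightarrow> psi D (lam * l)" by simp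
  with LIMSEQ_Suc[OF l] have "l = psi D (lam * l)" using LIMSEQ_unique by blast
  with sub[of l] l0 l1 have "l = 0" by force
  with l show ?thesis by simp
qed

lemma perc_double_exp:
  assumes lam: "0 < lam" and D: "2 \<le> D" and sub: "\<And>p. 0 < p \<Longrightarrow> p \<le> 1 \<Longrightarrow> psi D (lam * p) < p"
  shows "\<exists>h0. \<forall>k. perc D lam (h0 + k) \<le> exp (- (real D ^ k))"
proof -
  \<comment> \<open>\<open>K\<close> turns x_(h+1) <= lam^D x_h^D into y_(h+1) <= y_h^D for y = K x,
    using K^2 <= K^D. The depth \<open>h0\<close> is one at which y is already below exp
    (-1).\<close>
  define K where "K = max 1 (lam ^ D)"
  have K: "1 \<le> K" "lam ^ D \<le> K" by (auto simp: K_def)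
  have "eventually (\<lambda>h. perc D lam h < exp (-1) / K) sequentially"
    using order_tendstoD(2)[OF perc_tendsto_0[OF lam sub], of "exp (-1) / K"] K by auto
  then obtain h0 where h0: "perc D lam h0 < exp (-1) / K" by (auto simp: eventually_sequentially)
  have *: "K * perc D lam (h0 + k) \<le> exp (- (real D ^ k))" for k
  proof (induction k)
    case 0 then show ?case using h0 K by (simp add: field_simps)
  next
    case (Suc k)
    let ?x = "perc D lam (h0 + k)"
    have x: "0 \<le> ?x" using lam by (simp add: perc_nonneg)
    have "K * perc D lam (h0 + Suc k) \<le> K * (lam * ?x) ^ D"
      using psi_upper_power[of "lam * ?x" D] lam K x by (auto intro!: mult_left_mono)
    also have "\<dots> = K * lam ^ D * ?x ^ D" by (simp add: power_mult_distrib)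
    also have "\<dots> \<le> K * K * ?x ^ D" using K x by (intro mult_right_mono mult_left_mono) auto
    also have "K * K \<le> K ^ D" using power_increasing[OF D K(1)] by (simp add: power2_eq_square)
    then have "K * K * ?x ^ D \<le> (K * ?x) ^ D" using x by (simp add: power_mult_distrib mult_right_mono)
    also have "\<dots> \<le> exp (- (real D ^ k)) ^ D" using Suc K x by (intro power_mono) auto
    also have "\<dots> = exp (- (real D ^ Suc k))" by (simp flip: exp_of_nat_mult)
    finally show ?case .
  qed
  have "perc D lam (h0 + k) \<le> exp (- (real D ^ k))" for k
  proof -
    have "1 * perc D lam (h0 + k) \<le> K * perc D lam (h0 + k)"
      using K lam by (intro mult_right_mono) (auto simp: perc_nonneg)
    with *[of k] show ?thesis by simp
  qed
  then show ?thesis by blast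
qed

text \<open>If psi D (lam p) >= p, then, as \<open>psi\<close> is at most 1, the intermediate value
  theorem yields a fixed point in [p, 1], and the supremum of the fixed points would be
  positive.\<close>

lemma p_star_eq_0D:
  assumes D: "2 \<le> D" and lam: "0 < lam" and ps: "p_star D lam = 0" and p: "0 < p" "p \<le> 1"
  shows "psi D (lam * p) < p"
proof (rule ccontr)
  assume neg: "\<not> psi D (lam * p) < p"
  let ?S = "{p::real. 0 \<le> p \<and> p = psi D (lam * p)}"
  have bdd: "bdd_above ?S"
  proof (rule bdd_aboveI[of _ 1])
    fix q assume "q \<in> ?S"
    then show "q \<le> 1" using psi_le_1[of "lam * q" D] lam by auto
  qed
  have cont: "continuous_on {p..1} (\<lambda>x. x - psi D (lam * x))"
    by (intro continuous_intros continuous_on_compose2[OF continuous_psi[of UNIV]]) auto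
  have "\<exists>x. p \<le> x \<and> x \<le> 1 \<and> x - psi D (lam * x) = 0"
    using psi_le_1[of lam D] lam p neg by (intro IVT' cont) auto
  then obtain x where x: "p \<le> x" "x = psi D (lam * x)" by auto
  then have "x \<in> ?S" using p by auto
  from cSup_upper[OF this bdd] show False using ps x p by (auto simp: p_star_def)
qed

text \<open>Turns the strict inequality into room: a fixed larger parameter that is still
  subcritical, below which every O(1/n) perturbation of \<open>lam\<close> eventually stays.\<close>

lemma lambda_crit_D:
  assumes D: "2 \<le> D" and lam: "lam < lambda_crit D"
  shows "\<exists>lam'>max lam 0. \<forall>p. 0 < p \<longrightarrow> p \<le> 1 \<longrightarrow> psi D (lam' * p) < p"
proof -
  let ?S = "{lam::real. 0 < lam \<and> p_star D lam = 0}"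
  \<comment> \<open>The real \<open>Sup\<close> is meaningful only for nonempty sets that are
    bounded above. The value 1/2 shows that the set is nonempty; if it is unbounded, it has an
    element above \<open>lam\<close> anyway.\<close>
  have "p_star D (1/2) = 0"
  proof -
    have "{p::real. 0 \<le> p \<and> p = psi D (1/2 * p)} = {0}"
    proof (intro equalityI subsetI, simp_all)
      fix p :: real assume p: "0 \<le> p \<and> p = psi D (p / 2)"
      then have p1: "p \<le> 1" using psi_le_1[of "p/2" D] by simp
      have "p \<le> (p / 2) ^ D" using psi_upper_power[of "p/2" D] p by simp
      also have "\<dots> \<le> (p / 2) ^ 1" using D p p1 by (intro power_decreasing) auto
      finally show "p = 0" using p by simp
    qed (use D in \<open>simp add: psi_at_0\<close>)
    then show ?thesis by (simp add: p_star_def)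
  qed
  then have ne: "1/2 \<in> ?S" by simp
  have "\<exists>l\<in>?S. lam < l"
  proof (cases "bdd_above ?S")
    case True
    then show ?thesis using less_cSup_iff[of ?S lam] ne lam unfolding lambda_crit_def by blast
  next
    case False
    then show ?thesis by (meson bdd_above.I linorder_not_le)
  qed
  then obtain l where "l \<in> ?S" "lam < l" by blast
  with p_star_eq_0D[OF D, of l] show ?thesis by (intro exI[of _ l]) auto
qed

section \<open>Disjoint occurrence of increasing events\<close>

text \<open>Graphs become edge sets, so that increasing events are up-closed families and witnesses
  are sets of edges; \<open>prob_gnp\<close> leads back to \<open>gnp\<close>.\<close>

definition random_subset :: "'e set \<Rightarrow> real \<Rightarrow> 'e set pmf" where
  "random_subset E p = map_pmf Collect (Pi_pmf E False (\<lambda>_. bernoulli_pmf p))"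

lemma random_subset_empty: "random_subset {} p = return_pmf {}"
  by (simp add: random_subset_def)

lemma set_pmf_random_subset: "finite E \<Longrightarrow> S \<in> set_pmf (random_subset E p) \<Longrightarrow> S \<subseteq> E"
  using set_Pi_pmf_subset[of E False "\<lambda>_. bernoulli_pmf p"] by (fastforce simp: random_subset_def)

lemma finite_set_pmf_random_subset: "finite E \<Longrightarrow> finite (set_pmf (random_subset E p))"
proof -
  assume E: "finite E"
  have "set_pmf (random_subset E p) \<subseteq> Pow E" by (rule subsetI) (rule PowI, rule set_pmf_random_subset[OF E])
  then show ?thesis using E by (simp add: finite_subset)
qed

lemma prob_bind_pmf:
  "measure_pmf.prob (bind_pmf M f) A = measure_pmf.expectation M (\<lambda>x. measure_pmf.prob (f x) A)"
  unfolding measure_pmf_bind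
  by (rule measure_pmf.measure_bind[where N = "count_space UNIV"]) (use measurable_measure_pmf[of f] in auto)

lemma prob_random_subset_insert:
  assumes "finite E" "e \<notin> E" "0 \<le> p" "p \<le> 1"
  shows "measure_pmf.prob (random_subset (insert e E) p) A =
    p * measure_pmf.prob (random_subset E p) {S. insert e S \<in> A} +
    (1 - p) * measure_pmf.prob (random_subset E p) A"
proof -
  let ?P = "Pi_pmf E False (\<lambda>_. bernoulli_pmf p)"
  have eq: "random_subset (insert e E) p =
     bernoulli_pmf p \<bind> (\<lambda>y. map_pmf (\<lambda>S. if y then insert e S else S) (random_subset E p))"
  proof -
    have "map_pmf (\<lambda>f. Collect (f(e := y))) ?P = map_pmf (\<lambda>S. if y then insert e S else S) (random_subset E p)" for y
      unfolding random_subset_def pmf.map_comp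
    proof (rule map_pmf_cong[OF refl])
      fix f assume "f \<in> set_pmf ?P"
      then have "\<not> f e" using assms set_Pi_pmf_subset[of E False "\<lambda>_. bernoulli_pmf p"] by auto
      then show "Collect (f(e := y)) = ((\<lambda>S. if y then insert e S else S) \<circ> Collect) f" by (cases y) (auto split: if_splits)
    qed
    then show ?thesis
      by (simp add: random_subset_def[of "insert e E"] Pi_pmf_insert' assms map_bind_pmf map_pmf_def[symmetric] map_pmf_comp)
  qed
  show ?thesis unfolding eq
    using assms by (simp add: prob_bind_pmf vimage_def mult.commute)
qed

definition upclosed :: "'e set set \<Rightarrow> bool" where
  "upclosed A \<longleftrightarrow> (\<forall>S T. S \<in> A \<longrightarrow> S \<subseteq> T \<longrightarrow> T \<in> A)"

text \<open>For an increasing event a set certifies the event exactly when it belongs to it, so this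
  is the usual disjoint occurrence with \<open>S\<close> and \<open>T\<close> as the
  certificates.\<close>

definition disj_occ :: "'e set set \<Rightarrow> 'e set set \<Rightarrow> 'e set set" where
  "disj_occ A B = {w. \<exists>S T. S \<in> A \<and> T \<in> B \<and> S \<inter> T = {} \<and> S \<union> T \<subseteq> w}"

lemma disj_occI: "S \<in> A \<Longrightarrow> T \<in> B \<Longrightarrow> S \<inter> T = {} \<Longrightarrow> S \<subseteq> w \<Longrightarrow> T \<subseteq> w \<Longrightarrow> w \<in> disj_occ A B"
  unfolding disj_occ_def by blast

lemma upclosedD: "upclosed A \<Longrightarrow> S \<in> A \<Longrightarrow> S \<subseteq> T \<Longrightarrow> T \<in> A"
  unfolding upclosed_def by blast

lemma upclosed_disj_occ [simp]: "upclosed (disj_occ A B)"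
  unfolding upclosed_def disj_occ_def by blast

lemma upclosed_UNIV [simp]: "upclosed UNIV" and upclosed_empty [simp]: "upclosed {}"
  by (auto simp: upclosed_def)

lemma upclosed_Un: "upclosed A \<Longrightarrow> upclosed B \<Longrightarrow> upclosed (A \<union> B)"
  unfolding upclosed_def by blast

lemma disj_occ_mono: "A \<subseteq> A' \<Longrightarrow> B \<subseteq> B' \<Longrightarrow> disj_occ A B \<subseteq> disj_occ A' B'"
  unfolding disj_occ_def by blast

text \<open>This form iterates to "at least \<open>k\<close> of the events occur disjointly". In the induction step the slices
  \<open>D\<^sub>0 \<subseteq> D\<^sub>1\<close> of the event in the direction of \<open>e\<close> lie below the intersection and the union of the two
  mixed events, so the sum of their probabilities is at most that of the mixed events.\<close>
theorem van_den_Berg_Kesten_Un: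
  assumes "finite E" "0 \<le> p" "p \<le> 1" "upclosed A" "upclosed B" "upclosed B'" "B \<subseteq> B'"
  shows "measure_pmf.prob (random_subset E p) (B \<union> disj_occ A B') \<le>
    (1 - measure_pmf.prob (random_subset E p) A) * measure_pmf.prob (random_subset E p) B +
    measure_pmf.prob (random_subset E p) A * measure_pmf.prob (random_subset E p) B'"
  using assms
proof (induction E arbitrary: A B B' rule: finite_induct)
  case empty
  have "upclosed A \<Longrightarrow> {} \<in> disj_occ A B' \<longleftrightarrow> {} \<in> A \<and> {} \<in> B'" by (auto simp: disj_occ_def)
  with empty show ?case by (auto simp: random_subset_empty measure_return_pmf indicator_def)
next
  case (insert e E)
  let ?P = "measure_pmf.prob (random_subset E p)"
  let ?s = "\<lambda>X. {S. insert e S \<in> X}"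
  let ?F = "\<lambda>A B B'. B \<union> disj_occ A B'"
  let ?f = "\<lambda>A B B'. (1 - ?P A) * ?P B + ?P A * ?P B'"
  have up: "upclosed (?s X)" "X \<subseteq> ?s X" if "upclosed X" for X
    using that unfolding upclosed_def by (blast intro: insert_mono)+
  note ups = insert.prems(3,4,5) up(1)[OF insert.prems(3)] up(1)[OF insert.prems(4)] up(1)[OF insert.prems(5)]
  have subB: "?s B \<subseteq> ?s B'" using insert.prems by blast
  note IH = insert.IH[OF insert.prems(1,2)]
  have IH00: "?P (?F A B B') \<le> ?f A B B'"
   and IH11: "?P (?F (?s A) (?s B) (?s B')) \<le> ?f (?s A) (?s B) (?s B')"
   and IH01: "?P (?F A (?s B) (?s B')) \<le> ?f A (?s B) (?s B')"
   and IH10: "?P (?F (?s A) B B') \<le> ?f (?s A) B B'"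
    using IH ups subB insert.prems(6) by blast+
  let ?D1 = "?s (?F A B B')"
  \<comment> \<open>The two witnesses are disjoint, so at most one of them uses \<open>e\<close>,
    and \<open>e\<close> can be granted to that one alone.\<close>
  have split: "insert e S \<in> disj_occ A B' \<Longrightarrow> S \<in> disj_occ A (?s B') \<union> disj_occ (?s A) B'" for S
  proof -
    assume "insert e S \<in> disj_occ A B'"
    then obtain T1 T2 where T: "T1 \<in> A" "T2 \<in> B'" "T1 \<inter> T2 = {}" "T1 \<union> T2 \<subseteq> insert e S"
      by (auto simp: disj_occ_def)
    show ?thesis
    proof (cases "e \<in> T1")
      case False
      then have "T2 - {e} \<in> ?s B'" "T1 \<subseteq> S" "T2 - {e} \<subseteq> S"
        using T upclosedD[OF insert.prems(5), of T2 "insert e (T2 - {e})"] by auto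
      then have "S \<in> disj_occ A (?s B')" using T by (intro disj_occI[of T1 _ "T2 - {e}"]) auto
      then show ?thesis by blast
    next
      case True
      then have "T1 - {e} \<in> ?s A" "T2 \<subseteq> S" "T1 - {e} \<subseteq> S"
        using T upclosedD[OF insert.prems(3), of T1 "insert e (T1 - {e})"] by auto
      then have "S \<in> disj_occ (?s A) B'" using T by (intro disj_occI[of "T1 - {e}" _ T2]) auto
      then show ?thesis by blast
    qed
  qed
  have union: "?D1 \<subseteq> ?F A (?s B) (?s B') \<union> ?F (?s A) B B'" using split by blast
  have inter: "?F A B B' \<subseteq> ?F A (?s B) (?s B') \<inter> ?F (?s A) B B'"
    using up(2)[OF insert.prems(3)] up(2)[OF insert.prems(4)] up(2)[OF insert.prems(5)]
      disj_occ_mono[of A A B' "?s B'"] disj_occ_mono[of A "?s A" B' B'] by blast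
  have D1: "?D1 \<subseteq> ?F (?s A) (?s B) (?s B')"
    using union disj_occ_mono[of A "?s A" "?s B'" "?s B'"] disj_occ_mono[of "?s A" "?s A" "B'" "?s B'"]
     up(2)[OF insert.prems(3)] up(2)[OF insert.prems(4)] up(2)[OF insert.prems(5)] by blast
  have "?P (?F A B B') + ?P ?D1 \<le> ?P (?F A (?s B) (?s B') \<inter> ?F (?s A) B B') + ?P (?F A (?s B) (?s B') \<union> ?F (?s A) B B')"
    using union inter by (intro add_mono measure_pmf.finite_measure_mono) auto
  also have "\<dots> = ?P (?F A (?s B) (?s B')) + ?P (?F (?s A) B B')"
    using measure_pmf.finite_measure_Union'[of "?F A (?s B) (?s B')" "random_subset E p" "?F (?s A) B B'"]
      measure_pmf.finite_measure_Diff'[of "?F (?s A) B B'" "random_subset E p" "?F A (?s B) (?s B')"]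
    by (simp add: Int_commute)
  also have "\<dots> \<le> ?f A (?s B) (?s B') + ?f (?s A) B B'" using IH01 IH10 by linarith
  finally have mixed: "?P (?F A B B') + ?P ?D1 \<le> ?f A (?s B) (?s B') + ?f (?s A) B B'" .
  have D1': "?P ?D1 \<le> ?f (?s A) (?s B) (?s B')"
    using measure_pmf.finite_measure_mono[OF D1, of "random_subset E p"] IH11 by simp
  have p: "0 \<le> p" "0 \<le> 1 - p" using insert.prems by auto
  \<comment> \<open>The weights are those of two independent copies of \<open>e\<close>, one for
    \<open>A\<close> and one for \<open>B\<close> and \<open>B'\<close>. After the induction
    hypotheses the right-hand side therefore factors into probabilities over
    \<open>insert e E\<close>.\<close>
  have "p * ?P ?D1 + (1 - p) * ?P (?F A B B') =
      p * p * ?P ?D1 + (1 - p) * (1 - p) * ?P (?F A B B') + p * (1 - p) * (?P (?F A B B') + ?P ?D1)"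
    by algebra
  also have "\<dots> \<le> p * p * ?f (?s A) (?s B) (?s B') + (1 - p) * (1 - p) * ?f A B B' +
      p * (1 - p) * (?f A (?s B) (?s B') + ?f (?s A) B B')"
    using p by (intro add_mono mult_left_mono D1' IH00 mixed mult_nonneg_nonneg) auto
  also have "\<dots> = (1 - (p * ?P (?s A) + (1 - p) * ?P A)) * (p * ?P (?s B) + (1 - p) * ?P B) +
     (p * ?P (?s A) + (1 - p) * ?P A) * (p * ?P (?s B') + (1 - p) * ?P B')"
    by algebra
  finally show ?case
    using insert.prems insert.hyps by (simp add: prob_random_subset_insert)
qed

corollary van_den_Berg_Kesten:
  assumes "finite E" "0 \<le> p" "p \<le> 1" "upclosed A" "upclosed B"
  shows "measure_pmf.prob (random_subset E p) (disj_occ A B) \<le>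
    measure_pmf.prob (random_subset E p) A * measure_pmf.prob (random_subset E p) B"
  using van_den_Berg_Kesten_Un[OF assms(1-4) upclosed_empty assms(5)] by simp

text \<open>\<open>occ k As\<close>: at least \<open>k\<close> of the events \<open>As\<close> occur disjointly.\<close>
fun occ :: "nat \<Rightarrow> 'e set set list \<Rightarrow> 'e set set" where
  "occ 0 As = UNIV"
| "occ (Suc k) [] = {}"
| "occ (Suc k) (A # As) = occ (Suc k) As \<union> disj_occ A (occ k As)"

lemma upclosed_occ [simp]: "upclosed (occ k As)"
  by (induction k As rule: occ.induct) (auto intro: upclosed_Un)

lemma occ_antimono: "occ (Suc k) As \<subseteq> occ k As"
proof (induction As arbitrary: k)
  case (Cons A As)
  show ?case
  proof (cases k)
    case (Suc j)
    then show ?thesis using Cons[of "Suc j"] disj_occ_mono[OF subset_refl Cons[of j], of A] by auto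
  qed simp
qed simp

text \<open>An event of probability at most 1 - exp (-m) is dominated by a Poisson variable of mean
  m being nonzero, and the means add up; \<open>psi_add_ge\<close> is the step that adds one
  event.\<close>

lemma prob_occ_le:
  assumes "finite E" "0 \<le> p" "p \<le> 1" "0 \<le> m"
    and "\<And>A. A \<in> set As \<Longrightarrow> upclosed A"
    and "\<And>A. A \<in> set As \<Longrightarrow> measure_pmf.prob (random_subset E p) A \<le> 1 - exp (- m)"
  shows "measure_pmf.prob (random_subset E p) (occ k As) \<le> psi k (real (length As) * m)"
  using assms(5,6)
proof (induction As arbitrary: k)
  case Nil
  then show ?case by (cases k) (auto simp: psi_at_0)
next
  case (Cons A As)
  show ?case
  proof (cases k)
    case (Suc j)
    let ?P = "measure_pmf.prob (random_subset E p)"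
    let ?x = "real (length As) * m"
    have IH: "?P (occ i As) \<le> psi i ?x" for i using Cons by simp
    have a: "?P A \<le> 1 - exp (- m)" "upclosed A" using Cons.prems by auto
    have "?P (occ k (A # As)) \<le> (1 - ?P A) * ?P (occ (Suc j) As) + ?P A * ?P (occ j As)"
      unfolding Suc occ.simps
      by (rule van_den_Berg_Kesten_Un[OF assms(1-3) a(2)]) (auto simp: occ_antimono)
    also have "\<dots> \<le> (1 - ?P A) * psi (Suc j) ?x + ?P A * psi j ?x"
      using IH by (intro add_mono mult_left_mono) auto
    also have "\<dots> = psi (Suc j) ?x + ?P A * (psi j ?x - psi (Suc j) ?x)" by algebra
    also have "\<dots> \<le> psi (Suc j) ?x + (1 - exp (- m)) * (psi j ?x - psi (Suc j) ?x)"
      using a psi_antimono[of ?x j] assms(4) by (intro add_left_mono mult_right_mono) auto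
    also have "\<dots> = exp (- m) * psi (Suc j) ?x + (1 - exp (- m)) * psi j ?x" by algebra
    also have "\<dots> \<le> psi (Suc j) (?x + m)" using assms(4) by (intro psi_add_ge) auto
    finally show ?thesis by (simp add: Suc algebra_simps)
  qed simp
qed

lemma occ_mapI:
  assumes "distinct xs" "I \<subseteq> set xs" "card I = k"
    and "\<And>i. i \<in> I \<Longrightarrow> W i \<in> F i" "\<And>i. i \<in> I \<Longrightarrow> W i \<subseteq> w"
    and "\<And>i j. i \<in> I \<Longrightarrow> j \<in> I \<Longrightarrow> i \<noteq> j \<Longrightarrow> W i \<inter> W j = {}"
  shows "w \<in> occ k (map F xs)"
  using assms
proof (induction xs arbitrary: I k w)
  case Nil
  then show ?case by simp
next
  case (Cons x xs)
  have finI: "finite I" using Cons.prems(2) finite_subset by blast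
  show ?case
  proof (cases k)
    case (Suc j)
    show ?thesis
    proof (cases "x \<in> I")
      case True
      have "(\<Union>i\<in>I - {x}. W i) \<in> occ j (map F xs)"
        using Cons.prems True finI Suc by (intro Cons.IH[of "I - {x}"]) auto
      then have "w \<in> disj_occ (F x) (occ j (map F xs))"
        using Cons.prems True by (intro disj_occI[of "W x" _ "\<Union>i\<in>I - {x}. W i"]) fastforce+
      then show ?thesis by (simp add: Suc)
    next
      case False
      have "w \<in> occ k (map F xs)"
        using Cons.prems False by (intro Cons.IH[of I]) auto
      then show ?thesis by (simp add: Suc)
    qed
  qed simp
qed

section \<open>Events of the random graph and their Poisson bounds\<close>

text \<open>A graph is represented by its set of edges, in the same encoding as in \<open>gnp\<close>.\<close>
definition edge :: "nat \<Rightarrow> nat \<Rightarrow> nat \<times> nat" where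
  "edge u v = (min u v, max u v)"

definition all_edges :: "nat \<Rightarrow> (nat \<times> nat) set" where
  "all_edges n = {(i, j). i < j \<and> j < n}"

lemma finite_all_edges [simp]: "finite (all_edges n)"
  by (rule finite_subset[of _ "{..<n} \<times> {..<n}"]) (auto simp: all_edges_def)

definition has_edge :: "nat \<Rightarrow> nat \<Rightarrow> (nat \<times> nat) set set" where
  "has_edge u v = {w. edge u v \<in> w}"

lemma upclosed_has_edge [simp]: "upclosed (has_edge u v)"
  by (auto simp: upclosed_def has_edge_def)

lemma prob_mem_random_subset:
  assumes "finite E" "0 \<le> p" "p \<le> 1"
  shows "measure_pmf.prob (random_subset E p) {w. e \<in> w} = (if e \<in> E then p else 0)"
proof (cases "e \<in> E")
  case True
  have "measure_pmf.prob (random_subset (insert e (E - {e})) p) {w. e \<in> w} = p + (1 - p) * measure_pmf.prob (random_subset (E - {e}) p) {w. e \<in> w}"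
    using assms by (subst prob_random_subset_insert) auto
  moreover have "measure_pmf.prob (random_subset (E - {e}) p) {w. e \<in> w} = 0"
    using assms set_pmf_random_subset[of "E - {e}"] by (fastforce simp: measure_pmf_zero_iff)
  ultimately show ?thesis using True by (simp add: insert_absorb)
next
  case False
  then show ?thesis using assms set_pmf_random_subset[of E] by (fastforce simp: measure_pmf_zero_iff)
qed

lemma prob_has_edge_le:
  assumes "finite E" "0 \<le> p" "p \<le> 1"
  shows "measure_pmf.prob (random_subset E p) (has_edge u v) \<le> p"
  using assms by (simp add: has_edge_def prob_mem_random_subset)

text \<open>The edge-disjoint relaxation of "\<open>v\<close> is the root of a complete tree of depth \<open>h\<close>".\<close>
primrec tree_ev :: "nat \<Rightarrow> nat \<Rightarrow> nat \<Rightarrow> nat \<Rightarrow> (nat \<times> nat) set set" where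
  "tree_ev D n 0 = (\<lambda>v. UNIV)"
| "tree_ev D n (Suc h) = (\<lambda>v. occ D (map (\<lambda>u. disj_occ (has_edge v u) (tree_ev D n h u)) [0..<n]))"

lemma upclosed_tree_ev [simp]: "upclosed (tree_ev D n h v)"
  by (cases h) auto

text \<open>The increase over \<open>lam\<close> pays for dominating a Bernoulli variable by a Poisson one.\<close>
definition lam_up :: "real \<Rightarrow> nat \<Rightarrow> real" where
  "lam_up lam n = (1 + 2 * lam / real n) * lam"

text \<open>Put s = lam / n and let x be the exponent. Then 1 - exp (-x) >= x (1 - x/2) >= x (1 -
  s), and the 2 in \<open>lam_up\<close> is chosen so that (1 + 2 s) (1 - s) >= 1 for s <=
  1/2.\<close>

lemma lam_up_ineq:
  assumes "0 < lam" "2 * lam \<le> real n" "0 \<le> q" "q \<le> 1"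
  shows "lam / real n * q \<le> 1 - exp (- (lam_up lam n * q / real n))"
proof -
  have n: "real n > 0" using assms by linarith
  define x where "x = lam_up lam n * q / real n"
  have r: "2 * lam / real n \<le> 1" using assms n by (simp add: divide_le_eq)
  have lu: "lam_up lam n \<le> 2 * lam" unfolding lam_up_def using r assms by (intro mult_right_mono) auto
  have lu0: "0 \<le> lam_up lam n" using assms n by (simp add: lam_up_def)
  have "lam_up lam n * q \<le> 2 * lam * 1" using lu lu0 assms by (intro mult_mono) auto
  then have x: "0 \<le> x" "x / 2 \<le> lam / real n"
    using assms n lu0 by (auto simp: x_def field_simps)
  have "exp (- x) \<le> 1 - x + x\<^sup>2 / 2"
  proof -
    have "(\<lambda>x. 1 - x + x\<^sup>2 / 2 - exp (- x)) 0 \<le> (\<lambda>x::real. 1 - x + x\<^sup>2 / 2 - exp (- x)) x"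
    proof (rule DERIV_nonneg_imp_nondecreasing[OF x(1)])
      fix t :: real
      have "((\<lambda>x. 1 - x + x\<^sup>2 / 2 - exp (- x)) has_real_derivative (- 1 + t + exp (- t))) (at t)"
        by (auto intro!: derivative_eq_intros)
      moreover have "0 \<le> - 1 + t + exp (- t)" using exp_ge_add_one_self[of "- t"] by simp
      ultimately show "\<exists>y. ((\<lambda>x. 1 - x + x\<^sup>2 / 2 - exp (- x)) has_real_derivative y) (at t) \<and> 0 \<le> y" by blast
    qed
    then show ?thesis by simp
  qed
  then have 1: "x * (1 - x / 2) \<le> 1 - exp (- x)" by (simp add: power2_eq_square algebra_simps)
  have "x * (1 - lam / real n) \<le> x * (1 - x / 2)" using x by (intro mult_left_mono) auto
  moreover have "lam / real n * q * 1 \<le> lam / real n * q * ((1 + 2 * lam / real n) * (1 - lam / real n))"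
  proof (rule mult_left_mono)
    define s where "s = lam / real n"
    have s: "2 * lam / real n = 2 * s" "0 \<le> s" using assms n by (auto simp: s_def)
    have "0 \<le> s * (1 - 2 * s)" using r s by simp
    also have "\<dots> = (1 + 2 * lam / real n) * (1 - lam / real n) - 1"
      unfolding s(1) s_def[symmetric] by algebra
    finally show "1 \<le> (1 + 2 * lam / real n) * (1 - lam / real n)" by simp
  qed (use assms n in auto)
  moreover have "lam / real n * q * ((1 + 2 * lam / real n) * (1 - lam / real n)) = x * (1 - lam / real n)"
    by (simp add: x_def lam_up_def)
  ultimately have "lam / real n * q \<le> 1 - exp (- x)" using 1 by linarith
  then show ?thesis by (simp only: x_def)
qed

text \<open>The edge to a child and the subtree below it are required disjointly, so one child costs
  at most (lam / n) q. The number \<open>k\<close> is free because overlapping pairs need D - 1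
  children or 1 child instead of D.\<close>

lemma prob_children_le:
  assumes "0 < lam" "2 * lam \<le> real n" "finite E"
    and q: "0 \<le> q" "q \<le> 1" "\<And>u. measure_pmf.prob (random_subset E (lam / real n)) (tree_ev D n h u) \<le> q"
  shows "measure_pmf.prob (random_subset E (lam / real n))
     (occ k (map (\<lambda>u. disj_occ (has_edge v u) (tree_ev D n h u)) [0..<n])) \<le> psi k (lam_up lam n * q)"
proof -
  have n: "real n > 0" using assms by linarith
  let ?p = "lam / real n"
  have p: "0 \<le> ?p" "?p \<le> 1" using assms n by (auto simp: divide_le_eq)
  let ?m = "lam_up lam n * q / real n"
  have m: "0 \<le> ?m" using assms n by (auto simp: lam_up_def)
  have "measure_pmf.prob (random_subset E ?p) (disj_occ (has_edge v u) (tree_ev D n h u)) \<le> 1 - exp (- ?m)" for u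
  proof -
    have "measure_pmf.prob (random_subset E ?p) (disj_occ (has_edge v u) (tree_ev D n h u))
       \<le> measure_pmf.prob (random_subset E ?p) (has_edge v u) * measure_pmf.prob (random_subset E ?p) (tree_ev D n h u)"
      by (rule van_den_Berg_Kesten) (use assms p in auto)
    also have "\<dots> \<le> ?p * q" using assms p by (intro mult_mono prob_has_edge_le) auto
    also have "\<dots> \<le> 1 - exp (- ?m)" using assms by (intro lam_up_ineq) auto
    finally show ?thesis .
  qed
  then have "measure_pmf.prob (random_subset E ?p)
     (occ k (map (\<lambda>u. disj_occ (has_edge v u) (tree_ev D n h u)) [0..<n])) \<le>
     psi k (real (length (map (\<lambda>u. disj_occ (has_edge v u) (tree_ev D n h u)) [0..<n])) * ?m)"
    by (intro prob_occ_le) (use assms p m in auto)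
  then show ?thesis using n by simp
qed

theorem prob_tree_ev_le:
  assumes "0 < lam" "2 * lam \<le> real n" "finite E"
  shows "measure_pmf.prob (random_subset E (lam / real n)) (tree_ev D n h v) \<le> perc D (lam_up lam n) h"
proof (induction h arbitrary: v)
  case (Suc h)
  have "0 \<le> lam_up lam n" using assms by (auto simp: lam_up_def)
  then show ?case using prob_children_le[OF assms _ _ Suc.IH] perc_bounds by simp
qed (simp add: measure_pmf.prob_le_1)

section \<open>The Galton--Watson measure\<close>

text \<open>Both Galton--Watson models below, \<open>GW_measure\<close> and the discrete
  \<open>gw\<close>, obtain their recursion from this thinning identity. Substituting d = j + k
  splits off the exponential series of lam (1 - q).\<close>

lemma poisson_thinning:
  assumes "0 < lam" "0 \<le> q" "q \<le> 1"
  shows "(\<lambda>d. pmf (poisson_pmf lam) d * (real (d choose k) * q ^ k * (1 - q) ^ (d - k)))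
           sums ((lam * q) ^ k / fact k * exp (- (lam * q)))" (is "?f sums _")
proof -
  have "(\<lambda>j. (lam * (1 - q)) ^ j / fact j) sums exp (lam * (1 - q))"
    using exp_converges[of "lam * (1 - q)"] by (simp add: divide_inverse mult.commute)
  then have "(\<lambda>j. (lam * q) ^ k / fact k * exp (- lam) * ((lam * (1 - q)) ^ j / fact j)) sums
      ((lam * q) ^ k / fact k * exp (- lam) * exp (lam * (1 - q)))" by (rule sums_mult)
  moreover have "(lam * q) ^ k / fact k * exp (- lam) * exp (lam * (1 - q)) = (lam * q) ^ k / fact k * exp (- (lam * q))"
    by (simp add: algebra_simps flip: exp_add)
  moreover have "?f (j + k) = (lam * q) ^ k / fact k * exp (- lam) * ((lam * (1 - q)) ^ j / fact j)" for j
  proof -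
    have b: "real (j + k choose k) = fact (j + k) / (fact k * fact j)"
      using binomial_fact[of k "j + k"] by simp
    define r where "r = 1 - q"
    show ?thesis unfolding r_def[symmetric] using assms
      by (simp add: b power_add power_mult_distrib field_simps)
  qed
  ultimately have "(\<lambda>j. ?f (j + k)) sums ((lam * q) ^ k / fact k * exp (- (lam * q)))" by (simp only:)
  then show ?thesis by (subst (asm) sums_zero_iff_shift) auto
qed

lemma gw_contains_Cons: "gw_contains D X h (i # u) = gw_contains D (\<lambda>w. X (i # w)) h u"
  by (induction h arbitrary: u) auto

lemma gw_contains_cong:
  assumes "\<And>w. w \<in> K \<Longrightarrow> X w = Y w" "\<And>w j. w \<in> K \<Longrightarrow> w @ [j] \<in> K" "u \<in> K"
  shows "gw_contains D X h u = gw_contains D Y h u"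
  using assms(3) by (induction h arbitrary: u) (auto simp: assms(1,2))

text \<open>\<open>K\<close> is general because independence of the subtrees requires measurability
  with respect to the coordinates of one subtree alone.\<close>

lemma measurable_gw_contains:
  fixes P :: "nat pmf"
  assumes "\<And>w j. w \<in> K \<Longrightarrow> w @ [j] \<in> K" "u \<in> K"
  shows "Measurable.pred (PiM K (\<lambda>_::nat list. measure_pmf P)) (\<lambda>X. gw_contains D X h u)"
  using assms(2)
proof (induction h arbitrary: u)
  case (Suc h)
  let ?M = "PiM K (\<lambda>_::nat list. measure_pmf P)"
  have [measurable]: "Measurable.pred ?M (\<lambda>X. gw_contains D X h (u @ [i]))" for i
    using Suc assms(1) by blast
  have X [measurable]: "(\<lambda>X. X u) \<in> measurable ?M (count_space UNIV)"
    using measurable_component_singleton[OF Suc.prems, of "\<lambda>_. measure_pmf P"]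
    by (simp add: measurable_def)
  \<comment> \<open>Sets of children are replaced by lists, so that the quantifier ranges over a
    countable type.\<close>
  have "(\<lambda>X. gw_contains D X (Suc h) u) =
     (\<lambda>X. \<exists>xs. distinct xs \<and> length xs = D \<and> (\<forall>i. i \<in> set xs \<longrightarrow> i < X u \<and> gw_contains D X h (u @ [i])))"
    (is "_ = ?g")
  proof (intro ext iffI)
    fix X assume "gw_contains D X (Suc h) u"
    then obtain S where S: "S \<subseteq> {..<X u}" "card S = D" "\<forall>i\<in>S. gw_contains D X h (u @ [i])" by auto
    then obtain xs where "set xs = S" "distinct xs"
      using finite_distinct_list[of S] finite_subset by blast
    then show "?g X" using S distinct_card[of xs] by (intro exI[of _ xs]) auto
  next
    fix X assume "?g X"
    then obtain xs where "distinct xs" "length xs = D" "\<forall>i. i \<in> set xs \<longrightarrow> i < X u \<and> gw_contains D X h (u @ [i])"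
      by blast
    then show "gw_contains D X (Suc h) u" by (auto intro!: exI[of _ "set xs"] simp: distinct_card)
  qed
  moreover have "Measurable.pred ?M ?g" by measurable
  ultimately show ?case by simp
qed simp

interpretation GW: prob_space "GW_measure lam" for lam
  unfolding GW_measure_def by (intro prob_space_PiM measure_pmf.prob_space_axioms)

lemma space_GW [simp]: "space (GW_measure lam) = UNIV"
  by (simp add: GW_measure_def space_PiM)

lemma GW_pred [measurable]: "Measurable.pred (GW_measure lam) (\<lambda>X. gw_contains D X h u)"
  unfolding GW_measure_def by (rule measurable_gw_contains) auto

lemma GW_component: "(\<lambda>X. X u) \<in> measurable (GW_measure lam) (count_space UNIV)"
  using measurable_component_singleton[of u UNIV "\<lambda>_. measure_pmf (poisson_pmf lam)"]
  by (simp add: measurable_def GW_measure_def)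

lemma GW_shift: "GW.prob lam {X. gw_contains D X h [i]} = p_tree D lam h"
proof -
  let ?M = "\<lambda>_::nat list. measure_pmf (poisson_pmf lam)"
  have d: "distr (PiM UNIV ?M) (PiM UNIV ?M) (\<lambda>X. \<lambda>n\<in>UNIV. X (i # n)) = PiM UNIV ?M"
    using distr_PiM_reindex[of UNIV ?M "\<lambda>w. i # w" UNIV] by (simp add: measure_pmf.prob_space_axioms)
  have m: "(\<lambda>X. \<lambda>n\<in>UNIV. X (i # n)) \<in> measurable (PiM UNIV ?M) (PiM UNIV ?M)"
    by (rule measurable_restrict) (auto intro: measurable_component_singleton)
  have "p_tree D lam h = measure (PiM UNIV ?M) {X. gw_contains D X h []}"
    by (simp add: p_tree_def) (simp add: GW_measure_def)
  also have "\<dots> = measure (distr (PiM UNIV ?M) (PiM UNIV ?M) (\<lambda>X. \<lambda>n\<in>UNIV. X (i # n))) {X. gw_contains D X h []}"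
    by (simp only: d)
  also have "\<dots> = measure (PiM UNIV ?M) {X. gw_contains D (\<lambda>w. X (i # w)) h []}"
    by (subst measure_distr[OF m])
       (use measurable_gw_contains[where K = UNIV and u = "[]" and P = "poisson_pmf lam" and D = D and h = h] in
         \<open>auto simp: pred_def space_PiM vimage_def restrict_def\<close>)
  also have "\<dots> = measure (PiM UNIV ?M) {X. gw_contains D X h [i]}"
    using gw_contains_Cons[of D _ h i "[]"] by simp
  finally show ?thesis by (simp add: GW_measure_def)
qed

lemma GW_prob_root: "GW.prob lam {X. X u = d} = pmf (poisson_pmf lam) d"
proof -
  let ?M = "\<lambda>_::nat list. measure_pmf (poisson_pmf lam)"
  have "distr (PiM UNIV ?M) (?M u) (\<lambda>X. X u) = ?M u"
    by (intro distr_PiM_component measure_pmf.prob_space_axioms) auto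
  then have "pmf (poisson_pmf lam) d = measure (distr (PiM UNIV ?M) (?M u) (\<lambda>X. X u)) {d}"
    by (simp add: pmf.rep_eq)
  also have "\<dots> = measure (PiM UNIV ?M) {X. X u = d}"
    by (subst measure_distr) (auto intro!: measurable_component_singleton simp: space_PiM vimage_def)
  finally show ?thesis by (simp add: GW_measure_def)
qed

text \<open>\<open>None\<close> stands for the root degree and \<open>Some i\<close> for the subtree
  at \<open>[i]\<close>. Every word carries a coordinate, whether or not the vertex exists, so
  independence holds for all i at once, irrespective of the degree.\<close>

lemma GW_indep:
  "GW.indep_vars lam (\<lambda>_. count_space UNIV)
     (\<lambda>j X. case j of None \<Rightarrow> X [] = d | Some i \<Rightarrow> gw_contains D X h [i]) UNIV"
proof -
  let ?M = "\<lambda>_::nat list. measure_pmf (poisson_pmf lam)"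
  let ?K = "case_option {[]} (\<lambda>i. range ((#) i))"
  let ?f = "\<lambda>j (X::nat list \<Rightarrow> nat). case j of None \<Rightarrow> X [] = d | Some i \<Rightarrow> gw_contains D X h [i]"
  have dc: "distr (PiM UNIV ?M) (?M i) (\<lambda>X. X i) = ?M i" for i
    by (intro distr_PiM_component measure_pmf.prob_space_axioms) auto
  have "GW.indep_vars lam ?M (\<lambda>i X. X i) UNIV"
    unfolding GW_measure_def
    by (subst prob_space.indep_vars_iff_distr_eq_PiM)
       (auto intro!: prob_space_PiM measure_pmf.prob_space_axioms measurable_component_singleton simp: dc restrict_def distr_id)
  then have "GW.indep_vars lam (\<lambda>j. PiM (?K j) ?M) (\<lambda>j X. restrict (\<lambda>i. X i) (?K j)) UNIV"
    by (rule GW.indep_vars_restrict) (auto simp: disjoint_family_on_def split: option.splits)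
  then have "GW.indep_vars lam (\<lambda>_. count_space UNIV) (\<lambda>j X. ?f j (restrict (\<lambda>i. X i) (?K j))) UNIV"
  proof (rule GW.indep_vars_compose2)
    fix j :: "nat option"
    show "?f j \<in> measurable (PiM (?K j) ?M) (count_space UNIV)"
    proof (cases j)
      case None
      have "(\<lambda>X. X []) \<in> measurable (PiM {[]} ?M) (count_space UNIV)"
        using measurable_component_singleton[of "[]" "{[]}" ?M] by (simp add: measurable_def)
      then show ?thesis using None by simp
    next
      case (Some i)
      have "Measurable.pred (PiM (range ((#) i)) ?M) (\<lambda>X. gw_contains D X h [i])"
        by (rule measurable_gw_contains) auto
      then show ?thesis using Some by simp
    qed
  qed
  moreover have "?f j (restrict (\<lambda>i. X i) (?K j)) = ?f j X" for j X
  proof (cases j)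
    case (Some i)
    have "gw_contains D (restrict X (range ((#) i))) h [i] = gw_contains D X h [i]"
      by (rule gw_contains_cong[of "range ((#) i)"]) auto
    then show ?thesis using Some by simp
  qed simp
  ultimately show ?thesis by simp
qed

text \<open>Prescribing the exact set of successful children makes the events disjoint, so that
  \<open>p_tree_Suc\<close> can add them up.\<close>

lemma GW_pattern:
  assumes "T \<subseteq> {..<d}"
  shows "GW.prob lam {X. X [] = d \<and> {i\<in>{..<d}. gw_contains D X h [i]} = T} =
     pmf (poisson_pmf lam) d * (p_tree D lam h ^ card T * (1 - p_tree D lam h) ^ (d - card T))"
proof -
  let ?f = "\<lambda>j (X::nat list \<Rightarrow> nat). case j of None \<Rightarrow> X [] = d | Some i \<Rightarrow> gw_contains D X h [i]"
  let ?A = "case_option {True} (\<lambda>i. {i \<in> T})"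
  let ?J = "insert None (Some ` {..<d})"
  let ?q = "p_tree D lam h"
  have "GW.prob lam (\<Inter>j\<in>?J. ?f j -` ?A j \<inter> space (GW_measure lam)) = (\<Prod>j\<in>?J. GW.prob lam (?f j -` ?A j \<inter> space (GW_measure lam)))"
    by (rule GW.indep_varsD[OF GW_indep]) auto
  also have "(\<Inter>j\<in>?J. ?f j -` ?A j \<inter> space (GW_measure lam)) = {X. X [] = d \<and> {i\<in>{..<d}. gw_contains D X h [i]} = T}"
    using assms by auto
  also have "(\<Prod>j\<in>?J. GW.prob lam (?f j -` ?A j \<inter> space (GW_measure lam))) =
     GW.prob lam {X. X [] = d} * (\<Prod>i<d. GW.prob lam {X. gw_contains D X h [i] = (i \<in> T)})"
    by (subst prod.insert) (auto simp: prod.reindex vimage_def)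
  also have "(\<Prod>i<d. GW.prob lam {X. gw_contains D X h [i] = (i \<in> T)}) = (\<Prod>i<d. if i \<in> T then ?q else 1 - ?q)"
  proof (intro prod.cong refl)
    fix i
    have "GW.prob lam {X. \<not> gw_contains D X h [i]} = 1 - GW.prob lam {X. gw_contains D X h [i]}"
      using GW.prob_compl[where A = "{X. gw_contains D X h [i]}" and lam = lam] GW_pred[where lam = lam and D = D and h = h and u = "[i]"]
      by (auto simp: pred_def Compl_eq_Diff_UNIV[symmetric] Collect_neg_eq)
    then show "GW.prob lam {X. gw_contains D X h [i] = (i \<in> T)} = (if i \<in> T then ?q else 1 - ?q)"
      by (auto simp: GW_shift)
  qed
  also have "\<dots> = ?q ^ card T * (1 - ?q) ^ (d - card T)"
  proof -
    have "{..<d} \<inter> {i. i \<in> T} = T" "{..<d} \<inter> - {i. i \<in> T} = {..<d} - T" using assms by auto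
    then show ?thesis using assms by (simp add: prod.If_cases card_Diff_subset finite_subset)
  qed
  finally show ?thesis by (simp add: GW_prob_root)
qed

lemma p_tree_Suc:
  assumes "0 < lam"
  shows "p_tree D lam (Suc h) = psi D (lam * p_tree D lam h)"
proof -
  let ?q = "p_tree D lam h"
  have q: "0 \<le> ?q" "?q \<le> 1" by (auto simp: p_tree_def)
  let ?N = "\<lambda>X. {i\<in>{..<X []}. gw_contains D X h [i]}"
  have iff: "gw_contains D X (Suc h) [] \<longleftrightarrow> \<not> card (?N X) < D" for X
  proof
    assume "gw_contains D X (Suc h) []"
    then obtain S where "S \<subseteq> ?N X" "card S = D" by auto
    then show "\<not> card (?N X) < D" using card_mono[of "?N X" S] by auto
  next
    assume "\<not> card (?N X) < D"
    then obtain S where "S \<subseteq> ?N X" "card S = D" using obtain_subset_with_card_n[of D "?N X"] by auto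
    then show "gw_contains D X (Suc h) []" by auto
  qed
  have meas_eq: "{X. X [] = d \<and> {i\<in>{..<d}. gw_contains D X h [i]} = T} \<in> sets (GW_measure lam)" for d T
  proof -
    note [measurable] = GW_component[of "[]" lam]
    have "Measurable.pred (GW_measure lam) (\<lambda>X. X [] = d \<and> (\<forall>i. (i < d \<and> gw_contains D X h [i]) = (i \<in> T)))"
      by measurable
    moreover have "{X. X [] = d \<and> {i\<in>{..<d}. gw_contains D X h [i]} = T} =
        {X. X [] = d \<and> (\<forall>i. (i < d \<and> gw_contains D X h [i]) = (i \<in> T))}"
      by (auto simp: set_eq_iff)
    ultimately show ?thesis by (simp add: pred_def)
  qed
  have Ed: "{X. X [] = d \<and> card (?N X) < D} =
     (\<Union>T\<in>{T. T \<subseteq> {..<d} \<and> card T < D}. {X. X [] = d \<and> {i\<in>{..<d}. gw_contains D X h [i]} = T})" for d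
    by auto
  have meas_d: "{X. X [] = d \<and> card (?N X) < D} \<in> sets (GW_measure lam)" for d
    unfolding Ed by (intro sets.finite_UN meas_eq) (auto intro: finite_subset[of _ "Pow {..<d}"])
  have card_T: "card {T. T \<subseteq> {..<d} \<and> card T = k} = d choose k" for d k
    using n_subsets[of "{..<d}" k] by simp
  \<comment> \<open>The complementary event involves only the finitely many counts k < D, so the
    series over the degree d can be summed separately for each k.\<close>
  have prob_d: "GW.prob lam {X. X [] = d \<and> card (?N X) < D} =
     (\<Sum>k<D. pmf (poisson_pmf lam) d * (real (d choose k) * ?q ^ k * (1 - ?q) ^ (d - k)))" for d
  proof -
    have "GW.prob lam {X. X [] = d \<and> card (?N X) < D} =
      (\<Sum>T\<in>{T. T \<subseteq> {..<d} \<and> card T < D}. GW.prob lam {X. X [] = d \<and> {i\<in>{..<d}. gw_contains D X h [i]} = T})"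
      unfolding Ed using meas_eq
      by (intro GW.finite_measure_finite_Union) (auto simp: disjoint_family_on_def intro: finite_subset[of _ "Pow {..<d}"])
    also have "\<dots> = (\<Sum>T\<in>{T. T \<subseteq> {..<d} \<and> card T < D}. pmf (poisson_pmf lam) d * (?q ^ card T * (1 - ?q) ^ (d - card T)))"
      by (intro sum.cong refl GW_pattern) auto
    also have "\<dots> = (\<Sum>k<D. \<Sum>T\<in>{T. T \<in> {T. T \<subseteq> {..<d} \<and> card T < D} \<and> card T = k}. pmf (poisson_pmf lam) d * (?q ^ card T * (1 - ?q) ^ (d - card T)))"
      by (subst sum.group) (auto intro: finite_subset[of _ "Pow {..<d}"])
    also have "\<dots> = (\<Sum>k<D. \<Sum>T\<in>{T. T \<subseteq> {..<d} \<and> card T = k}. pmf (poisson_pmf lam) d * (?q ^ k * (1 - ?q) ^ (d - k)))"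
      by (intro sum.cong) auto
    also have "\<dots> = (\<Sum>k<D. pmf (poisson_pmf lam) d * (real (d choose k) * ?q ^ k * (1 - ?q) ^ (d - k)))"
      by (simp add: card_T mult_ac)
    finally show ?thesis .
  qed
  have U: "(\<Union>d. {X. X [] = d \<and> card (?N X) < D}) = {X. card (?N X) < D}" by auto
  have "(\<lambda>d. GW.prob lam {X. X [] = d \<and> card (?N X) < D}) sums GW.prob lam {X. card (?N X) < D}"
    unfolding U[symmetric]
    by (rule GW.finite_measure_UNION) (use meas_d in \<open>auto simp: disjoint_family_on_def\<close>)
  moreover have "(\<lambda>d. GW.prob lam {X. X [] = d \<and> card (?N X) < D}) sums (\<Sum>k<D. (lam * ?q) ^ k / fact k * exp (- (lam * ?q)))"
    unfolding prob_d by (intro sums_sum poisson_thinning assms q)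
  ultimately have low: "GW.prob lam {X. card (?N X) < D} = (\<Sum>k<D. (lam * ?q) ^ k / fact k * exp (- (lam * ?q)))"
    by (rule sums_unique2)
  have "{X. card (?N X) < D} \<in> sets (GW_measure lam)"
    unfolding U[symmetric] by (intro sets.countable_UN) (use meas_d in auto)
  from GW.prob_compl[OF this] have "GW.prob lam {X. \<not> card (?N X) < D} = 1 - GW.prob lam {X. card (?N X) < D}"
    by (simp add: Compl_eq_Diff_UNIV[symmetric] Collect_neg_eq)
  moreover have "p_tree D lam (Suc h) = GW.prob lam {X. \<not> card (?N X) < D}"
    by (simp only: p_tree_def iff space_GW UNIV_I simp_thms)
  ultimately show ?thesis by (simp only: low psi_def)
qed

theorem p_tree_eq_perc: "0 < lam \<Longrightarrow> p_tree D lam h = perc D lam h"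
proof (induction h)
  case 0
  show ?case using GW.prob_space[of lam] by (simp add: p_tree_def)
qed (simp add: p_tree_Suc)

section \<open>Finite Galton--Watson trees\<close>

datatype 'a rtree = Nd (lab: 'a) (kids: "'a rtree list")

fun labels :: "'a rtree \<Rightarrow> 'a list" where
  "labels (Nd a ts) = a # concat (map labels ts)"

fun wf_depth :: "nat \<Rightarrow> 'a rtree \<Rightarrow> bool" where
  "wf_depth 0 (Nd a ts) = (ts = [])"
| "wf_depth (Suc r) (Nd a ts) = (\<forall>t\<in>set ts. wf_depth r t)"

text \<open>The vertices whose offspring number is revealed by exploring to depth r, childless ones
  included. Each contributes a factor exp (-lam) to the Galton--Watson probability and at most n
  vertex pairs to the exploration of the graph.\<close>

fun internals :: "nat \<Rightarrow> 'a rtree \<Rightarrow> 'a list" where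
  "internals 0 t = []"
| "internals (Suc r) (Nd a ts) = a # concat (map (internals r) ts)"

text \<open>The part of the Galton--Watson probability that is not a power of \<open>lam\<close> or
  of \<open>exp (- lam)\<close>. In the graph it compensates for listing the children in an
  arbitrary order.\<close>

fun weight :: "'a rtree \<Rightarrow> real" where
  "weight (Nd a ts) = prod_list (map weight ts) / fact (length ts)"

fun good :: "nat \<Rightarrow> nat \<Rightarrow> 'a rtree \<Rightarrow> bool" where
  "good D 0 t = True"
| "good D (Suc h) (Nd a ts) = (D \<le> length (filter (good D h) ts))"

text \<open>A discrete model of the same process, cut off at depth r. Single trees have their own
  mass here, which the comparison with the graph tree by tree requires.\<close>

primrec gw :: "real \<Rightarrow> nat \<Rightarrow> unit rtree pmf" where
  "gw lam 0 = return_pmf (Nd () [])"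
| "gw lam (Suc r) = do {d \<leftarrow> poisson_pmf lam; ts \<leftarrow> replicate_pmf d (gw lam r); return_pmf (Nd () ts)}"

lemma labels_not_Nil [simp]: "labels t \<noteq> []"
  by (cases t) auto

lemma length_internals_le: "length (internals r t) \<le> length (labels t)"
proof (induction r t rule: internals.induct)
  case (2 r a ts)
  then have "sum_list (map (length \<circ> internals r) ts) \<le> sum_list (map (length \<circ> labels) ts)"
    by (intro sum_list_mono) auto
  then show ?case by (simp add: length_concat)
qed simp

lemma pmf_replicate_pmf:
  "pmf (replicate_pmf n p) xs = (if length xs = n then prod_list (map (pmf p) xs) else 0)"
proof (induction n arbitrary: xs)
  case 0
  then show ?case by (auto simp: indicator_def)
next
  case (Suc n)
  have eq: "replicate_pmf (Suc n) p = map_pmf (\<lambda>(x, xs). x # xs) (pair_pmf p (replicate_pmf n p))"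
    by (simp add: pair_pmf_def map_bind_pmf bind_assoc_pmf bind_return_pmf)
  show ?case
  proof (cases xs)
    case Nil
    then show ?thesis by (auto simp: set_replicate_pmf pmf_eq_0_set_pmf simp del: replicate_pmf.simps)
  next
    case (Cons y ys)
    have "inj (\<lambda>(x, xs). x # xs)" by (auto simp: inj_def)
    then have "pmf (map_pmf (\<lambda>(x, xs). x # xs) (pair_pmf p (replicate_pmf n p))) ((\<lambda>(x, xs). x # xs) (y, ys)) = pmf (pair_pmf p (replicate_pmf n p)) (y, ys)"
      by (rule pmf_map_inj')
    then show ?thesis unfolding eq using Cons Suc by (simp add: pmf_pair)
  qed
qed

lemma pmf_gw_Suc:
  "pmf (gw lam (Suc r)) (Nd () ts) = pmf (poisson_pmf lam) (length ts) * prod_list (map (pmf (gw lam r)) ts)"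
proof -
  have inj: "inj (Nd ())" by (auto simp: inj_def)
  have m: "pmf (replicate_pmf d (gw lam r) \<bind> (\<lambda>ts. return_pmf (Nd () ts))) (Nd () ts) =
      (if length ts = d then prod_list (map (pmf (gw lam r)) ts) else 0)" for d
    using pmf_map_inj'[OF inj, of "replicate_pmf d (gw lam r)" ts] by (simp add: map_pmf_def pmf_replicate_pmf)
  have "pmf (gw lam (Suc r)) (Nd () ts) = measure_pmf.expectation (poisson_pmf lam)
     (\<lambda>d. if length ts = d then prod_list (map (pmf (gw lam r)) ts) else 0)"
    unfolding gw.simps pmf_bind[of "poisson_pmf lam"] m ..
  also have "\<dots> = (\<Sum>d\<in>{length ts}. (if length ts = d then prod_list (map (pmf (gw lam r)) ts) else 0) * pmf (poisson_pmf lam) d)"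
    by (rule integral_measure_pmf_real) (auto split: if_splits)
  finally show ?thesis by simp
qed

lemma prod_list_prod_list: "prod_list (map (\<lambda>x. f x * g x) xs) = prod_list (map f xs) * prod_list (map (g :: _ \<Rightarrow> real) xs)"
  by (induction xs) auto

lemma prod_list_power: "prod_list (map (\<lambda>x. c ^ f x) xs) = (c :: real) ^ sum_list (map f xs)"
  by (induction xs) (auto simp: power_add)

lemma pmf_gw:
  assumes "0 < lam" "wf_depth r t"
  shows "pmf (gw lam r) t = weight t * lam ^ (length (labels t) - 1) * exp (- lam) ^ length (internals r t)"
  using assms(2)
proof (induction r arbitrary: t)
  case 0
  then show ?case by (cases t) auto
next
  case (Suc r)
  obtain ts where t: "t = Nd () ts" by (cases t) auto
  have "map (pmf (gw lam r)) ts = map (\<lambda>t. weight t * lam ^ (length (labels t) - 1) * exp (- lam) ^ length (internals r t)) ts"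
    using Suc by (auto simp: t)
  then have "prod_list (map (pmf (gw lam r)) ts) =
     prod_list (map weight ts) * lam ^ sum_list (map (\<lambda>t. length (labels t) - 1) ts) * exp (- lam) ^ sum_list (map (length \<circ> internals r) ts)"
    by (simp only: prod_list_prod_list prod_list_power o_def)
  moreover have "length (concat (map labels ts)) = length ts + sum_list (map (\<lambda>t. length (labels t) - 1) ts)"
  proof (induction ts)
    case (Cons a ts)
    have "length (labels a) > 0" by simp
    then show ?case using Cons by simp
  qed simp
  ultimately show ?case using assms(1)
    by (simp add: t pmf_gw_Suc length_concat o_def power_add del: gw.simps)
qed

lemma set_pmf_gw: "t \<in> set_pmf (gw lam r) \<Longrightarrow> wf_depth r t"
  by (induction r arbitrary: t) (auto simp: set_replicate_pmf)

lemma measure_pmf_nat_integral_sums: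
  fixes f :: "nat \<Rightarrow> real"
  assumes "(\<lambda>d. pmf P d * f d) sums s" "\<And>d. 0 \<le> f d"
  shows "measure_pmf.expectation P f = s"
proof -
  have "integrable (count_space UNIV) (\<lambda>d. pmf P d * f d)"
    using assms by (simp add: integrable_count_space_nat_iff sums_iff)
  then have "integral\<^sup>L (count_space UNIV) (\<lambda>d. pmf P d * f d) = (\<Sum>d. pmf P d * f d)"
    by (rule integral_count_space_nat)
  moreover have "measure_pmf.expectation P f = integral\<^sup>L (count_space UNIV) (\<lambda>d. pmf P d * f d)"
    unfolding measure_pmf_eq_density by (subst integral_density) auto
  ultimately show ?thesis using assms(1) by (simp add: sums_iff)
qed

lemma map_pmf_pred_bernoulli: "map_pmf A P = bernoulli_pmf (measure_pmf.prob P (Collect A))"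
proof (rule pmf_eqI)
  fix b
  have "pmf (map_pmf A P) b = measure_pmf.prob P (A -` {b})" by (simp add: pmf_map)
  moreover have "measure_pmf.prob P {x. \<not> A x} = 1 - measure_pmf.prob P (Collect A)"
    using measure_pmf.prob_compl[of "Collect A" P] by (simp add: Compl_eq_Diff_UNIV[symmetric] Collect_neg_eq)
  ultimately show "pmf (map_pmf A P) b = pmf (bernoulli_pmf (measure_pmf.prob P (Collect A))) b"
    by (cases b) (auto simp: vimage_def)
qed

lemma map_replicate_pmf: "map_pmf (map f) (replicate_pmf n P) = replicate_pmf n (map_pmf f P)"
proof (induction n)
  case (Suc n)
  have "map_pmf (map f) (replicate_pmf (Suc n) P) =
      P \<bind> (\<lambda>x. map_pmf ((#) (f x)) (map_pmf (map f) (replicate_pmf n P)))"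
    by (simp add: map_bind_pmf pmf.map_comp o_def map_pmf_def[symmetric])
  also have "\<dots> = replicate_pmf (Suc n) (map_pmf f P)"
    unfolding Suc by (simp add: bind_map_pmf map_pmf_def[symmetric])
  finally show ?case .
qed simp

lemma replicate_pmf_count:
  "map_pmf (\<lambda>ts. length (filter A ts)) (replicate_pmf d P) = binomial_pmf d (measure_pmf.prob P (Collect A))"
proof -
  have "map_pmf (\<lambda>ts. length (filter A ts)) (replicate_pmf d P) = map_pmf (length \<circ> filter id) (map_pmf (map A) (replicate_pmf d P))"
    by (simp add: pmf.map_comp o_def filter_map)
  also have "\<dots> = binomial_pmf d (measure_pmf.prob P (Collect A))"
    by (subst binomial_pmf_altdef) (auto simp: map_replicate_pmf map_pmf_pred_bernoulli)
  finally show ?thesis .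
qed

text \<open>The cut at depth r >= h does not affect the event. The number of good children of the
  root is a Poisson mixture of binomials, hence Poisson by thinning.\<close>

theorem prob_gw_good:
  assumes "0 < lam" "h \<le> r"
  shows "measure_pmf.prob (gw lam r) {t. good D h t} = perc D lam h"
  using assms(2)
proof (induction h arbitrary: r)
  case 0
  have "{t :: unit rtree. good D 0 t} = UNIV" by auto
  then show ?case by simp
next
  case (Suc h)
  obtain r' where r: "r = Suc r'" "h \<le> r'" using Suc by (cases r) auto
  define q where "q = perc D lam h"
  have q: "0 \<le> q" "q \<le> 1" using perc_bounds[of lam D h] assms by (auto simp: q_def)
  have IH: "measure_pmf.prob (gw lam r') {t. good D h t} = q" using Suc.IH[OF r(2)] by (simp add: q_def)
  let ?K = "map_pmf (\<lambda>t. length (filter (good D h) (kids t))) (gw lam r)"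
  have K: "?K = poisson_pmf lam \<bind> (\<lambda>d. binomial_pmf d q)"
    using replicate_pmf_count[of "good D h" _ "gw lam r'"] IH
    by (simp add: r map_bind_pmf map_pmf_comp map_pmf_def[symmetric])
  have pK: "pmf ?K k = (lam * q) ^ k / fact k * exp (- (lam * q))" for k
  proof -
    have "pmf ?K k = measure_pmf.expectation (poisson_pmf lam) (\<lambda>d. pmf (binomial_pmf d q) k)"
      by (simp add: K pmf_bind)
    also have "\<dots> = measure_pmf.expectation (poisson_pmf lam) (\<lambda>d. real (d choose k) * q ^ k * (1 - q) ^ (d - k))"
      using q by simp
    also have "\<dots> = (lam * q) ^ k / fact k * exp (- (lam * q))"
      by (rule measure_pmf_nat_integral_sums[OF poisson_thinning]) (use assms q in auto)
    finally show ?thesis .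
  qed
  have "measure_pmf.prob (gw lam r) {t. good D (Suc h) t} = measure_pmf.prob ?K {k. D \<le> k}"
  proof -
    have "good D (Suc h) t \<longleftrightarrow> D \<le> length (filter (good D h) (kids t))" for t :: "unit rtree" by (cases t) auto
    then show ?thesis by (simp add: vimage_def)
  qed
  also have "\<dots> = 1 - measure_pmf.prob ?K {..<D}"
    using measure_pmf.prob_compl[of "{..<D}" ?K] by (simp add: Compl_eq_Diff_UNIV[symmetric] atLeast_def)
  also have "measure_pmf.prob ?K {..<D} = (\<Sum>k<D. pmf ?K k)" by (rule measure_measure_pmf_finite) auto
  finally show ?case by (simp only: pK perc.simps q_def psi_def)
qed

section \<open>Exponential tails of the tree size\<close>

lemma nn_integral_poisson_power:
  assumes "0 < lam" "0 \<le> x"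
  shows "(\<integral>\<^sup>+d. ennreal (x ^ d) \<partial>measure_pmf (poisson_pmf lam)) = ennreal (exp (lam * (x - 1)))"
proof -
  have "(\<lambda>d. pmf (poisson_pmf lam) d * x ^ d) sums exp (lam * (x - 1))"
  proof -
    have "(\<lambda>j. (lam * x) ^ j / fact j) sums exp (lam * x)"
      using exp_converges[of "lam * x"] by (simp add: divide_inverse mult.commute)
    from sums_mult[OF this, of "exp (- lam)"] show ?thesis
      using assms by (simp add: power_mult_distrib field_simps exp_diff exp_minus)
  qed
  then have "(\<Sum>d. ennreal (pmf (poisson_pmf lam) d * x ^ d)) = ennreal (exp (lam * (x - 1)))"
    using assms by (subst suminf_ennreal2) (auto simp: sums_iff)
  then show ?thesis
    by (simp only: nn_integral_measure_pmf nn_integral_count_space_nat ennreal_mult'[OF pmf_nonneg])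
qed

lemma nn_integral_replicate_pmf_exp:
  "(\<integral>\<^sup>+ts. ennreal (exp (th * real (length (concat (map labels ts))))) \<partial>measure_pmf (replicate_pmf d P)) =
     (\<integral>\<^sup>+t. ennreal (exp (th * real (length (labels t)))) \<partial>measure_pmf P) ^ d"
proof (induction d)
  case (Suc d)
  show ?case
    using Suc by (simp add: distrib_left exp_add ennreal_mult nn_integral_cmult nn_integral_multc)
qed simp

lemma exp_le_one_plus_double: "0 \<le> y \<Longrightarrow> y \<le> 1 \<Longrightarrow> exp y \<le> 1 + 2 * (y :: real)"
  using exp_bound[of y] mult_left_le[of y y] by (simp add: power2_eq_square)

text \<open>One generation maps the moment F to exp th exp (lam (F - 1)). By exp y <= 1 + 2 y on
  [0, 1], the bound for F - 1 grows by the factor B = 2 + 2 lam per generation, since 2 (th + lam th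
  B^k) <= th B^(k+1).\<close>

lemma gw_size_exp_moment:
  assumes "0 < lam" "0 < th" "th * (2 + 2 * lam) ^ Suc r \<le> 1"
  shows "(\<integral>\<^sup>+t. ennreal (exp (th * real (length (labels t)))) \<partial>measure_pmf (gw lam r)) \<le>
     ennreal (1 + th * (2 + 2 * lam) ^ Suc r)"
  using assms(3)
proof (induction r)
  case 0
  have th1: "th \<le> 1"
  proof -
    have "th * 1 \<le> th * (2 + 2 * lam)" using assms by (intro mult_left_mono) auto
    then show ?thesis using 0 by simp
  qed
  have "exp th \<le> 1 + 2 * th" using th1 assms by (intro exp_le_one_plus_double) auto
  also have "\<dots> \<le> 1 + th * (2 + 2 * lam)" using assms by (simp add: algebra_simps)
  finally show ?case by (simp add: ennreal_leI)
next
  case (Suc r)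
  define B where "B = 2 + 2 * lam"
  have B: "1 \<le> B" using assms by (simp add: B_def)
  let ?x = "1 + th * B ^ Suc r"
  have Br: "1 \<le> B ^ Suc r" using B one_le_power by blast
  have le1: "th * B ^ Suc r \<le> 1"
  proof -
    have "th * B ^ Suc r * 1 \<le> th * B ^ Suc r * B" using B assms by (intro mult_left_mono) auto
    also have "\<dots> \<le> 1" using Suc.prems by (simp add: B_def mult_ac)
    finally show ?thesis by simp
  qed
  let ?F = "\<integral>\<^sup>+t. ennreal (exp (th * real (length (labels t)))) \<partial>measure_pmf (gw lam r)"
  have IH: "?F \<le> ennreal ?x" using Suc.IH le1 by (simp add: B_def)
  let ?y = "th + lam * (th * B ^ Suc r)"
  have "(\<integral>\<^sup>+t. ennreal (exp (th * real (length (labels t)))) \<partial>measure_pmf (gw lam (Suc r))) =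
     (\<integral>\<^sup>+d. (\<integral>\<^sup>+ts. ennreal (exp th) * ennreal (exp (th * real (length (concat (map labels ts))))) \<partial>measure_pmf (replicate_pmf d (gw lam r))) \<partial>measure_pmf (poisson_pmf lam))"
    by (simp add: distrib_left exp_add flip: ennreal_mult)
  also have "\<dots> = ennreal (exp th) * (\<integral>\<^sup>+d. ?F ^ d \<partial>measure_pmf (poisson_pmf lam))"
    by (simp add: nn_integral_cmult nn_integral_replicate_pmf_exp)
  also have "\<dots> \<le> ennreal (exp th) * (\<integral>\<^sup>+d. ennreal (?x ^ d) \<partial>measure_pmf (poisson_pmf lam))"
  proof (intro mult_left_mono nn_integral_mono)
    fix d
    have "?F ^ d \<le> ennreal ?x ^ d" using IH by (intro power_mono) auto
    also have "\<dots> = ennreal (?x ^ d)" using assms B by (intro ennreal_power) auto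
    finally show "?F ^ d \<le> ennreal (?x ^ d)" .
  qed auto
  also have "\<dots> = ennreal (exp th) * ennreal (exp (lam * (?x - 1)))"
    using assms B by (subst nn_integral_poisson_power) auto
  also have "\<dots> = ennreal (exp ?y)" by (simp add: exp_add flip: ennreal_mult)
  also have "\<dots> \<le> ennreal (1 + th * B ^ Suc (Suc r))"
  proof (rule ennreal_leI)
    have y2: "2 * ?y \<le> th * B ^ Suc (Suc r)"
    proof -
      have "2 * ?y = th * (2 + 2 * lam * B ^ Suc r)" by (simp add: algebra_simps)
      also have "\<dots> \<le> th * (2 * B ^ Suc r + 2 * lam * B ^ Suc r)" using assms Br by (intro mult_left_mono) auto
      also have "\<dots> = th * (B * B ^ Suc r)" by (simp add: B_def algebra_simps)
      finally show ?thesis by simp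
    qed
    have y0: "0 \<le> ?y" using assms B by simp
    have "?y \<le> 1" using y2 y0 Suc.prems by (simp add: B_def)
    then show "exp ?y \<le> 1 + th * B ^ Suc (Suc r)" using exp_le_one_plus_double[of ?y] y0 y2 by linarith
  qed
  finally show ?case by (simp add: B_def)
qed

lemma gw_size_tail:
  assumes "0 < lam"
  shows "measure_pmf.prob (gw lam r) {t. s < length (labels t)} \<le> 2 * exp (- (real s / (2 + 2 * lam) ^ Suc r))"
proof -
  \<comment> \<open>The largest exponent to which the moment bound applies; the moment is then at
    most 2.\<close>
  define th where "th = 1 / (2 + 2 * lam) ^ Suc r"
  have th: "0 < th" "th * (2 + 2 * lam) ^ Suc r = 1"
    using assms by (auto simp: th_def simp del: power_Suc)
  let ?c = "exp (- (th * real s))"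
  have "ennreal (measure_pmf.prob (gw lam r) {t. s < length (labels t)}) = (\<integral>\<^sup>+t. indicator {t. s < length (labels t)} t \<partial>measure_pmf (gw lam r))"
    by (simp add: measure_pmf.emeasure_eq_measure)
  also have "\<dots> \<le> (\<integral>\<^sup>+t. ennreal ?c * ennreal (exp (th * real (length (labels t)))) \<partial>measure_pmf (gw lam r))"
  proof (rule nn_integral_mono)
    fix t :: "unit rtree"
    have "1 \<le> ?c * exp (th * real (length (labels t)))" if "s < length (labels t)"
      using that th by (simp flip: exp_add)
    then show "indicator {t. s < length (labels t)} t \<le> ennreal ?c * ennreal (exp (th * real (length (labels t))))"
      by (auto simp: indicator_def simp flip: ennreal_mult)
  qed
  also have "\<dots> = ennreal ?c * (\<integral>\<^sup>+t. ennreal (exp (th * real (length (labels t)))) \<partial>measure_pmf (gw lam r))"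
    by (rule nn_integral_cmult) auto
  also have "\<dots> \<le> ennreal ?c * ennreal (1 + th * (2 + 2 * lam) ^ Suc r)"
    by (intro mult_left_mono gw_size_exp_moment assms th) (use th in auto)
  also have "\<dots> = ennreal (2 * ?c)" unfolding th(2) by (subst ennreal_mult[symmetric]) (auto simp: mult.commute)
  finally have "measure_pmf.prob (gw lam r) {t. s < length (labels t)} \<le> 2 * ?c" by (simp add: ennreal_le_iff)
  then show ?thesis by (simp add: th_def)
qed

section \<open>Exploring the random graph\<close>

lemma edge_eq_iff: "edge a b = edge c d \<longleftrightarrow> a = c \<and> b = d \<or> a = d \<and> b = c"
  by (auto simp: edge_def min_def max_def split: if_splits)

lemma edge_commute: "edge a b = edge b a"
  by (simp add: edge_eq_iff)

definition nb :: "(nat \<times> nat) set \<Rightarrow> nat \<Rightarrow> nat set" where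
  "nb w v = {u. u \<noteq> v \<and> edge v u \<in> w}"

lemma finite_nb: "finite w \<Longrightarrow> finite (nb w v)"
proof -
  assume "finite w"
  have "nb w v \<subseteq> (\<lambda>e. if fst e = v then snd e else fst e) ` w"
    by (force simp: nb_def edge_def min_def max_def image_iff split: if_splits)
  then show ?thesis using \<open>finite w\<close> finite_surj by blast
qed

text \<open>\<open>explored w r par t\<close>: \<open>t\<close> is the tree of non-backtracking walks of length at most \<open>r\<close> in the
  graph \<open>w\<close>, started at the root label of \<open>t\<close> and not entering \<open>par\<close> in the first step; the children
  are listed in an arbitrary order.\<close>
fun explored :: "(nat \<times> nat) set \<Rightarrow> nat \<Rightarrow> nat set \<Rightarrow> nat rtree \<Rightarrow> bool" where
  "explored w 0 par (Nd v ts) = (ts = [])"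
| "explored w (Suc r) par (Nd v ts) =
     (distinct (map lab ts) \<and> set (map lab ts) = nb w v - par \<and> (\<forall>t\<in>set ts. explored w r {v} t))"

lemma weight_nonneg: "0 \<le> weight t"
  by (induction t) (auto intro!: divide_nonneg_nonneg prod_list_nonneg)

text \<open>With the order of the child labels fixed by \<open>xs\<close>, the subtrees at different
  positions are chosen from separate families, so the sum is at most a product of sums that are each
  at most 1.\<close>

lemma sum_prod_list_le_1:
  fixes f :: "'a \<Rightarrow> real"
  assumes "\<And>x S. finite S \<Longrightarrow> S \<subseteq> {t. Q x t} \<Longrightarrow> sum f S \<le> 1" "\<And>t. 0 \<le> f t"
    and "finite L" "L \<subseteq> {ts. list_all2 Q xs ts}"
  shows "(\<Sum>ts\<in>L. prod_list (map f ts)) \<le> 1"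
  using assms(3,4)
proof (induction xs arbitrary: L)
  case Nil
  then have "L \<subseteq> {[]}" by auto
  then have "L = {} \<or> L = {[]}" by auto
  then show ?case by auto
next
  case (Cons x xs)
  have nz: "ts \<noteq> []" if "ts \<in> L" for ts using Cons.prems that by auto
  have inj: "inj_on (\<lambda>ts. (hd ts, tl ts)) L" using nz by (auto simp: inj_on_def intro: list.expand)
  have "(\<Sum>ts\<in>L. prod_list (map f ts)) = (\<Sum>ts\<in>L. f (hd ts) * prod_list (map f (tl ts)))"
  proof (intro sum.cong refl)
    fix ts assume "ts \<in> L"
    then show "prod_list (map f ts) = f (hd ts) * prod_list (map f (tl ts))" using nz by (cases ts) auto
  qed
  also have "\<dots> = (\<Sum>(t, ts)\<in>(\<lambda>ts. (hd ts, tl ts)) ` L. f t * prod_list (map f ts))"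
    by (simp add: sum.reindex[OF inj])
  also have "\<dots> \<le> (\<Sum>(t, ts)\<in>hd ` L \<times> tl ` L. f t * prod_list (map f ts))"
    using Cons.prems assms(2) by (intro sum_mono2) (auto intro!: mult_nonneg_nonneg prod_list_nonneg)
  also have "\<dots> = (\<Sum>t\<in>hd ` L. f t) * (\<Sum>ts\<in>tl ` L. prod_list (map f ts))"
    by (simp add: sum_product sum.cartesian_product)
  also have "\<dots> \<le> 1 * 1"
  proof (intro mult_mono)
    show "(\<Sum>t\<in>hd ` L. f t) \<le> 1"
      by (rule assms(1)[of _ x]) (use Cons.prems in \<open>auto simp: list_all2_Cons1\<close>)
    show "(\<Sum>ts\<in>tl ` L. prod_list (map f ts)) \<le> 1"
      by (rule Cons.IH) (use Cons.prems in \<open>auto simp: list_all2_Cons1\<close>)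
  qed (auto intro!: sum_nonneg prod_list_nonneg assms(2))
  finally show ?case by simp
qed

text \<open>A tree whose vertices have numbers of children \<open>d\<^sub>i\<close> is counted once for each of the
  \<open>\<Prod>d\<^sub>i!\<close> orderings, each with weight \<open>1 / \<Prod>d\<^sub>i!\<close>.\<close>
lemma sum_weight_explored_le_1:
  assumes "finite w" "finite S" "S \<subseteq> {t. explored w r par t \<and> lab t = v}"
  shows "sum weight S \<le> 1"
  using assms(2,3)
proof (induction r arbitrary: S par v)
  case 0
  have "explored w 0 par t \<Longrightarrow> lab t = v \<Longrightarrow> t = Nd v []" for t by (cases t) auto
  then have "S \<subseteq> {Nd v []}" using 0 by auto
  then have "S = {} \<or> S = {Nd v []}" by auto
  then show ?case by auto
next
  case (Suc r)
  let ?N = "nb w v - par"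
  have finN: "finite ?N" using finite_nb[OF assms(1)] by auto
  have inj: "inj_on kids S" using Suc.prems by (auto simp: inj_on_def intro!: rtree.expand)
  have el: "distinct (map lab (kids t))" "set (map lab (kids t)) = ?N" "\<forall>s\<in>set (kids t). explored w r {v} s"
    "weight t = prod_list (map weight (kids t)) / fact (card ?N)" if "t \<in> S" for t
  proof -
    have "lab t = v" using Suc.prems(2) that by auto
    then obtain ts where t: "t = Nd v ts" by (cases t) simp
    have e: "explored w (Suc r) par (Nd v ts)" using Suc.prems(2) that unfolding t by blast
    then show "distinct (map lab (kids t))" "set (map lab (kids t)) = ?N" "\<forall>s\<in>set (kids t). explored w r {v} s" by (auto simp: t)
    from e have "length ts = card ?N" by (metis distinct_card explored.simps(2) length_map)
    then show "weight t = prod_list (map weight (kids t)) / fact (card ?N)" by (simp add: t)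
  qed
  let ?L = "kids ` S"
  have "sum weight S = (\<Sum>t\<in>S. prod_list (map weight (kids t)) / fact (card ?N))"
    using el(4) by (intro sum.cong) auto
  also have "\<dots> = (\<Sum>ts\<in>?L. prod_list (map weight ts)) / fact (card ?N)"
    by (simp add: sum.reindex[OF inj] sum_divide_distrib)
  also have "(\<Sum>ts\<in>?L. prod_list (map weight ts)) =
     (\<Sum>xs\<in>permutations_of_set ?N. \<Sum>ts\<in>{ts\<in>?L. map lab ts = xs}. prod_list (map weight ts))"
  proof (rule sum.group[symmetric])
    show "map lab ` kids ` S \<subseteq> permutations_of_set ?N"
    proof
      fix xs assume "xs \<in> map lab ` kids ` S"
      then obtain t where "t \<in> S" "xs = map lab (kids t)" by blast
      with el(1,2)[of t] show "xs \<in> permutations_of_set ?N" by (simp add: permutations_of_set_def)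
    qed
  qed (use Suc.prems finN in auto)
  also have "\<dots> \<le> (\<Sum>xs\<in>permutations_of_set ?N. 1)"
  proof (rule sum_mono)
    fix xs
    show "(\<Sum>ts\<in>{ts\<in>?L. map lab ts = xs}. prod_list (map weight ts)) \<le> 1"
    proof (rule sum_prod_list_le_1[where Q = "\<lambda>x t. explored w r {v} t \<and> lab t = x"])
      show "{ts\<in>?L. map lab ts = xs} \<subseteq> {ts. list_all2 (\<lambda>x t. explored w r {v} t \<and> lab t = x) xs ts}"
        using el(3) by (fastforce simp: list_all2_conv_all_nth)
    qed (use Suc.IH Suc.prems weight_nonneg in auto)
  qed
  also have "\<dots> = fact (card ?N)" using finN by simp
  finally show ?case by (simp add: divide_le_eq)
qed

section \<open>Labelled trees as neighbourhoods in the graph\<close>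

fun tree_edges :: "nat rtree \<Rightarrow> (nat \<times> nat) set" where
  "tree_edges (Nd v ts) = (\<Union>t\<in>set ts. insert (edge v (lab t)) (tree_edges t))"

lemma lab_in_labels [simp]: "lab t \<in> set (labels t)"
  by (cases t) auto

lemma finite_tree_edges [simp]: "finite (tree_edges t)"
  by (induction t) auto

lemma card_tree_edges: "card (tree_edges t) \<le> length (labels t) - 1"
proof (induction t)
  case (Nd v ts)
  have "card (tree_edges (Nd v ts)) \<le> (\<Sum>t\<in>set ts. card (insert (edge v (lab t)) (tree_edges t)))"
    by (simp add: card_UN_le)
  also have "\<dots> \<le> (\<Sum>t\<in>set ts. length (labels t))"
  proof (rule sum_mono)
    fix t assume "t \<in> set ts"
    then have "card (tree_edges t) \<le> length (labels t) - 1" using Nd by blast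
    moreover have "0 < length (labels t)" by simp
    ultimately have "Suc (card (tree_edges t)) \<le> length (labels t)" by linarith
    then show "card (insert (edge v (lab t)) (tree_edges t)) \<le> length (labels t)"
      using card_insert_le_m1 by (simp add: card_insert_if)
  qed
  also have "\<dots> \<le> sum_list (map (\<lambda>t. length (labels t)) ts)"
  proof (induction ts)
    case (Cons a ts)
    then show ?case by (cases "a \<in> set ts") (auto simp: insert_absorb)
  qed simp
  finally show ?case by (simp add: length_concat o_def)
qed

lemma edge_in_tree_edges:
  "edge a b \<in> tree_edges t \<Longrightarrow> a \<in> set (labels t) \<and> b \<in> set (labels t)"
proof (induction t arbitrary: a b)
  case (Nd v ts)
  then obtain t where t: "t \<in> set ts" "edge a b = edge v (lab t) \<or> edge a b \<in> tree_edges t" by auto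
  then show ?case using Nd.IH[of t a b] lab_in_labels[of t] by (auto simp: edge_eq_iff simp del: lab_in_labels)
qed

lemma distinct_concat_same:
  assumes "distinct (concat (map f ts))" "t \<in> set ts" "t' \<in> set ts" "x \<in> set (f t)" "x \<in> set (f t')"
  shows "t = t'"
  using assms by (induction ts) auto

lemma distinct_concat_nth:
  assumes "distinct (concat (map f ts))" "i < length ts" "j < length ts" "i \<noteq> j"
  shows "set (f (ts ! i)) \<inter> set (f (ts ! j)) = {}"
  using assms
proof (induction ts arbitrary: i j)
  case (Cons a ts)
  have a: "set (f a) \<inter> set (f (ts ! k)) = {}" if "k < length ts" for k
    using Cons.prems(1) nth_mem[OF that] by auto
  show ?case
  proof (cases i)
    case 0
    then show ?thesis using Cons.prems a by (cases j) auto
  next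
    case (Suc i')
    then show ?thesis using Cons a by (cases j) auto
  qed
qed simp

lemma distinct_map_lab: "distinct (concat (map labels ts)) \<Longrightarrow> distinct (map lab ts)"
proof (induction ts)
  case (Cons a ts)
  have "lab a \<noteq> lab t" if "t \<in> set ts" for t
    using Cons.prems that lab_in_labels[of a] lab_in_labels[of t] by (auto simp del: lab_in_labels)
  then have "lab a \<notin> lab ` set ts" by auto
  then show ?case using Cons by auto
qed simp

lemma internals_subset: "set (internals r t) \<subseteq> set (labels t)"
  by (induction r t rule: internals.induct) auto

text \<open>Exploration looks only at the neighbourhoods of internal vertices, and prescribing these
  is a condition on finitely many pairs with an explicit probability. \<open>par\<close> is added at
  the root because the edge to the parent lies outside the subtree.\<close>

lemma explored_if_nb:
  assumes "distinct (labels t)" "wf_depth r t" "par \<inter> set (labels t) = {}"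
    and "\<And>x. x \<in> set (internals r t) \<Longrightarrow> nb w x = nb (tree_edges t) x \<union> (if x = lab t then par else {})"
  shows "explored w r par t"
  using assms
proof (induction r arbitrary: t par)
  case 0
  then show ?case by (cases t) auto
next
  case (Suc r)
  obtain v ts where t: "t = Nd v ts" by (cases t)
  have dist: "v \<notin> set (concat (map labels ts))" "distinct (concat (map labels ts))"
    using Suc.prems by (auto simp: t)
  have vt: "v \<notin> set (labels s)" if "s \<in> set ts" for s using dist that by auto
  have nbv: "nb (tree_edges t) v = lab ` set ts"
  proof (intro set_eqI iffI)
    fix y assume "y \<in> nb (tree_edges t) v"
    then obtain s where s: "s \<in> set ts" "edge v y = edge v (lab s) \<or> edge v y \<in> tree_edges s"
      by (auto simp: nb_def t)
    then show "y \<in> lab ` set ts" using edge_in_tree_edges[of v y s] vt by (auto simp: edge_eq_iff)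
  next
    fix y assume "y \<in> lab ` set ts"
    then obtain s where s: "s \<in> set ts" "y = lab s" by auto
    then have "y \<noteq> v" using vt lab_in_labels by metis
    then show "y \<in> nb (tree_edges t) v" using s by (auto simp: nb_def t)
  qed
  have "nb w v = lab ` set ts \<union> par" using Suc.prems(4)[of v] nbv by (simp add: t)
  moreover have "lab ` set ts \<inter> par = {}"
  proof -
    have "lab s \<notin> par" if "s \<in> set ts" for s
      using Suc.prems(3) that lab_in_labels[of s] by (auto simp: t simp del: lab_in_labels)
    then show ?thesis by auto
  qed
  ultimately have "set (map lab ts) = nb w v - par" by auto
  moreover have "explored w r {v} s" if s: "s \<in> set ts" for s
  proof (rule Suc.IH)
    show "distinct (labels s)" using dist(2) s by (auto simp: distinct_concat_iff)
    show "wf_depth r s" using Suc.prems s by (auto simp: t)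
    show "{v} \<inter> set (labels s) = {}" using vt s by auto
    fix x assume x: "x \<in> set (internals r s)"
    then have xl: "x \<in> set (labels s)" using internals_subset by fastforce
    have xv: "x \<noteq> v" using xl vt s by auto
    have "nb w x = nb (tree_edges t) x" using Suc.prems(4)[of x] x s xv by (auto simp: t)
    also have "\<dots> = nb (tree_edges s) x \<union> (if x = lab s then {v} else {})"
    proof (intro set_eqI iffI)
      fix y assume y: "y \<in> nb (tree_edges t) x"
      then obtain s' where s': "s' \<in> set ts" "edge x y = edge v (lab s') \<or> edge x y \<in> tree_edges s'"
        by (auto simp: nb_def t)
      then have "x \<in> set (labels s')" using xv edge_in_tree_edges[of x y s'] by (auto simp: edge_eq_iff)
      then have "s' = s" using distinct_concat_same[OF dist(2) s s'(1) xl] by simp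
      then show "y \<in> nb (tree_edges s) x \<union> (if x = lab s then {v} else {})"
        using s' y xv by (auto simp: nb_def edge_eq_iff)
    next
      fix y assume "y \<in> nb (tree_edges s) x \<union> (if x = lab s then {v} else {})"
      then show "y \<in> nb (tree_edges t) x" using s xv
        by (auto simp: nb_def t edge_commute split: if_splits)
    qed
    finally show "nb w x = nb (tree_edges s) x \<union> (if x = lab s then {v} else {})" .
  qed
  ultimately show ?case using distinct_map_lab[OF dist(2)] by (simp add: t)
qed

lemma prob_random_subset_pattern:
  assumes "finite E" "F \<subseteq> Q" "Q \<subseteq> E" "0 \<le> p" "p \<le> 1"
  shows "measure_pmf.prob (random_subset E p) {w. w \<inter> Q = F} = p ^ card F * (1 - p) ^ (card Q - card F)"
proof -
  have finQ: "finite Q" "finite F" using assms(1-3) by (auto intro: finite_subset)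
  let ?B = "\<lambda>e. if e \<in> Q then {e \<in> F} else UNIV"
  have "measure_pmf.prob (random_subset E p) {w. w \<inter> Q = F} = measure_pmf.prob (Pi_pmf E False (\<lambda>_. bernoulli_pmf p)) (Pi E ?B)"
    unfolding random_subset_def measure_map_pmf
    by (rule arg_cong[where f = "measure_pmf.prob _"]) (use assms in \<open>auto simp: Pi_def\<close>)
  also have "\<dots> = (\<Prod>e\<in>E. measure_pmf.prob (bernoulli_pmf p) (?B e))"
    using assms by (intro measure_Pi_pmf_Pi) auto
  also have "\<dots> = (\<Prod>e\<in>E. if e \<in> Q then (if e \<in> F then p else 1 - p) else 1)"
    using assms by (intro prod.cong) (auto simp: measure_pmf_single)
  also have "\<dots> = (\<Prod>e\<in>Q. if e \<in> F then p else 1 - p)"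
    using assms by (subst prod.inter_restrict[symmetric]) (auto simp: Int_absorb1 Int_commute)
  also have "\<dots> = p ^ card F * (1 - p) ^ (card Q - card F)"
  proof -
    have "Q \<inter> {e. e \<in> F} = F" "Q \<inter> - {e. e \<in> F} = Q - F" using assms by auto
    then show ?thesis using finQ assms by (simp add: prod.If_cases card_Diff_subset)
  qed
  finally show ?thesis .
qed

lemma tree_edges_subset_internals:
  assumes "wf_depth r t" "e \<in> tree_edges t" "distinct (labels t)"
  shows "\<exists>x y. x \<in> set (internals r t) \<and> y \<in> set (labels t) \<and> x \<noteq> y \<and> e = edge x y"
  using assms
proof (induction r arbitrary: t)
  case 0
  then show ?case by (cases t) auto
next
  case (Suc r)
  obtain v ts where t: "t = Nd v ts" by (cases t)
  then obtain s where s: "s \<in> set ts" "e = edge v (lab s) \<or> e \<in> tree_edges s" using Suc.prems by auto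
  show ?case
  proof (cases "e = edge v (lab s)")
    case True
    have "v \<noteq> lab s" using s Suc.prems(3) lab_in_labels[of s] by (auto simp: t simp del: lab_in_labels)
    then show ?thesis using s True lab_in_labels[of s]
      by (intro exI[of _ v] exI[of _ "lab s"]) (auto simp: t simp del: lab_in_labels)
  next
    case False
    then have "\<exists>x y. x \<in> set (internals r s) \<and> y \<in> set (labels s) \<and> x \<noteq> y \<and> e = edge x y"
      using s Suc.prems by (intro Suc.IH) (auto simp: t distinct_concat_iff)
    then obtain x y where "x \<in> set (internals r s)" "y \<in> set (labels s)" "x \<noteq> y" "e = edge x y" by blast
    then show ?thesis using s(1) by (intro exI[of _ x] exI[of _ y]) (auto simp: t)
  qed
qed

text \<open>The exponents mirror \<open>pmf_gw\<close>: a factor p for each non-root vertex, and for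
  each internal vertex a factor (1 - p)^n, which is close to exp (-lam) for p = lam / n.\<close>

lemma prob_explored_ge:
  assumes "0 \<le> p" "p \<le> 1" "distinct (labels t)" "wf_depth r t" "set (labels t) \<subseteq> {..<n}"
  shows "p ^ (length (labels t) - 1) * (1 - p) ^ (n * length (internals r t)) \<le>
    measure_pmf.prob (random_subset (all_edges n) p) {w. explored w r {} t}"
proof -
  let ?F = "tree_edges t"
  \<comment> \<open>All pairs with an internal endpoint. If exactly the tree edges are present among
    them, \<open>t\<close> is an exploration of the graph.\<close>
  let ?Q = "(\<lambda>(x, y). edge x y) ` {(x, y). x \<in> set (internals r t) \<and> y < n \<and> x \<noteq> y}"
  have labn: "x < n" if "x \<in> set (internals r t)" for x using that internals_subset assms(5) by fastforce
  have sub: "{(x, y). x \<in> set (internals r t) \<and> y < n \<and> x \<noteq> y} \<subseteq> set (internals r t) \<times> {..<n}" by auto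
  have finQ: "finite ?Q" using finite_subset[OF sub] by auto
  have QE: "?Q \<subseteq> all_edges n" using labn by (auto simp: edge_def all_edges_def)
  have FQ: "?F \<subseteq> ?Q"
  proof
    fix e assume "e \<in> ?F"
    from tree_edges_subset_internals[OF assms(4) this assms(3)]
    obtain x y where "x \<in> set (internals r t)" "y \<in> set (labels t)" "x \<noteq> y" "e = edge x y" by blast
    then show "e \<in> ?Q" using assms(5) by (intro image_eqI[of _ _ "(x, y)"]) auto
  qed
  have cQ: "card ?Q \<le> n * length (internals r t)"
  proof -
    have "card ?Q \<le> card {(x, y). x \<in> set (internals r t) \<and> y < n \<and> x \<noteq> y}"
      by (rule card_image_le) (rule finite_subset[OF sub], simp)
    also have "\<dots> \<le> card (set (internals r t) \<times> {..<n})" by (rule card_mono[OF _ sub]) simp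
    also have "\<dots> = card (set (internals r t)) * n" by simp
    also have "\<dots> \<le> length (internals r t) * n" by (intro mult_right_mono card_length) simp
    finally show ?thesis by (simp add: mult.commute)
  qed
  have "p ^ (length (labels t) - 1) * (1 - p) ^ (n * length (internals r t)) \<le> p ^ card ?F * (1 - p) ^ (card ?Q - card ?F)"
    using assms cQ card_tree_edges[of t] by (intro mult_mono power_decreasing) auto
  also have "\<dots> = measure_pmf.prob (random_subset (all_edges n) p) {w. w \<inter> ?Q = ?F}"
    using FQ QE assms by (subst prob_random_subset_pattern) auto
  also have "\<dots> \<le> measure_pmf.prob (random_subset (all_edges n) p) {w. explored w r {} t}"
  proof (rule measure_pmf.finite_measure_mono_AE)
    show "AE w in measure_pmf (random_subset (all_edges n) p). w \<in> {w. w \<inter> ?Q = ?F} \<longrightarrow> w \<in> {w. explored w r {} t}"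
    proof (rule AE_pmfI, intro impI)
      fix w assume w: "w \<in> set_pmf (random_subset (all_edges n) p)" "w \<in> {w. w \<inter> ?Q = ?F}"
      then have wE: "w \<subseteq> all_edges n" by (auto dest: set_pmf_random_subset[rotated])
      have "nb w x = nb ?F x" if x: "x \<in> set (internals r t)" for x
      proof (intro set_eqI iffI)
        fix y assume "y \<in> nb w x"
        then have y: "y \<noteq> x" "edge x y \<in> w" by (auto simp: nb_def)
        then have "y < n" using wE by (auto simp: edge_def all_edges_def min_def max_def split: if_splits)
        then have "edge x y \<in> ?Q" using x y by (intro image_eqI[of _ _ "(x, y)"]) auto
        then show "y \<in> nb ?F x" using y w by (auto simp: nb_def)
      qed (use w in \<open>auto simp: nb_def\<close>)
      then show "w \<in> {w. explored w r {} t}"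
        using assms by (auto intro!: explored_if_nb)
    qed
  qed simp
  finally show ?thesis .
qed

section \<open>Embeddings found in an explored tree\<close>

definition emb :: "nat \<Rightarrow> nat \<Rightarrow> nat \<Rightarrow> (nat \<times> nat) set \<Rightarrow> (nat list \<Rightarrow> nat) \<Rightarrow> bool" where
  "emb D h n w \<phi> \<longleftrightarrow> inj_on \<phi> (tree_verts D h) \<and> \<phi> ` tree_verts D h \<subseteq> {..<n} \<and>
     (\<forall>u i. length u < h \<and> set u \<subseteq> {..<D} \<and> i < D \<longrightarrow> \<phi> (u @ [i]) \<in> nb w (\<phi> u))"

lemma tree_embedding_iff_emb: "tree_embedding D h n G \<phi> \<longleftrightarrow> emb D h n (Collect G) \<phi>"
proof -
  have "adj G u v \<longleftrightarrow> v \<in> nb (Collect G) u" for u v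
    by (auto simp: adj_def nb_def edge_def)
  then show ?thesis by (simp add: tree_embedding_def emb_def)
qed

lemma Nil_in_tree_verts [simp]: "[] \<in> tree_verts D h"
  by (simp add: tree_verts_def)

lemma Cons_in_tree_verts [simp]: "i # u \<in> tree_verts D (Suc h) \<longleftrightarrow> i < D \<and> u \<in> tree_verts D h"
  by (auto simp: tree_verts_def)

text \<open>Distinct labels make the subtrees of different children disjoint, which gives
  injectivity.\<close>

lemma emb_of_good:
  assumes "good D h t" "explored w r par t" "h \<le> r" "distinct (labels t)" "set (labels t) \<subseteq> {..<n}"
  shows "\<exists>\<phi>. emb D h n w \<phi> \<and> \<phi> [] = lab t \<and> \<phi> ` tree_verts D h \<subseteq> set (labels t)"
  using assms
proof (induction h arbitrary: t r par)
  case 0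
  have "tree_verts D 0 = {[]}" by (auto simp: tree_verts_def)
  moreover have "lab t < n" using 0 lab_in_labels[of t] by (auto simp del: lab_in_labels)
  ultimately show ?case by (intro exI[of _ "\<lambda>_. lab t"]) (auto simp: emb_def)
next
  case (Suc h)
  obtain r' where r: "r = Suc r'" "h \<le> r'" using Suc.prems by (cases r) auto
  obtain v ts where t: "t = Nd v ts" by (cases t)
  define gs where "gs = filter (good D h) ts"
  have gs: "D \<le> length gs" using Suc.prems by (simp add: t gs_def)
  have dist: "v \<notin> set (concat (map labels ts))" "distinct (concat (map labels ts))"
    using Suc.prems by (auto simp: t)
  have dgs: "distinct (concat (map labels gs))"
    using dist(2) unfolding gs_def by (induction ts) auto
  have gsi: "gs ! i \<in> set ts" "good D h (gs ! i)" if "i < D" for i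
    using nth_mem[of i gs] that gs by (auto simp: gs_def)
  have "\<exists>\<phi>. emb D h n w \<phi> \<and> \<phi> [] = lab (gs ! i) \<and> \<phi> ` tree_verts D h \<subseteq> set (labels (gs ! i))" if "i < D" for i
  proof (rule Suc.IH[OF _ _ r(2)])
    show "explored w r' {v} (gs ! i)" using Suc.prems gsi[OF that] by (simp add: t r)
    show "distinct (labels (gs ! i))" using dist(2) gsi[OF that] by (auto simp: distinct_concat_iff)
    show "set (labels (gs ! i)) \<subseteq> {..<n}" using Suc.prems gsi[OF that] by (auto simp: t)
  qed (use gsi[OF that] in auto)
  then obtain f where f: "\<And>i. i < D \<Longrightarrow> emb D h n w (f i)" "\<And>i. i < D \<Longrightarrow> f i [] = lab (gs ! i)"
      "\<And>i. i < D \<Longrightarrow> f i ` tree_verts D h \<subseteq> set (labels (gs ! i))"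
    by metis
  define \<phi> where "\<phi> u = (case u of [] \<Rightarrow> v | i # u' \<Rightarrow> f i u')" for u
  have sub: "\<phi> u \<in> set (labels t)" if "u \<in> tree_verts D (Suc h)" for u
  proof (cases u)
    case (Cons i u')
    then have "f i u' \<in> set (labels (gs ! i))" using that f(3)[of i] by auto
    then show ?thesis using gsi[of i] that Cons by (auto simp: \<phi>_def t)
  qed (simp add: \<phi>_def t)
  have ne: "f i u \<noteq> v" if "i < D" "u \<in> tree_verts D h" for i u
    using f(3)[OF that(1)] that gsi[OF that(1)] dist(1) by auto
  have ne2: "f i u \<noteq> f j u'" if "i < D" "u \<in> tree_verts D h" "j < D" "u' \<in> tree_verts D h" "i \<noteq> j" for i j u u'
    using f(3)[OF that(1)] f(3)[OF that(3)] that gs distinct_concat_nth[OF dgs, of i j] by fastforce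
  have "inj_on \<phi> (tree_verts D (Suc h))"
  proof (rule inj_onI)
    fix x y assume xy: "x \<in> tree_verts D (Suc h)" "y \<in> tree_verts D (Suc h)" "\<phi> x = \<phi> y"
    show "x = y"
    proof (cases x)
      case Nil
      then show ?thesis using xy ne by (cases y) (auto simp: \<phi>_def)
    next
      case (Cons i u)
      then show ?thesis
      proof (cases y)
        case Nil
        then show ?thesis using xy ne Cons by (auto simp: \<phi>_def)
      next
        case C2: (Cons j u')
        have "i = j" using ne2[of i u j u'] xy Cons C2 by (auto simp: \<phi>_def)
        moreover have "inj_on (f i) (tree_verts D h)" using f(1)[of i] xy Cons by (auto simp: emb_def)
        ultimately show ?thesis using xy Cons C2 by (auto simp: \<phi>_def inj_on_def)
      qed
    qed
  qed
  moreover have "\<phi> (u @ [i]) \<in> nb w (\<phi> u)" if "length u < Suc h" "set u \<subseteq> {..<D}" "i < D" for u i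
  proof (cases u)
    case Nil
    have "lab (gs ! i) \<in> nb w v" using Suc.prems(2) gsi[OF that(3)] unfolding t r explored.simps by auto
    then show ?thesis using Nil f(2)[OF that(3)] by (simp add: \<phi>_def)
  next
    case (Cons j u')
    then show ?thesis using that f(1)[of j] by (auto simp: \<phi>_def emb_def)
  qed
  ultimately have "emb D (Suc h) n w \<phi>"
    unfolding emb_def using sub Suc.prems(5) by fast
  moreover have "\<phi> [] = lab t" by (simp add: \<phi>_def t)
  ultimately show ?case using sub by blast
qed

section \<open>Uniqueness of non-backtracking walks\<close>

fun nbwalk :: "(nat \<times> nat) set \<Rightarrow> nat list \<Rightarrow> bool" where
  "nbwalk w [] = False"
| "nbwalk w [x] = True"
| "nbwalk w (x # y # zs) = (y \<in> nb w x \<and> (zs \<noteq> [] \<longrightarrow> hd zs \<noteq> x) \<and> nbwalk w (y # zs))"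

definition uniq :: "(nat \<times> nat) set \<Rightarrow> nat \<Rightarrow> nat \<Rightarrow> bool" where
  "uniq w L v \<longleftrightarrow> (\<forall>xs ys. nbwalk w (v # xs) \<and> nbwalk w (v # ys) \<and> length xs \<le> L \<and> length ys \<le> L \<and>
     last (v # xs) = last (v # ys) \<longrightarrow> xs = ys)"

fun paths :: "'a rtree \<Rightarrow> 'a list set" where
  "paths (Nd v ts) = insert [v] ((#) v ` (\<Union>t\<in>set ts. paths t))"

text \<open>The children of an explored vertex are all its neighbours but the parent, so a walk that
  never turns back runs down the tree.\<close>

lemma nbwalk_in_paths:
  assumes "explored w r par t" "nbwalk w (lab t # xs)" "length xs \<le> r" "xs \<noteq> [] \<Longrightarrow> hd xs \<notin> par"
  shows "lab t # xs \<in> paths t"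
  using assms
proof (induction r arbitrary: t par xs)
  case 0
  then show ?case by (cases t) auto
next
  case (Suc r)
  obtain v ts where t: "t = Nd v ts" by (cases t)
  show ?case
  proof (cases xs)
    case (Cons y ys)
    then have "y \<in> nb w v - par" using Suc.prems by (auto simp: t)
    then have "y \<in> set (map lab ts)" using Suc.prems(1) by (simp add: t)
    then obtain s where s: "s \<in> set ts" "y = lab s" by auto
    have "lab s # ys \<in> paths s"
      using Suc.prems s by (intro Suc.IH[of "{v}"]) (auto simp: t Cons)
    then show ?thesis using s by (auto simp: t Cons)
  qed (simp add: t)
qed

lemma paths_nonempty: "p \<in> paths t \<Longrightarrow> p \<noteq> []"
  by (cases t) auto

lemma last_paths: "p \<in> paths t \<Longrightarrow> last p \<in> set (labels t)"
proof (induction t arbitrary: p)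
  case (Nd v ts)
  show ?case
  proof (cases "p = [v]")
    case False
    then obtain s q where s: "s \<in> set ts" "q \<in> paths s" "p = v # q" using Nd.prems by auto
    then show ?thesis using Nd.IH[OF s(1,2)] paths_nonempty[OF s(2)] by auto
  qed simp
qed

lemma paths_last_inj:
  assumes "distinct (labels t)" "p \<in> paths t" "q \<in> paths t" "last p = last q"
  shows "p = q"
  using assms
proof (induction t arbitrary: p q)
  case (Nd v ts)
  have ne: "last p' \<noteq> v" if "s \<in> set ts" "p' \<in> paths s" for s p'
    using last_paths[OF that(2)] that(1) Nd.prems(1) by auto
  consider "p = [v]" "q = [v]" | s q' where "s \<in> set ts" "q' \<in> paths s" "q = v # q'" "p = [v]"
    | s p' where "s \<in> set ts" "p' \<in> paths s" "p = v # p'" "q = [v]"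
    | s p' s' q' where "s \<in> set ts" "p' \<in> paths s" "p = v # p'" "s' \<in> set ts" "q' \<in> paths s'" "q = v # q'"
    using Nd.prems(2,3) by auto
  then show ?case
  proof cases
    case 2
    then show ?thesis using Nd.prems(4) ne[of s q'] paths_nonempty[of q' s] by auto
  next
    case 3
    then show ?thesis using Nd.prems(4) ne[of s p'] paths_nonempty[of p' s] by auto
  next
    case 4
    then have l: "last p' = last q'" using Nd.prems(4) paths_nonempty[of p' s] paths_nonempty[of q' s'] by auto
    have "s = s'" using distinct_concat_same[of labels ts s s' "last p'"] 4 l last_paths[of p' s] last_paths[of q' s'] Nd.prems(1) by auto
    moreover have "distinct (labels s)" using Nd.prems(1) 4 by (auto simp: distinct_concat_iff)
    ultimately show ?thesis using Nd.IH[of s p' q'] 4 l by simp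
  qed simp
qed

text \<open>The exploration that exhibits a copy thus certifies uniqueness as well, and both are
  covered by one first moment bound.\<close>

lemma uniq_if_explored:
  assumes "explored w r {} t" "distinct (labels t)"
  shows "uniq w r (lab t)"
  unfolding uniq_def
proof (intro allI impI, elim conjE)
  fix xs ys
  assume "nbwalk w (lab t # xs)" "nbwalk w (lab t # ys)" "length xs \<le> r" "length ys \<le> r"
    and l: "last (lab t # xs) = last (lab t # ys)"
  then have "lab t # xs \<in> paths t" "lab t # ys \<in> paths t"
    using nbwalk_in_paths[OF assms(1)] by simp_all
  from paths_last_inj[OF assms(2) this l] show "xs = ys" by simp
qed

section \<open>Shapes and labellings\<close>

abbreviation shape :: "'a rtree \<Rightarrow> unit rtree" where
  "shape \<equiv> map_rtree (\<lambda>_. ())"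

lemma length_labels_shape [simp]: "length (labels (shape t)) = length (labels t)"
  by (induction t) (auto simp: length_concat o_def intro!: arg_cong[where f = sum_list])

lemma weight_shape [simp]: "weight (shape t) = weight t"
  by (induction t) (auto simp: o_def intro!: arg_cong[where f = prod_list])

lemma wf_depth_shape [simp]: "wf_depth r (shape t) = wf_depth r t"
  by (induction r t rule: wf_depth.induct) auto

lemma length_internals_shape [simp]: "length (internals r (shape t)) = length (internals r t)"
  by (induction r t rule: internals.induct) (auto simp: length_concat o_def intro!: arg_cong[where f = sum_list])

lemma good_shape [simp]: "good D h (shape t) = good D h t"
proof (induction D h t rule: good.induct)
  case (2 D h a ts)
  have "filter (good D h) (map shape ts) = map shape (filter (good D h) ts)"
    using 2 by (induction ts) auto
  then show ?case by simp
qed simp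

lemma exists_labelling:
  "length ys = length (labels \<sigma>) \<Longrightarrow> \<exists>t. shape t = \<sigma> \<and> labels t = ys" for \<sigma> :: "unit rtree"
proof (induction \<sigma> arbitrary: ys)
  case (Nd a \<sigma>s)
  obtain x xs where ys: "ys = x # xs" "length xs = length (concat (map labels \<sigma>s))"
    using Nd.prems by (cases ys) auto
  have "\<exists>ts. map shape ts = \<sigma>s \<and> concat (map labels ts) = xs"
    using Nd.IH ys(2)
  proof (induction \<sigma>s arbitrary: xs)
    case (Cons \<sigma> \<sigma>s)
    let ?k = "length (labels \<sigma>)"
    have "\<exists>t. shape t = \<sigma> \<and> labels t = take ?k xs" using Cons.prems by auto
    moreover have "\<exists>ts. map shape ts = \<sigma>s \<and> concat (map labels ts) = drop ?k xs"
      using Cons.prems by (intro Cons.IH) auto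
    ultimately obtain t ts where "shape t = \<sigma>" "labels t = take ?k xs" "map shape ts = \<sigma>s" "concat (map labels ts) = drop ?k xs"
      by blast
    then show ?case by (intro exI[of _ "t # ts"]) auto
  qed simp
  then obtain ts where "map shape ts = \<sigma>s" "concat (map labels ts) = xs" by blast
  then show ?case using ys by (intro exI[of _ "Nd x ts"]) auto
qed

lemma finite_rtrees: "finite {t :: unit rtree. length (labels t) \<le> s}"
proof (induction s)
  case 0
  then show ?case by simp
next
  case (Suc s)
  have "{t :: unit rtree. length (labels t) \<le> Suc s} \<subseteq>
      Nd () ` {ts. set ts \<subseteq> {t. length (labels t) \<le> s} \<and> length ts \<le> s}"
  proof
    fix t :: "unit rtree" assume t: "t \<in> {t. length (labels t) \<le> Suc s}"
    obtain ts where ts: "t = Nd () ts" by (cases t) auto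
    have le: "sum_list (map (length \<circ> labels) ts) \<le> s" using t by (simp add: ts length_concat)
    have "length (labels u) \<le> s" if "u \<in> set ts" for u
      using member_le_sum_list[of "length (labels u)" "map (length \<circ> labels) ts"] that le by fastforce
    moreover have "length ts \<le> sum_list (map (length \<circ> labels) ts)"
    proof (induction ts)
      case (Cons u ts)
      have "1 \<le> length (labels u)" by (simp add: Suc_le_eq)
      then show ?case using Cons by simp
    qed simp
    ultimately show "t \<in> Nd () ` {ts. set ts \<subseteq> {t. length (labels t) \<le> s} \<and> length ts \<le> s}"
      using le by (auto simp: ts)
  qed
  then show ?case using finite_lists_length_le[OF Suc] finite_surj by blast
qed

text \<open>A labelling is chosen through its list of labels in preorder, which starts with
  \<open>v\<close>; counting labellings becomes counting lists of distinct vertices.\<close>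

definition labellings :: "nat \<Rightarrow> nat \<Rightarrow> unit rtree \<Rightarrow> nat rtree set" where
  "labellings n v \<sigma> = (\<lambda>ys. SOME t. shape t = \<sigma> \<and> labels t = v # ys) `
     {ys. length ys = length (labels \<sigma>) - 1 \<and> distinct ys \<and> set ys \<subseteq> {..<n} - {v}}"

lemma labellings_props:
  assumes "v < n"
  shows "t \<in> labellings n v \<sigma> \<Longrightarrow> shape t = \<sigma> \<and> lab t = v \<and> distinct (labels t) \<and> set (labels t) \<subseteq> {..<n}"
    and "card (labellings n v \<sigma>) = card {ys. length ys = length (labels \<sigma>) - 1 \<and> distinct ys \<and> set ys \<subseteq> {..<n} - {v}}"
    and "finite (labellings n v \<sigma>)"
proof -
  let ?X = "{ys. length ys = length (labels \<sigma>) - 1 \<and> distinct ys \<and> set ys \<subseteq> {..<n} - {v}}"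
  let ?f = "\<lambda>ys. SOME t. shape t = \<sigma> \<and> labels t = v # ys"
  have f: "shape (?f ys) = \<sigma> \<and> labels (?f ys) = v # ys" if "ys \<in> ?X" for ys
  proof -
    have "0 < length (labels \<sigma>)" by simp
    then have "\<exists>t. shape t = \<sigma> \<and> labels t = v # ys" using that by (intro exists_labelling) auto
    then show ?thesis by (rule someI_ex)
  qed
  show "t \<in> labellings n v \<sigma> \<Longrightarrow> shape t = \<sigma> \<and> lab t = v \<and> distinct (labels t) \<and> set (labels t) \<subseteq> {..<n}"
  proof -
    assume "t \<in> labellings n v \<sigma>"
    then obtain ys where ys: "ys \<in> ?X" "t = ?f ys" by (auto simp: labellings_def)
    then have "labels t = v # ys" "shape t = \<sigma>" using f by auto
    moreover from this have "lab t = v" by (cases t) auto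
    ultimately show ?thesis using ys assms by auto
  qed
  have "inj_on ?f ?X"
  proof (rule inj_onI)
    fix x y assume "x \<in> ?X" "y \<in> ?X" "?f x = ?f y"
    then have "v # x = v # y" using f[of x] f[of y] by metis
    then show "x = y" by simp
  qed
  then show "card (labellings n v \<sigma>) = card ?X" unfolding labellings_def by (rule card_image)
  have "?X \<subseteq> {ys. set ys \<subseteq> {..<n} \<and> length ys = length (labels \<sigma>) - 1}" by auto
  then have "finite ?X" using finite_lists_length_eq[of "{..<n}"] finite_subset by blast
  then show "finite (labellings n v \<sigma>)" unfolding labellings_def by simp
qed

lemma card_labellings_ge:
  assumes "v < n" "length (labels \<sigma>) \<le> s" "s \<le> n"
  shows "(real n - real s) ^ (length (labels \<sigma>) - 1) \<le> real (card (labellings n v \<sigma>))"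
proof -
  let ?e = "length (labels \<sigma>) - 1"
  have l: "0 < length (labels \<sigma>)" by simp
  have c: "card ({..<n} - {v}) = n - 1" using assms by simp
  have "card {ys. length ys = ?e \<and> distinct ys \<and> set ys \<subseteq> {..<n} - {v}} = \<Prod>{n - 1 - ?e + 1..n - 1}"
    using card_lists_distinct_length_eq[of "{..<n} - {v}" ?e] assms c l by auto
  moreover have "(n - s) ^ ?e \<le> \<Prod>{n - 1 - ?e + 1..n - 1}"
  proof -
    have "(n - s) ^ ?e = (\<Prod>i\<in>{n - 1 - ?e + 1..n - 1}. n - s)" using assms l by simp
    also have "\<dots> \<le> (\<Prod>i\<in>{n - 1 - ?e + 1..n - 1}. i)" using assms l by (intro prod_mono) auto
    finally show ?thesis .
  qed
  ultimately have "(n - s) ^ ?e \<le> card (labellings n v \<sigma>)" using labellings_props(2)[OF assms(1)] by simp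
  then have "real ((n - s) ^ ?e) \<le> real (card (labellings n v \<sigma>))" by linarith
  then show ?thesis using assms by (simp add: of_nat_diff)
qed

text \<open>A shape with e non-root and i internal vertices has at least (n - s)^e labellings, each
  explored with probability at least p^e (1 - p)^(n i). Times \<open>weight\<close>, this is the
  Galton--Watson mass up to a factor 1 - s/n per label and \<open>(1 - p) ^ n * exp lam\<close> per
  internal vertex. Both factors are at most 1 and occur at most s times. Larger trees are discarded
  by the tail bound.\<close>

theorem prob_emb_uniq_ge:
  assumes lam: "0 < lam" "lam \<le> real n" and v: "v < n" and hr: "h \<le> r" and s: "s \<le> n"
  shows "((1 - real s / real n) * (1 - lam / real n) ^ n * exp lam) ^ s *
      (perc D lam h - 2 * exp (- (real s / (2 + 2 * lam) ^ Suc r))) \<le>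
    measure_pmf.prob (random_subset (all_edges n) (lam / real n))
      {w. (\<exists>\<phi>. emb D h n w \<phi> \<and> \<phi> [] = v) \<and> uniq w r v}"
proof -
  have n: "0 < real n" using lam by linarith
  define p where "p = lam / real n"
  have p: "0 \<le> p" "p \<le> 1" using lam n by (auto simp: p_def)
  let ?M = "random_subset (all_edges n) p"
  let ?A = "{w. (\<exists>\<phi>. emb D h n w \<phi> \<and> \<phi> [] = v) \<and> uniq w r v}"
  define Sh where "Sh = {\<sigma> :: unit rtree. wf_depth r \<sigma> \<and> good D h \<sigma> \<and> length (labels \<sigma>) \<le> s}"
  have finSh: "finite Sh" unfolding Sh_def by (rule finite_subset[OF _ finite_rtrees[of s]]) auto
  define c where "c = (1 - real s / real n) * (1 - p) ^ n * exp lam"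
  define a where "a = 1 - real s / real n"
  define b where "b = (1 - p) ^ n * exp lam"
  have a: "0 \<le> a" "a \<le> 1" using s n by (auto simp: a_def)
  have b: "0 \<le> b" "b \<le> 1"
  proof -
    show "0 \<le> b" using p by (simp add: b_def)
    have "(1 - p) ^ n \<le> exp (- p) ^ n" using p exp_ge_add_one_self[of "- p"] by (intro power_mono) auto
    also have "\<dots> = exp (- lam)" using n by (simp add: p_def flip: exp_of_nat_mult)
    finally have "(1 - p) ^ n * exp lam \<le> exp (- lam) * exp lam" by (intro mult_right_mono) auto
    then show "b \<le> 1" by (simp add: b_def flip: exp_add)
  qed
  have cab: "c = a * b" by (simp add: c_def a_def b_def)
  then have c0: "0 \<le> c" using a b by simp
  have termwise: "c ^ s * pmf (gw lam r) \<sigma> \<le> (\<Sum>t\<in>labellings n v \<sigma>. weight t * measure_pmf.prob ?M {w. explored w r {} t})"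
    if "\<sigma> \<in> Sh" for \<sigma>
  proof -
    let ?e = "length (labels \<sigma>) - 1"
    let ?i = "length (internals r \<sigma>)"
    have \<sigma>: "wf_depth r \<sigma>" "length (labels \<sigma>) \<le> s" using that by (auto simp: Sh_def)
    have es: "?e \<le> s" "?i \<le> s" using \<sigma>(2) length_internals_le[of r \<sigma>] by auto
    have w0: "0 \<le> weight \<sigma>" by (rule weight_nonneg)
    have n0: "real n \<noteq> 0" using n by simp
    have "c ^ s * pmf (gw lam r) \<sigma> = a ^ s * b ^ s * (weight \<sigma> * lam ^ ?e * exp (- lam) ^ ?i)"
      using pmf_gw[OF lam(1) \<sigma>(1)] by (simp add: cab power_mult_distrib)
    also have "\<dots> \<le> a ^ ?e * b ^ ?i * (weight \<sigma> * lam ^ ?e * exp (- lam) ^ ?i)"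
      using a b es w0 lam by (intro mult_right_mono mult_mono power_decreasing) auto
    also have "\<dots> = (a * lam) ^ ?e * (b * exp (- lam)) ^ ?i * weight \<sigma>"
      by (simp add: power_mult_distrib)
    also have "a * lam = (real n - real s) * p" using n0 by (simp add: a_def p_def field_simps)
    also have "b * exp (- lam) = (1 - p) ^ n" by (simp add: b_def exp_minus)
    also have "((real n - real s) * p) ^ ?e * ((1 - p) ^ n) ^ ?i * weight \<sigma> =
        (real n - real s) ^ ?e * (weight \<sigma> * (p ^ ?e * (1 - p) ^ (n * ?i)))"
      by (simp add: power_mult_distrib power_mult)
    also have "\<dots> \<le> real (card (labellings n v \<sigma>)) * (weight \<sigma> * (p ^ ?e * (1 - p) ^ (n * ?i)))"
      using card_labellings_ge[OF v \<sigma>(2) s] w0 p by (intro mult_right_mono) auto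
    also have "\<dots> = (\<Sum>t\<in>labellings n v \<sigma>. weight \<sigma> * (p ^ ?e * (1 - p) ^ (n * ?i)))" by simp
    also have "\<dots> \<le> (\<Sum>t\<in>labellings n v \<sigma>. weight t * measure_pmf.prob ?M {w. explored w r {} t})"
    proof (rule sum_mono)
      fix t assume "t \<in> labellings n v \<sigma>"
      then have t: "\<sigma> = shape t" "distinct (labels t)" "set (labels t) \<subseteq> {..<n}"
        using labellings_props(1)[OF v] by auto
      then have "p ^ ?e * (1 - p) ^ (n * ?i) \<le> measure_pmf.prob ?M {w. explored w r {} t}"
        using prob_explored_ge[OF p t(2) _ t(3), of r] \<sigma>(1) by simp
      then show "weight \<sigma> * (p ^ ?e * (1 - p) ^ (n * ?i)) \<le> weight t * measure_pmf.prob ?M {w. explored w r {} t}"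
        using weight_nonneg[of t] by (simp add: t(1) mult_left_mono)
    qed
    finally show ?thesis .
  qed
  define T where "T = (\<Union>\<sigma>\<in>Sh. labellings n v \<sigma>)"
  have finT: "finite T" using finSh labellings_props(3)[OF v] by (auto simp: T_def)
  have "perc D lam h \<le> measure_pmf.prob (gw lam r) (Sh \<union> {t. s < length (labels t)})"
    unfolding prob_gw_good[OF lam(1) hr, symmetric]
    by (rule measure_pmf.finite_measure_mono_AE) (auto intro!: AE_pmfI simp: Sh_def dest: set_pmf_gw)
  also have "\<dots> \<le> measure_pmf.prob (gw lam r) Sh + measure_pmf.prob (gw lam r) {t. s < length (labels t)}"
    by (rule measure_Un_le) auto
  also have "\<dots> \<le> measure_pmf.prob (gw lam r) Sh + 2 * exp (- (real s / (2 + 2 * lam) ^ Suc r))"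
    using gw_size_tail[OF lam(1)] by (intro add_left_mono)
  finally have "perc D lam h - 2 * exp (- (real s / (2 + 2 * lam) ^ Suc r)) \<le> measure_pmf.prob (gw lam r) Sh" by simp
  then have "c ^ s * (perc D lam h - 2 * exp (- (real s / (2 + 2 * lam) ^ Suc r))) \<le> c ^ s * measure_pmf.prob (gw lam r) Sh"
    using c0 by (intro mult_left_mono) auto
  also have "\<dots> = (\<Sum>\<sigma>\<in>Sh. c ^ s * pmf (gw lam r) \<sigma>)"
    by (simp add: measure_measure_pmf_finite[OF finSh] sum_distrib_left)
  also have "\<dots> \<le> (\<Sum>\<sigma>\<in>Sh. \<Sum>t\<in>labellings n v \<sigma>. weight t * measure_pmf.prob ?M {w. explored w r {} t})"
    using termwise by (rule sum_mono)
  also have "\<dots> = (\<Sum>t\<in>T. weight t * measure_pmf.prob ?M {w. explored w r {} t})"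
    using finSh labellings_props[OF v] unfolding T_def by (intro sum.UNION_disjoint[symmetric]) blast+
  also have "\<dots> = (\<Sum>t\<in>T. measure_pmf.expectation ?M (\<lambda>w. weight t * indicat_real {w. explored w r {} t} w))"
    by simp
  also have "\<dots> = measure_pmf.expectation ?M (\<lambda>w. \<Sum>t\<in>T. weight t * indicat_real {w. explored w r {} t} w)"
    by (intro Bochner_Integration.integral_sum[symmetric] integrable_mult_right integrable_measure_pmf_finite)
       (auto simp: finite_set_pmf_random_subset)
  \<comment> \<open>Several orderings of one neighbourhood are counted, but their weights add up to
    at most 1 in every graph, so the sum is below the indicator of the event.\<close>
  also have "\<dots> \<le> measure_pmf.expectation ?M (indicat_real ?A)"
  proof (rule integral_mono_AE)
    show "AE w in measure_pmf ?M. (\<Sum>t\<in>T. weight t * indicat_real {w. explored w r {} t} w) \<le> indicat_real ?A w"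
    proof (rule AE_pmfI)
      fix w assume "w \<in> set_pmf ?M"
      from finite_subset[OF set_pmf_random_subset[OF finite_all_edges this] finite_all_edges] have finw: "finite w" .
      let ?T' = "{t\<in>T. explored w r {} t}"
      have eq: "(\<Sum>t\<in>T. weight t * indicat_real {w. explored w r {} t} w) = sum weight ?T'"
        unfolding sum.inter_filter[OF finT] by (intro sum.cong) (auto simp: indicator_def)
      show "(\<Sum>t\<in>T. weight t * indicat_real {w. explored w r {} t} w) \<le> indicat_real ?A w"
      proof (cases "?T' = {}")
        case True
        then show ?thesis unfolding eq True by simp
      next
        case False
        then obtain t where "t \<in> T" and te: "explored w r {} t" by auto
        then obtain \<sigma> where "\<sigma> \<in> Sh" "t \<in> labellings n v \<sigma>" by (auto simp: T_def)
        note t = this te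
        have tp: "shape t = \<sigma>" "lab t = v" "distinct (labels t)" "set (labels t) \<subseteq> {..<n}"
          using labellings_props(1)[OF v t(2)] by auto
        have "good D h t" using t(1) tp(1) good_shape[of D h t] by (simp add: Sh_def)
        from emb_of_good[OF this t(3) hr tp(3,4)] obtain \<phi> where "emb D h n w \<phi>" "\<phi> [] = v"
          unfolding tp(2) by blast
        moreover have "uniq w r v" using uniq_if_explored[OF t(3) tp(3)] tp(2) by simp
        ultimately have "w \<in> ?A" by blast
        moreover have "sum weight ?T' \<le> 1"
        proof (rule sum_weight_explored_le_1[OF finw, where r = r and par = "{}" and v = v])
          show "?T' \<subseteq> {t. explored w r {} t \<and> lab t = v}"
          proof
            fix t assume "t \<in> ?T'"
            then have "t \<in> T" "explored w r {} t" by auto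
            then obtain \<sigma> where "t \<in> labellings n v \<sigma>" by (auto simp: T_def)
            from labellings_props(1)[OF v this] \<open>explored w r {} t\<close>
            show "t \<in> {t. explored w r {} t \<and> lab t = v}" by simp
          qed
        qed (use finT in simp)
        ultimately show ?thesis unfolding eq by (simp only: indicator_simps)
      qed
    qed
  qed (auto intro!: integrable_measure_pmf_finite simp: finite_set_pmf_random_subset)
  also have "\<dots> = measure_pmf.prob ?M ?A" by simp
  finally show ?thesis by (simp add: c_def p_def)
qed

section \<open>Copies of the tree and disjoint occurrence\<close>

lemma nb_sym: "b \<in> nb w a \<longleftrightarrow> a \<in> nb w b"
  by (auto simp: nb_def edge_commute)

lemma nb_less: "w \<subseteq> all_edges n \<Longrightarrow> b \<in> nb w a \<Longrightarrow> b < n"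
  by (auto simp: nb_def edge_def all_edges_def min_def max_def split: if_splits)

lemma tree_verts_mono: "k \<le> h \<Longrightarrow> tree_verts D k \<subseteq> tree_verts D h"
  by (auto simp: tree_verts_def)

lemma emb_mono: "emb D h n w \<phi> \<Longrightarrow> k \<le> h \<Longrightarrow> emb D k n w \<phi>"
  unfolding emb_def using tree_verts_mono[of k h D] inj_on_subset by (auto 4 3)

lemma emb_less: "emb D h n w \<phi> \<Longrightarrow> u \<in> tree_verts D h \<Longrightarrow> \<phi> u < n"
  by (auto simp: emb_def image_subset_iff)

lemma inj_on_sub: "inj_on \<phi> (tree_verts D (Suc h)) \<Longrightarrow> i < D \<Longrightarrow> inj_on (\<lambda>u. \<phi> (i # u)) (tree_verts D h)"
  by (rule inj_onI) (drule inj_onD[where x = "i # _" and y = "i # _"], auto)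

lemma emb_sub: "emb D (Suc h) n w \<phi> \<Longrightarrow> i < D \<Longrightarrow> emb D h n w (\<lambda>u. \<phi> (i # u))"
  unfolding emb_def using inj_on_sub[of \<phi> D h i]
  by (auto simp: image_subset_iff) (metis Suc_less_eq append_Cons insert_subset length_Cons lessThan_iff list.set(2))

section \<open>Edge sets of copies as witnesses\<close>

definition tedges :: "nat \<Rightarrow> nat \<Rightarrow> (nat list \<Rightarrow> nat) \<Rightarrow> (nat \<times> nat) set" where
  "tedges D h \<phi> = {edge (\<phi> u) (\<phi> (u @ [i])) | u i. length u < h \<and> set u \<subseteq> {..<D} \<and> i < D}"

definition branch :: "nat \<Rightarrow> nat \<Rightarrow> (nat list \<Rightarrow> nat) \<Rightarrow> nat \<Rightarrow> (nat \<times> nat) set" where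
  "branch D h \<phi> i = insert (edge (\<phi> []) (\<phi> [i])) (tedges D h (\<lambda>u. \<phi> (i # u)))"

lemma tedges_Suc: "tedges D (Suc h) \<phi> = (\<Union>i<D. branch D h \<phi> i)"
proof (intro equalityI subsetI)
  fix e assume "e \<in> tedges D (Suc h) \<phi>"
  then obtain u i where u: "e = edge (\<phi> u) (\<phi> (u @ [i]))" "length u < Suc h" "set u \<subseteq> {..<D}" "i < D"
    by (auto simp: tedges_def)
  show "e \<in> (\<Union>i<D. branch D h \<phi> i)"
  proof (cases u)
    case Nil
    then show ?thesis using u by (auto simp: branch_def)
  next
    case (Cons j u')
    then have "e \<in> tedges D h (\<lambda>u. \<phi> (j # u))" using u unfolding tedges_def by auto
    then show ?thesis using u Cons by (auto simp: branch_def)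
  qed
next
  fix e assume "e \<in> (\<Union>i<D. branch D h \<phi> i)"
  then obtain i where i: "i < D" "e = edge (\<phi> []) (\<phi> [i]) \<or> e \<in> tedges D h (\<lambda>u. \<phi> (i # u))"
    by (auto simp: branch_def)
  then show "e \<in> tedges D (Suc h) \<phi>"
  proof (elim disjE)
    assume "e = edge (\<phi> []) (\<phi> [i])"
    then show ?thesis unfolding tedges_def using i(1) by (auto intro!: exI[of _ "[]"] exI[of _ i])
  next
    assume "e \<in> tedges D h (\<lambda>u. \<phi> (i # u))"
    then obtain u j where "e = edge (\<phi> (i # u)) (\<phi> ((i # u) @ [j]))" "length u < h" "set u \<subseteq> {..<D}" "j < D"
      by (auto simp: tedges_def)
    then show ?thesis unfolding tedges_def using i(1) by (intro CollectI exI[of _ "i # u"] exI[of _ j]) auto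
  qed
qed

lemma tedges_verts:
  assumes "e \<in> tedges D h \<phi>"
  shows "\<exists>x y. x \<in> \<phi> ` tree_verts D h \<and> y \<in> \<phi> ` tree_verts D h \<and> e = edge x y"
proof -
  obtain u i where u: "e = edge (\<phi> u) (\<phi> (u @ [i]))" "length u < h" "set u \<subseteq> {..<D}" "i < D"
    using assms by (auto simp: tedges_def)
  then have "u \<in> tree_verts D h" "u @ [i] \<in> tree_verts D h" by (auto simp: tree_verts_def)
  then show ?thesis using u by blast
qed

lemma branch_verts:
  assumes "e \<in> branch D h \<phi> i"
  shows "\<exists>x y. x \<in> insert (\<phi> []) ((\<lambda>u. \<phi> (i # u)) ` tree_verts D h) \<and> y \<in> (\<lambda>u. \<phi> (i # u)) ` tree_verts D h \<and> e = edge x y"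
proof (cases "e = edge (\<phi> []) (\<phi> [i])")
  case True
  then show ?thesis by (intro exI[of _ "\<phi> []"] exI[of _ "\<phi> [i]"]) (auto intro!: image_eqI[of _ _ "[]"])
next
  case False
  then show ?thesis using assms tedges_verts[of e D h "\<lambda>u. \<phi> (i # u)"] by (auto simp: branch_def)
qed

lemma branch_disjoint:
  assumes inj: "inj_on \<phi> (tree_verts D (Suc h))" and ij: "i < D" "j < D" "i \<noteq> j"
  shows "branch D h \<phi> i \<inter> branch D h \<phi> j = {}"
proof (rule ccontr)
  assume "\<not> ?thesis"
  then obtain e where "e \<in> branch D h \<phi> i" "e \<in> branch D h \<phi> j" by blast
  then obtain x y x' y' where xy: "x \<in> insert (\<phi> []) ((\<lambda>u. \<phi> (i # u)) ` tree_verts D h)" "y \<in> (\<lambda>u. \<phi> (i # u)) ` tree_verts D h"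
     "x' \<in> insert (\<phi> []) ((\<lambda>u. \<phi> (j # u)) ` tree_verts D h)" "y' \<in> (\<lambda>u. \<phi> (j # u)) ` tree_verts D h" "edge x y = edge x' y'"
    using branch_verts by metis
  have ne: "\<phi> (k # u) \<noteq> \<phi> []" if "k < D" "u \<in> tree_verts D h" for k u
    using inj_onD[OF inj, of "k # u" "[]"] that by auto
  have ne2: "\<phi> (i # u) \<noteq> \<phi> (j # u')" if "u \<in> tree_verts D h" "u' \<in> tree_verts D h" for u u'
    using inj_onD[OF inj, of "i # u" "j # u'"] that ij by auto
  show False using xy ne ne2 ij by (auto simp: edge_eq_iff)
qed

lemma branches_in_occ_aux:
  assumes inj: "inj_on \<phi> (tree_verts D (Suc h))" and ran: "\<phi> ` tree_verts D (Suc h) \<subseteq> {..<n}" and I: "I \<subseteq> {..<D}"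
    and ev: "\<And>\<psi>. inj_on \<psi> (tree_verts D h) \<Longrightarrow> \<psi> ` tree_verts D h \<subseteq> {..<n} \<Longrightarrow> tedges D h \<psi> \<in> tree_ev D n h (\<psi> [])"
  shows "(\<Union>i\<in>I. branch D h \<phi> i) \<in> occ (card I) (map (\<lambda>u. disj_occ (has_edge (\<phi> []) u) (tree_ev D n h u)) [0..<n])"
proof -
  have inj1: "inj_on (\<lambda>i. \<phi> [i]) I"
    using inj_onD[OF inj, of "[_]" "[_]"] I by (intro inj_onI) auto
  \<comment> \<open>\<open>occ\<close> is indexed by vertices of the graph, hence a branch is
    addressed through the vertex \<open>\<phi> [i]\<close>.\<close>
  let ?g = "inv_into I (\<lambda>i. \<phi> [i])"
  have g: "?g (\<phi> [i]) = i" if "i \<in> I" for i by (rule inv_into_f_f[OF inj1 that])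
  show ?thesis
  proof (rule occ_mapI[where I = "(\<lambda>i. \<phi> [i]) ` I" and W = "\<lambda>u. branch D h \<phi> (?g u)"])
    show "(\<lambda>i. \<phi> [i]) ` I \<subseteq> set [0..<n]"
    proof
      fix x assume "x \<in> (\<lambda>i. \<phi> [i]) ` I"
      then obtain i where i: "x = \<phi> [i]" "i < D" using I by auto
      then have "[i] \<in> tree_verts D (Suc h)" by simp
      then show "x \<in> set [0..<n]" using ran i by (auto simp: image_subset_iff simp del: Cons_in_tree_verts)
    qed
    show "card ((\<lambda>i. \<phi> [i]) ` I) = card I" using inj1 by (rule card_image)
    fix u assume u: "u \<in> (\<lambda>i. \<phi> [i]) ` I"
    then obtain i where i: "i \<in> I" "u = \<phi> [i]" "i < D" using I by auto
    have sub: "inj_on (\<lambda>u. \<phi> (i # u)) (tree_verts D h)" "(\<lambda>u. \<phi> (i # u)) ` tree_verts D h \<subseteq> {..<n}"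
      using inj_on_sub[OF inj i(3)] ran i(3) by (auto simp: image_subset_iff)
    have t: "tedges D h (\<lambda>u. \<phi> (i # u)) \<in> tree_ev D n h u" using ev[OF sub] i by simp
    have "edge (\<phi> []) (\<phi> [i]) \<notin> tedges D h (\<lambda>u. \<phi> (i # u))"
    proof
      assume "edge (\<phi> []) (\<phi> [i]) \<in> tedges D h (\<lambda>u. \<phi> (i # u))"
      then obtain u' where "u' \<in> tree_verts D h" "\<phi> [] = \<phi> (i # u')"
        using tedges_verts by (fastforce simp: edge_eq_iff)
      then show False using inj_onD[OF inj, of "[]" "i # u'"] i by auto
    qed
    then show "branch D h \<phi> (?g u) \<in> disj_occ (has_edge (\<phi> []) u) (tree_ev D n h u)"
      using t g i by (intro disj_occI[of "{edge (\<phi> []) u}" _ "tedges D h (\<lambda>u. \<phi> (i # u))"]) (auto simp: has_edge_def branch_def)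
    show "branch D h \<phi> (?g u) \<subseteq> (\<Union>i\<in>I. branch D h \<phi> i)" using g i by auto
    fix v assume "v \<in> (\<lambda>i. \<phi> [i]) ` I" "u \<noteq> v"
    then obtain j where j: "j \<in> I" "v = \<phi> [j]" "j < D" "i \<noteq> j" using I i by auto
    show "branch D h \<phi> (?g u) \<inter> branch D h \<phi> (?g v) = {}"
      using branch_disjoint[OF inj i(3) j(3,4)] g i j by simp
  qed simp
qed

lemma tedges_in_tree_ev:
  assumes "inj_on \<phi> (tree_verts D h)" "\<phi> ` tree_verts D h \<subseteq> {..<n}"
  shows "tedges D h \<phi> \<in> tree_ev D n h (\<phi> [])"
  using assms
proof (induction h arbitrary: \<phi>)
  case (Suc h)
  then show ?case using branches_in_occ_aux[OF Suc.prems, of "{..<D}"] by (simp add: tedges_Suc)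
qed simp

lemma branches_in_occ:
  assumes "emb D (Suc h) n w \<phi>" "I \<subseteq> {..<D}"
  shows "(\<Union>i\<in>I. branch D h \<phi> i) \<in> occ (card I) (map (\<lambda>u. disj_occ (has_edge (\<phi> []) u) (tree_ev D n h u)) [0..<n])"
  using branches_in_occ_aux[OF _ _ assms(2)] tedges_in_tree_ev assms(1) by (simp add: emb_def)

lemma tedges_subset: "emb D h n w \<phi> \<Longrightarrow> tedges D h \<phi> \<subseteq> w"
  by (auto simp: tedges_def emb_def nb_def)

lemma branch_subset: "emb D (Suc h) n w \<phi> \<Longrightarrow> i < D \<Longrightarrow> branch D h \<phi> i \<subseteq> w"
  using tedges_subset[of D "Suc h" n w \<phi>] by (auto simp: tedges_Suc)

lemma emb_tree_ev:
  assumes "emb D h n w \<phi>" shows "w \<in> tree_ev D n h (\<phi> [])"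
  using upclosedD[OF upclosed_tree_ev tedges_in_tree_ev tedges_subset[OF assms]] assms by (simp add: emb_def)

lemma disjoint_embs:
  assumes "emb D h n w \<phi>" "emb D h n w \<phi>'" "\<phi> ` tree_verts D h \<inter> \<phi>' ` tree_verts D h = {}"
  shows "w \<in> disj_occ (tree_ev D n h (\<phi> [])) (tree_ev D n h (\<phi>' []))"
proof (rule disj_occI)
  show "tedges D h \<phi> \<inter> tedges D h \<phi>' = {}"
  proof (rule ccontr)
    assume "\<not> ?thesis"
    then obtain e where "e \<in> tedges D h \<phi>" "e \<in> tedges D h \<phi>'" by blast
    then obtain x y x' y' where "x \<in> \<phi> ` tree_verts D h" "x' \<in> \<phi>' ` tree_verts D h" "y' \<in> \<phi>' ` tree_verts D h" "edge x y = edge x' y'"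
      using tedges_verts by metis
    then show False using assms(3) by (auto simp: edge_eq_iff)
  qed
  show "tedges D h \<phi> \<in> tree_ev D n h (\<phi> [])" "tedges D h \<phi>' \<in> tree_ev D n h (\<phi>' [])"
    using assms(1,2) by (auto simp: emb_def intro!: tedges_in_tree_ev)
qed (rule tedges_subset[OF assms(1)], rule tedges_subset[OF assms(2)])

section \<open>Walks through copies\<close>

lemma nbwalk_append_left: "nbwalk w (xs @ ys) \<Longrightarrow> xs \<noteq> [] \<Longrightarrow> nbwalk w xs"
proof (induction w xs rule: nbwalk.induct)
  case (3 w x y zs)
  then show ?case by (cases zs) auto
qed auto

lemma nbwalk_snoc:
  "nbwalk w (xs @ [a]) \<Longrightarrow> b \<in> nb w a \<Longrightarrow> (xs \<noteq> [] \<Longrightarrow> last xs \<noteq> b) \<Longrightarrow> nbwalk w (xs @ [a, b])"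
proof (induction w xs rule: nbwalk.induct)
  case (3 w x y zs)
  then show ?case by (cases zs) auto
qed auto

lemma nbwalk_last3: "nbwalk w (xs @ [a, b, c]) \<Longrightarrow> a \<noteq> c"
  by (induction w xs rule: nbwalk.induct) auto

definition conn :: "(nat \<times> nat) set \<Rightarrow> nat \<Rightarrow> nat \<Rightarrow> nat \<Rightarrow> bool" where
  "conn w k a b \<longleftrightarrow> (\<exists>xs. nbwalk w xs \<and> hd xs = a \<and> last xs = b \<and> length xs \<le> Suc k)"

lemma conn_refl: "conn w 0 a a"
  unfolding conn_def by (intro exI[of _ "[a]"]) auto

text \<open>If prepending \<open>a\<close> would make the walk turn back, then the walk visits
  \<open>a\<close> in its second step and its tail serves.\<close>

lemma conn_step:
  assumes "conn w k b c" "b \<in> nb w a" shows "conn w (Suc k) a c"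
proof -
  obtain xs where xs: "nbwalk w xs" "hd xs = b" "last xs = c" "length xs \<le> Suc k"
    using assms by (auto simp: conn_def)
  then obtain zs where z: "xs = b # zs" by (cases xs) auto
  show ?thesis
  proof (cases "zs \<noteq> [] \<and> hd zs = a")
    case True
    then obtain ws where "zs = a # ws" by (cases zs) auto
    then show ?thesis unfolding conn_def using xs z by (intro exI[of _ zs]) auto
  next
    case False
    then show ?thesis unfolding conn_def using xs z assms by (intro exI[of _ "a # xs"]) auto
  qed
qed

lemma conn_emb_up:
  assumes "emb D h n w \<phi>" "u \<in> tree_verts D h" "conn w k (\<phi> u) c"
  shows "conn w (k + length u) (\<phi> []) c"
  using assms(2,3)
proof (induction u arbitrary: k rule: rev_induct)
  case (snoc i u)
  then have "\<phi> (u @ [i]) \<in> nb w (\<phi> u)" using assms(1) by (auto simp: emb_def tree_verts_def)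
  then have "conn w (Suc k) (\<phi> u) c" using conn_step snoc by blast
  from snoc.IH[OF _ this] snoc.prems show ?case by (auto simp: tree_verts_def)
qed simp

lemma conn_emb_down:
  assumes "emb D h n w \<phi>" "u \<in> tree_verts D h"
  shows "conn w (length u) (\<phi> u) (\<phi> [])"
  using assms(2)
proof (induction u rule: rev_induct)
  case (snoc i u)
  then have "\<phi> (u @ [i]) \<in> nb w (\<phi> u)" using assms(1) by (auto simp: emb_def tree_verts_def)
  then have "\<phi> u \<in> nb w (\<phi> (u @ [i]))" using nb_sym by blast
  moreover have "conn w (length u) (\<phi> u) (\<phi> [])" using snoc by (auto simp: tree_verts_def)
  ultimately show ?case using conn_step by fastforce
qed (simp add: conn_refl)

text \<open>\<open>end_edge w v L e xs\<close>: \<open>e\<close> is the last edge of the non-backtracking walk \<open>xs\<close> from \<open>v\<close>. If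
  non-backtracking walks from \<open>v\<close> are determined by their endpoint, then \<open>e\<close> determines \<open>xs\<close>, so sets of edges
  can be separated by separating the walks that lead to them.\<close>
definition end_edge :: "(nat \<times> nat) set \<Rightarrow> nat \<Rightarrow> nat \<Rightarrow> nat \<times> nat \<Rightarrow> nat list \<Rightarrow> bool" where
  "end_edge w v L e xs \<longleftrightarrow> (\<exists>ys a b. xs = ys @ [a, b] \<and> nbwalk w xs \<and> hd xs = v \<and> length xs \<le> Suc L \<and> e = edge a b)"

lemma end_edgeI:
  "xs = ys @ [a, b] \<Longrightarrow> nbwalk w xs \<Longrightarrow> hd xs = v \<Longrightarrow> length xs \<le> Suc L \<Longrightarrow> e = edge a b \<Longrightarrow> end_edge w v L e xs"
  unfolding end_edge_def by blast

lemma uniqD: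
  assumes "uniq w L v" "nbwalk w xs" "nbwalk w ys" "hd xs = v" "hd ys = v" "length xs \<le> Suc L" "length ys \<le> Suc L"
    "last xs = last ys"
  shows "xs = ys"
proof -
  obtain xs' ys' where "xs = v # xs'" "ys = v # ys'" using assms(2-5) by (cases xs; cases ys) auto
  moreover from this have "xs' = ys'"
    using assms(1)[unfolded uniq_def, rule_format, of xs' ys'] assms(2-) by simp
  ultimately show ?thesis by simp
qed

text \<open>Crossing the edge in the same direction, both walks have the same endpoint. In opposite
  directions, \<open>xs\<close> without its last vertex has the endpoint of \<open>xs'\<close> and
  so equals it; then \<open>xs\<close> would end with b, a, b and turn back.\<close>

lemma end_edge_unique:
  assumes u: "uniq w L v" and "end_edge w v L e xs" "end_edge w v L e xs'"
  shows "xs = xs'"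
proof -
  obtain ys a b where x: "xs = ys @ [a, b]" "nbwalk w xs" "hd xs = v" "length xs \<le> Suc L" "e = edge a b"
    using assms by (auto simp: end_edge_def)
  obtain ys' c d where x': "xs' = ys' @ [c, d]" "nbwalk w xs'" "hd xs' = v" "length xs' \<le> Suc L" "e = edge c d"
    using assms by (auto simp: end_edge_def)
  consider "b = d" | "a = d" "b = c" using x x' by (auto simp: edge_eq_iff)
  then show ?thesis
  proof cases
    case 1
    then show ?thesis using uniqD[OF u, of xs xs'] x x' by simp
  next
    case 2
    have "nbwalk w (ys @ [a])" using nbwalk_append_left[of w "ys @ [a]" "[b]"] x by simp
    moreover have "hd (ys @ [a]) = v" using x by (cases ys) auto
    ultimately have "ys @ [a] = xs'" using uniqD[OF u, of "ys @ [a]" xs'] x x' 2 by simp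
    then have "xs = ys' @ [b, a, b]" using x x' 2 by simp
    then show ?thesis using x nbwalk_last3 by blast
  qed
qed

text \<open>\<open>y\<close> is a walk from \<open>v\<close> to the root of the copy, with that root
  left off, and is continued down branch i. The walk does not turn back at the junction by
  assumption, nor inside the copy by injectivity.\<close>

lemma end_edge_branch:
  assumes e: "emb D (Suc h) n w \<phi>" "i < D" and y: "nbwalk w (y @ [\<phi> []])" "hd (y @ [\<phi> []]) = v" "y \<noteq> [] \<Longrightarrow> last y \<noteq> \<phi> [i]"
    and len: "length y + Suc (Suc h) \<le> Suc L" and b: "b \<in> branch D h \<phi> i"
  shows "\<exists>zs. end_edge w v L b (y @ [\<phi> [], \<phi> [i]] @ zs)"
proof -
  have inj: "inj_on \<phi> (tree_verts D (Suc h))" using e by (simp add: emb_def)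
  have e1: "\<phi> [i] \<in> nb w (\<phi> [])" using e unfolding emb_def by (metis append_Nil empty_iff list.set(1) list.size(3) subsetI zero_less_Suc)
  have nb1: "nbwalk w (y @ [\<phi> [], \<phi> [i]])" using nbwalk_snoc[OF y(1) e1] y(3) by blast
  have hd1: "hd (y @ [\<phi> [], \<phi> [i]] @ zs) = v" for zs using y(2) by (cases y) auto
  \<comment> \<open>The last two vertices are carried along, because an extension must be compared
    with the last but one.\<close>
  have walk: "\<exists>zs. nbwalk w (y @ [\<phi> [], \<phi> [i]] @ zs) \<and> (\<exists>ws. y @ [\<phi> [], \<phi> [i]] @ zs = ws @ [\<phi> (butlast (i # t)), \<phi> (i # t)]) \<and> length zs = length t"
    if "t \<in> tree_verts D h" for t
    using that
  proof (induction t rule: rev_induct)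
    case Nil
    then show ?case using nb1 by (intro exI[of _ "[]"]) auto
  next
    case (snoc j t)
    have t: "t \<in> tree_verts D h" "length (i # t) < Suc h" "set (i # t) \<subseteq> {..<D}" "j < D"
      using snoc.prems e by (auto simp: tree_verts_def)
    then obtain zs ws where zs: "nbwalk w (y @ [\<phi> [], \<phi> [i]] @ zs)" "y @ [\<phi> [], \<phi> [i]] @ zs = ws @ [\<phi> (butlast (i # t)), \<phi> (i # t)]" "length zs = length t"
      using snoc.IH by blast
    have "\<phi> ((i # t) @ [j]) \<in> nb w (\<phi> (i # t))" using e(1) t unfolding emb_def by blast
    moreover have "\<phi> (butlast (i # t)) \<noteq> \<phi> ((i # t) @ [j])"
    proof
      assume "\<phi> (butlast (i # t)) = \<phi> ((i # t) @ [j])"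
      moreover have "butlast (i # t) \<in> tree_verts D (Suc h)" "(i # t) @ [j] \<in> tree_verts D (Suc h)"
        using t by (auto simp: tree_verts_def dest: in_set_butlastD split: if_splits)
      ultimately have "butlast (i # t) = (i # t) @ [j]" using inj by (auto dest: inj_onD)
      then have "length (butlast (i # t)) = length ((i # t) @ [j])" by (rule arg_cong)
      then show False by (simp only: length_butlast) simp
    qed
    ultimately have A: "nbwalk w ((ws @ [\<phi> (butlast (i # t))]) @ [\<phi> (i # t), \<phi> ((i # t) @ [j])])"
      using zs by (intro nbwalk_snoc) auto
    have B: "(ws @ [\<phi> (butlast (i # t))]) @ [\<phi> (i # t), \<phi> ((i # t) @ [j])] = y @ [\<phi> [], \<phi> [i]] @ (zs @ [\<phi> ((i # t) @ [j])])"
      using zs(2) by simp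
    have C: "butlast (i # t @ [j]) = i # t" by (simp add: butlast_append)
    show ?case
    proof (intro exI conjI)
      show "nbwalk w (y @ [\<phi> [], \<phi> [i]] @ (zs @ [\<phi> ((i # t) @ [j])]))" using A unfolding B .
      show "y @ [\<phi> [], \<phi> [i]] @ (zs @ [\<phi> ((i # t) @ [j])]) =
          (ws @ [\<phi> (butlast (i # t))]) @ [\<phi> (butlast (i # t @ [j])), \<phi> (i # t @ [j])]"
        unfolding B[symmetric] C by simp
    qed (use zs(3) in simp)
  qed
  from b consider "b = edge (\<phi> []) (\<phi> [i])" | u j where "b = edge (\<phi> (i # u)) (\<phi> ((i # u) @ [j]))" "length u < h" "set u \<subseteq> {..<D}" "j < D"
    by (auto simp: branch_def tedges_def)
  then show ?thesis
  proof cases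
    case 1
    have "end_edge w v L b (y @ [\<phi> [], \<phi> [i]] @ [])"
      using 1 nb1 hd1[of "[]"] len by (intro end_edgeI) auto
    then show ?thesis by blast
  next
    case (2 u j)
    then have "u @ [j] \<in> tree_verts D h" by (auto simp: tree_verts_def)
    from walk[OF this] obtain zs ws where zs: "nbwalk w (y @ [\<phi> [], \<phi> [i]] @ zs)"
      "y @ [\<phi> [], \<phi> [i]] @ zs = ws @ [\<phi> (butlast (i # u @ [j])), \<phi> (i # u @ [j])]" "length zs = length (u @ [j])"
      by blast
    have len': "length (y @ [\<phi> [], \<phi> [i]] @ zs) \<le> Suc L" using zs(3) 2 len by simp
    have "butlast (i # u @ [j]) = i # u" by (simp add: butlast_append)
    then have "y @ [\<phi> [], \<phi> [i]] @ zs = ws @ [\<phi> (i # u), \<phi> ((i # u) @ [j])]" using zs(2) by simp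
    from end_edgeI[OF this zs(1) hd1 len' 2(1)] have "end_edge w v L b (y @ [\<phi> [], \<phi> [i]] @ zs)" .
    then show ?thesis by blast
  qed
qed

fun wedges :: "nat list \<Rightarrow> (nat \<times> nat) list" where
  "wedges (x # y # zs) = edge x y # wedges (y # zs)"
| "wedges _ = []"

text \<open>Nesting the disjoint occurrences yields the bound p to the number of edges for every
  vertex sequence, even one that repeats an edge.\<close>

fun path_ev :: "nat list \<Rightarrow> (nat \<times> nat) set set" where
  "path_ev (x # y # zs) = disj_occ (has_edge x y) (path_ev (y # zs))"
| "path_ev _ = UNIV"

lemma upclosed_path_ev [simp]: "upclosed (path_ev xs)"
  by (induction xs rule: path_ev.induct) auto

lemma prob_path_ev_le:
  assumes "finite E" "0 \<le> p" "p \<le> 1"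
  shows "measure_pmf.prob (random_subset E p) (path_ev xs) \<le> p ^ (length xs - 1)"
proof (induction xs rule: path_ev.induct)
  case (1 x y zs)
  have "measure_pmf.prob (random_subset E p) (path_ev (x # y # zs)) \<le>
     measure_pmf.prob (random_subset E p) (has_edge x y) * measure_pmf.prob (random_subset E p) (path_ev (y # zs))"
    unfolding path_ev.simps by (intro van_den_Berg_Kesten assms) auto
  also have "\<dots> \<le> p * p ^ (length (y # zs) - 1)"
    using 1 assms by (intro mult_mono prob_has_edge_le) auto
  finally show ?case by simp
qed (auto simp: measure_pmf.prob_le_1)

lemma wedges_in_path_ev: "distinct (wedges xs) \<Longrightarrow> set (wedges xs) \<in> path_ev xs"
proof (induction xs rule: path_ev.induct)
  case (1 x y zs)
  then show ?case by (intro path_ev.simps(1)[THEN equalityD2, THEN subsetD] disj_occI[of "{edge x y}" _ "set (wedges (y # zs))"]) (auto simp: has_edge_def)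
qed auto

lemma wedges_subset: "nbwalk w xs \<Longrightarrow> set (wedges xs) \<subseteq> w"
  by (induction w xs rule: nbwalk.induct) (auto simp: nb_def)

lemma length_wedges: "length (wedges xs) = length xs - 1"
  by (induction xs rule: wedges.induct) auto

lemma nth_wedges: "Suc i < length xs \<Longrightarrow> wedges xs ! i = edge (xs ! i) (xs ! Suc i)"
proof (induction xs arbitrary: i rule: wedges.induct)
  case (1 x y zs)
  then show ?case by (cases i) auto
qed auto

lemma end_edge_wedges:
  assumes "nbwalk w xs" "hd xs = v" "length xs \<le> Suc L" "Suc i < length xs"
  shows "end_edge w v L (wedges xs ! i) (take (Suc (Suc i)) xs)"
proof -
  have "take (Suc (Suc i)) xs = take i xs @ [xs ! i, xs ! Suc i]"
    using assms(4) by (simp add: take_Suc_conv_app_nth)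
  moreover have "nbwalk w (take (Suc (Suc i)) xs)"
    using assms nbwalk_append_left[of w "take (Suc (Suc i)) xs" "drop (Suc (Suc i)) xs"] by (cases xs) auto
  moreover have "hd (take (Suc (Suc i)) xs) = v" using assms by (cases xs) auto
  ultimately show ?thesis using nth_wedges[OF assms(4)] assms
    by (intro end_edgeI[of _ "take i xs" "xs ! i" "xs ! Suc i"]) auto
qed

lemma distinct_wedges:
  assumes "uniq w L v" "nbwalk w xs" "hd xs = v" "length xs \<le> Suc L"
  shows "distinct (wedges xs)"
  unfolding distinct_conv_nth
proof (intro allI impI)
  fix i j assume ij: "i < length (wedges xs)" "j < length (wedges xs)" "i \<noteq> j"
  then have ij': "Suc i < length xs" "Suc j < length xs" by (auto simp: length_wedges)
  show "wedges xs ! i \<noteq> wedges xs ! j"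
  proof
    assume "wedges xs ! i = wedges xs ! j"
    then have "take (Suc (Suc i)) xs = take (Suc (Suc j)) xs"
      using end_edge_unique[OF assms(1)] end_edge_wedges[OF assms(2-4)] ij' by metis
    then have "length (take (Suc (Suc i)) xs) = length (take (Suc (Suc j)) xs)" by simp
    then show False using ij' ij by simp
  qed
qed

lemma nbwalk_less:
  assumes "w \<subseteq> all_edges n" "nbwalk w xs" "hd xs < n" shows "set xs \<subseteq> {..<n}"
  using assms by (induction w xs rule: nbwalk.induct) (auto dest: nb_less)

section \<open>Pairs of overlapping copies\<close>

text \<open>By injectivity at most one child sits at \<open>x\<close>, which will be the neighbour
  of the root on the connecting path; the selected branches start off the path.\<close>

lemma children_avoiding:
  assumes inj: "inj_on \<phi> (tree_verts D (Suc h))"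
  shows "\<exists>I. I \<subseteq> {..<D} \<and> card I = D - 1 \<and> (\<forall>i\<in>I. \<phi> [i] \<noteq> x)"
proof -
  let ?B = "{i\<in>{..<D}. \<phi> [i] = x}"
  have one: "card ?B \<le> 1"
  proof -
    have "i = j" if "i \<in> ?B" "j \<in> ?B" for i j
    proof -
      have "[i] \<in> tree_verts D (Suc h)" "[j] \<in> tree_verts D (Suc h)" "\<phi> [i] = \<phi> [j]" using that by auto
      then have "[i] = [j]" using inj_onD[OF inj, of "[i]" "[j]"] by simp
      then show ?thesis by simp
    qed
    then show ?thesis using card_le_Suc0_iff_eq[of ?B] by auto
  qed
  have "D - 1 \<le> card ({..<D} - ?B)" using one by (subst card_Diff_subset) auto
  then obtain I where "I \<subseteq> {..<D} - ?B" "card I = D - 1" using obtain_subset_with_card_n[of "D - 1" "{..<D} - ?B"] by blast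
  then show ?thesis by (intro exI[of _ I]) auto
qed

abbreviation children_ev :: "nat \<Rightarrow> nat \<Rightarrow> nat \<Rightarrow> nat \<Rightarrow> nat \<Rightarrow> (nat \<times> nat) set set" where
  "children_ev D n h k v \<equiv> occ k (map (\<lambda>u. disj_occ (has_edge v u) (tree_ev D n h u)) [0..<n])"

text \<open>Here g is h - 2. The union reflects where the further subtree is found: at
  \<open>hd xs\<close> if the second vertex of the path is not a child of this root in its copy, and
  otherwise at that child.\<close>

definition overlap_ev :: "nat \<Rightarrow> nat \<Rightarrow> nat \<Rightarrow> nat list \<Rightarrow> (nat \<times> nat) set set" where
  "overlap_ev D n g xs = disj_occ (path_ev xs)
     (disj_occ (children_ev D n (Suc g) (D - 1) (hd xs))
       (disj_occ (children_ev D n (Suc g) (D - 1) (last xs))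
         (children_ev D n g 1 (hd xs) \<union> children_ev D n g 1 (xs ! 1))))"

text \<open>Only one child of \<open>v\<close> and one child of \<open>z\<close> can lie on the path between them, which leaves
  \<open>2 (D - 1)\<close> disjoint subtrees of depth \<open>h - 1\<close>. For \<open>D = 2\<close> this alone would be as likely as a single
  tree, so one further disjoint subtree, of depth \<open>h - 2\<close>, is extracted next to \<open>v\<close>.\<close>
theorem overlapping_embs:
  assumes D: "2 \<le> D" and u: "uniq w (3 * Suc (Suc g)) v" and wE: "w \<subseteq> all_edges n"
    and e: "emb D (Suc (Suc g)) n w \<phi>" "\<phi> [] = v" and e': "emb D (Suc (Suc g)) n w \<phi>'" "\<phi>' [] = z"
    and vz: "v \<noteq> z" and int: "\<phi> ` tree_verts D (Suc (Suc g)) \<inter> \<phi>' ` tree_verts D (Suc (Suc g)) \<noteq> {}"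
  shows "\<exists>xs. hd xs = v \<and> last xs = z \<and> 2 \<le> length xs \<and> length xs \<le> Suc (2 * Suc (Suc g)) \<and>
     set xs \<subseteq> {..<n} \<and> w \<in> overlap_ev D n g xs"
proof -
  let ?h = "Suc (Suc g)"
  let ?L = "3 * ?h"
  have inj: "inj_on \<phi> (tree_verts D ?h)" and inj': "inj_on \<phi>' (tree_verts D ?h)" using e e' by (auto simp: emb_def)
  have vn: "v < n" using emb_less[OF e(1), of "[]"] e(2) by simp
  obtain t t' where t: "t \<in> tree_verts D ?h" "t' \<in> tree_verts D ?h" "\<phi> t = \<phi>' t'" using int by blast
  \<comment> \<open>Down the copy of \<open>v\<close> to a common vertex and up the other copy to
    \<open>z\<close>, at most 2h steps.\<close>
  have "conn w (length t' + length t) (\<phi> []) (\<phi>' [])"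
    by (rule conn_emb_up[OF e(1) t(1)]) (use conn_emb_down[OF e'(1) t(2)] t(3) in simp)
  then obtain xs where xs: "nbwalk w xs" "hd xs = v" "last xs = z" "length xs \<le> Suc (length t' + length t)"
    using e e' by (auto simp: conn_def)
  have tl: "length t \<le> ?h" "length t' \<le> ?h" using t by (auto simp: tree_verts_def)
  have len: "length xs \<le> Suc (2 * ?h)" using xs(4) tl by simp
  have lenL: "length xs \<le> Suc ?L" using len by simp
  obtain x1 rest where xr: "xs = v # x1 # rest" using xs vz by (cases xs; cases "tl xs") auto
  have xsn: "set xs \<subseteq> {..<n}" using nbwalk_less[OF wE xs(1)] xs(2) vn by simp
  obtain I where I: "I \<subseteq> {..<D}" "card I = D - 1" "\<And>i. i \<in> I \<Longrightarrow> \<phi> [i] \<noteq> x1"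
    using children_avoiding[OF inj, of x1] by auto
  obtain J where J: "J \<subseteq> {..<D}" "card J = D - 1" "\<And>i. i \<in> J \<Longrightarrow> \<phi>' [i] \<noteq> last (butlast xs)"
    using children_avoiding[OF inj', of "last (butlast xs)"] by auto
  have finI: "finite I" "finite J" using finite_subset[OF I(1)] finite_subset[OF J(1)] by auto
  define W1 where "W1 = set (wedges xs)"
  define W2 where "W2 = (\<Union>i\<in>I. branch D (Suc g) \<phi> i)"
  define W3 where "W3 = (\<Union>i\<in>J. branch D (Suc g) \<phi>' i)"
  \<comment> \<open>\<open>R1\<close>, \<open>R2\<close> and \<open>R3\<close> attach to each edge
    of a witness a walk from \<open>v\<close> ending with it: a prefix of \<open>xs\<close>, a walk
    starting into a child in \<open>I\<close>, or a continuation of \<open>xs\<close> into a child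
    in \<open>J\<close>. It then suffices that these families share no walk.\<close>
  have R1: "\<exists>k. 2 \<le> k \<and> k \<le> length xs \<and> end_edge w v ?L b (take k xs)" if "b \<in> W1" for b
  proof -
    obtain i where "i < length (wedges xs)" "b = wedges xs ! i" using \<open>b \<in> W1\<close> by (auto simp: W1_def in_set_conv_nth)
    then show ?thesis using end_edge_wedges[OF xs(1,2) lenL, of i]
      by (intro exI[of _ "Suc (Suc i)"]) (auto simp: length_wedges)
  qed
  have R2: "\<exists>i zs. i \<in> I \<and> end_edge w v ?L b ([v, \<phi> [i]] @ zs)" if "b \<in> W2" for b
  proof -
    obtain i where i: "i \<in> I" "b \<in> branch D (Suc g) \<phi> i" using \<open>b \<in> W2\<close> by (auto simp: W2_def)
    then have "\<exists>zs. end_edge w v ?L b ([] @ [\<phi> [], \<phi> [i]] @ zs)"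
      using I e by (intro end_edge_branch[OF e(1)]) auto
    then show ?thesis using i e by auto
  qed
  have xsl: "xs = butlast xs @ [z]" using xs xr append_butlast_last_id[of xs] by simp
  have R3: "\<exists>i zs. i \<in> J \<and> end_edge w v ?L b (xs @ [\<phi>' [i]] @ zs)" if "b \<in> W3" for b
  proof -
    obtain i where i: "i \<in> J" "b \<in> branch D (Suc g) \<phi>' i" using \<open>b \<in> W3\<close> by (auto simp: W3_def)
    have "\<exists>zs. end_edge w v ?L b (butlast xs @ [\<phi>' [], \<phi>' [i]] @ zs)"
    proof (rule end_edge_branch[OF e'(1)])
      show "nbwalk w (butlast xs @ [\<phi>' []])" "hd (butlast xs @ [\<phi>' []]) = v" using xs xsl e' by auto
      show "length (butlast xs) + Suc (Suc (Suc g)) \<le> Suc ?L" using len by simp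
    qed (use i J in \<open>auto dest: sym\<close>)
    moreover have "butlast xs @ [\<phi>' [], \<phi>' [i]] @ zs = xs @ [\<phi>' [i]] @ zs" for zs
      by (subst (2) xsl) (simp add: e')
    ultimately show ?thesis using i by metis
  qed
  have "\<exists>W4 x. x \<in> {hd xs, xs ! 1} \<and> W4 \<in> children_ev D n g 1 x \<and> W4 \<subseteq> w \<and>
     (\<forall>b\<in>W4. \<exists>ys. end_edge w v ?L b ys \<and> (\<forall>k. 2 \<le> k \<and> k \<le> length xs \<longrightarrow> ys \<noteq> take k xs) \<and>
       (\<forall>i zs. i \<in> I \<longrightarrow> ys \<noteq> [v, \<phi> [i]] @ zs) \<and> (\<forall>i zs. i \<in> J \<longrightarrow> ys \<noteq> xs @ [\<phi>' [i]] @ zs))"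
  proof (cases "\<exists>i<D. \<phi> [i] = x1")
    case False
    \<comment> \<open>All D children of \<open>v\<close> are off the path, and \<open>I\<close> uses
      D - 1 of them. The copy is truncated by one level so that the spare branch has the same depth
      g as in the other case.\<close>
    have eS: "emb D (Suc g) n w \<phi>" using emb_mono[OF e(1)] by simp
    have "card I < card {..<D}" using I D by simp
    then have "\<not> {..<D} \<subseteq> I" using card_mono[OF finI(1), of "{..<D}"] by auto
    then obtain i0 where i0: "i0 < D" "i0 \<notin> I" by blast
    have ch: "branch D g \<phi> i0 \<in> children_ev D n g 1 v"
      using branches_in_occ[OF eS, of "{i0}"] i0 e(2) by simp
    have reps: "\<exists>ys. end_edge w v ?L b ys \<and> (\<forall>k. 2 \<le> k \<and> k \<le> length xs \<longrightarrow> ys \<noteq> take k xs) \<and>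
       (\<forall>i zs. i \<in> I \<longrightarrow> ys \<noteq> [v, \<phi> [i]] @ zs) \<and> (\<forall>i zs. i \<in> J \<longrightarrow> ys \<noteq> xs @ [\<phi>' [i]] @ zs)" if b: "b \<in> branch D g \<phi> i0" for b
    proof -
      have "\<exists>zs. end_edge w v ?L b ([] @ [\<phi> [], \<phi> [i0]] @ zs)"
        using i0 e b by (intro end_edge_branch[OF eS]) auto
      then obtain zs where zs: "end_edge w v ?L b ([v, \<phi> [i0]] @ zs)" using e(2) by auto
      have n1: "\<phi> [i0] \<noteq> x1" using False i0 by blast
      have n2: "\<phi> [i0] \<noteq> \<phi> [i]" if "i \<in> I" for i
      proof
        assume "\<phi> [i0] = \<phi> [i]"
        moreover have "[i0] \<in> tree_verts D ?h" "[i] \<in> tree_verts D ?h" using i0 that I by auto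
        ultimately have "[i0] = [i]" using inj_onD[OF inj, of "[i0]" "[i]"] by simp
        then show False using that i0 by simp
      qed
      have n3: "[v, \<phi> [i0]] @ zs \<noteq> take k xs" if "2 \<le> k" for k
        using that n1 by (cases k; cases "k - 1") (auto simp: xr)
      show ?thesis using zs n1 n2 n3 by (intro exI[of _ "[v, \<phi> [i0]] @ zs"]) (auto simp: xr)
    qed
    show ?thesis
      using ch reps branch_subset[OF eS i0(1)] xs(2) by (intro exI[of _ "branch D g \<phi> i0"] exI[of _ v]) blast
  next
    case True
    then obtain i0 where i0: "i0 < D" "\<phi> [i0] = x1" by blast
    define \<phi>1 where "\<phi>1 = (\<lambda>u. \<phi> (i0 # u))"
    have e1: "emb D (Suc g) n w \<phi>1" "\<phi>1 [] = x1" using emb_sub[OF e(1) i0(1)] i0(2) by (auto simp: \<phi>1_def)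
    have inj1: "inj_on (\<lambda>j. \<phi>1 [j]) {..<D}"
    proof (rule inj_onI)
      fix a b assume "a \<in> {..<D}" "b \<in> {..<D}" "\<phi>1 [a] = \<phi>1 [b]"
      moreover from this have "[i0, a] \<in> tree_verts D ?h" "[i0, b] \<in> tree_verts D ?h" using i0 by auto
      ultimately have "[i0, a] = [i0, b]" using inj_onD[OF inj, of "[i0, a]" "[i0, b]"] unfolding \<phi>1_def by simp
      then show "a = b" by simp
    qed
    \<comment> \<open>The children of \<open>x1\<close> to avoid: the next vertex of the path or, if
      the path ends at \<open>x1 = z\<close>, the children in \<open>J\<close> taken by the other
      copy. These are at most D - 1 vertices, so one of the D children of \<open>x1\<close>
      remains.\<close>
    define Ex where "Ex = (if rest = [] then (\<lambda>i. \<phi>' [i]) ` J else {hd rest})"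
    have "card Ex \<le> D - 1" using card_image_le[OF finI(2), of "\<lambda>i. \<phi>' [i]"] J D by (auto simp: Ex_def)
    moreover have "card ((\<lambda>j. \<phi>1 [j]) ` {..<D}) = D" using card_image[OF inj1] by simp
    moreover have "finite Ex" using finI by (auto simp: Ex_def)
    ultimately have "\<not> (\<lambda>j. \<phi>1 [j]) ` {..<D} \<subseteq> Ex" using card_mono[of Ex "(\<lambda>j. \<phi>1 [j]) ` {..<D}"] D by auto
    then obtain j where j: "j < D" "\<phi>1 [j] \<notin> Ex" by blast
    have ch: "branch D g \<phi>1 j \<in> children_ev D n g 1 x1"
      using branches_in_occ[OF e1(1), of "{j}"] j e1(2) by simp
    have ne: "\<phi>1 [j] \<noteq> v"
    proof
      assume "\<phi>1 [j] = v"
      then have "\<phi> [i0, j] = \<phi> []" using e by (simp add: \<phi>1_def)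
      moreover have "[i0, j] \<in> tree_verts D ?h" using i0 j by simp
      ultimately have "[i0, j] = []" using inj_onD[OF inj, of "[i0, j]" "[]"] by simp
      then show False by simp
    qed
    have reps: "\<exists>ys. end_edge w v ?L b ys \<and> (\<forall>k. 2 \<le> k \<and> k \<le> length xs \<longrightarrow> ys \<noteq> take k xs) \<and>
       (\<forall>i zs. i \<in> I \<longrightarrow> ys \<noteq> [v, \<phi> [i]] @ zs) \<and> (\<forall>i zs. i \<in> J \<longrightarrow> ys \<noteq> xs @ [\<phi>' [i]] @ zs)" if b: "b \<in> branch D g \<phi>1 j" for b
    proof -
      have "\<exists>zs. end_edge w v ?L b ([v] @ [\<phi>1 [], \<phi>1 [j]] @ zs)"
      proof (rule end_edge_branch[OF e1(1) j(1) _ _ _ _ b])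
        show "nbwalk w ([v] @ [\<phi>1 []])" using xs(1) e1(2) unfolding xr by simp
      qed (use ne in auto)
      then obtain zs where zs: "end_edge w v ?L b ([v, x1, \<phi>1 [j]] @ zs)" using e1(2) by auto
      have m1: "[v, x1, \<phi>1 [j]] @ zs \<noteq> take k xs" if "2 \<le> k" "k \<le> length xs" for k
      proof
        assume eq: "[v, x1, \<phi>1 [j]] @ zs = take k xs"
        obtain k' where k: "k = Suc (Suc k')" using le_Suc_ex[OF \<open>2 \<le> k\<close>] by auto
        have "\<phi>1 [j] # zs = take k' rest" using eq by (simp add: k xr)
        then have "rest \<noteq> []" "hd rest = \<phi>1 [j]" by (cases rest; cases k'; simp)+
        then show False using j by (simp add: Ex_def)
      qed
      have m3: "[v, x1, \<phi>1 [j]] @ zs \<noteq> xs @ [\<phi>' [i]] @ zs'" if "i \<in> J" for i zs'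
      proof
        assume eq: "[v, x1, \<phi>1 [j]] @ zs = xs @ [\<phi>' [i]] @ zs'"
        then have "\<phi>1 [j] # zs = rest @ [\<phi>' [i]] @ zs'" by (simp add: xr)
        then show False using j that by (cases rest) (auto simp: Ex_def)
      qed
      show ?thesis using zs m1 m3 I(3) by (intro exI[of _ "[v, x1, \<phi>1 [j]] @ zs"]) auto
    qed
    have "x1 \<in> {hd xs, xs ! 1}" by (simp add: xr)
    then show ?thesis
      using ch reps branch_subset[OF e1(1) j(1)] by (intro exI[of _ "branch D g \<phi>1 j"] exI[of _ x1]) blast
  qed
  then obtain W4 x where W4: "x \<in> {hd xs, xs ! 1}" "W4 \<in> children_ev D n g 1 x" "W4 \<subseteq> w"
    and R4: "\<And>b. b \<in> W4 \<Longrightarrow> \<exists>ys. end_edge w v ?L b ys \<and> (\<forall>k. 2 \<le> k \<and> k \<le> length xs \<longrightarrow> ys \<noteq> take k xs) \<and>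
       (\<forall>i zs. i \<in> I \<longrightarrow> ys \<noteq> [v, \<phi> [i]] @ zs) \<and> (\<forall>i zs. i \<in> J \<longrightarrow> ys \<noteq> xs @ [\<phi>' [i]] @ zs)"
    by blast
  note un = end_edge_unique[OF u]
  have d12: "W1 \<inter> W2 = {}"
  proof (rule ccontr)
    assume "\<not> ?thesis"
    then obtain b where b: "b \<in> W1" "b \<in> W2" by blast
    from R1[OF b(1)] obtain k where k: "2 \<le> k" "end_edge w v ?L b (take k xs)" by blast
    from R2[OF b(2)] obtain i zs where i: "i \<in> I" "end_edge w v ?L b ([v, \<phi> [i]] @ zs)" by blast
    have "take k xs = [v, \<phi> [i]] @ zs" by (rule un[OF k(2) i(2)])
    then show False using k(1) I(3)[OF i(1)] by (cases k; cases "k - 1") (auto simp: xr)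
  qed
  have d13: "W1 \<inter> W3 = {}"
  proof (rule ccontr)
    assume "\<not> ?thesis"
    then obtain b where b: "b \<in> W1" "b \<in> W3" by blast
    from R1[OF b(1)] obtain k where k: "2 \<le> k" "end_edge w v ?L b (take k xs)" by blast
    from R3[OF b(2)] obtain i zs where i: "i \<in> J" "end_edge w v ?L b (xs @ [\<phi>' [i]] @ zs)" by blast
    have "take k xs = xs @ [\<phi>' [i]] @ zs" by (rule un[OF k(2) i(2)])
    then have "length (take k xs) = length (xs @ [\<phi>' [i]] @ zs)" by (rule arg_cong)
    then show False by simp
  qed
  have d23: "W2 \<inter> W3 = {}"
  proof (rule ccontr)
    assume "\<not> ?thesis"
    then obtain b where b: "b \<in> W2" "b \<in> W3" by blast
    from R2[OF b(1)] obtain i zs where i: "i \<in> I" "end_edge w v ?L b ([v, \<phi> [i]] @ zs)" by blast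
    from R3[OF b(2)] obtain j zs' where j: "j \<in> J" "end_edge w v ?L b (xs @ [\<phi>' [j]] @ zs')" by blast
    have "[v, \<phi> [i]] @ zs = xs @ [\<phi>' [j]] @ zs'" by (rule un[OF i(2) j(2)])
    then show False using I(3)[OF i(1)] by (auto simp: xr)
  qed
  have d14: "W1 \<inter> W4 = {}" and d24: "W2 \<inter> W4 = {}" and d34: "W3 \<inter> W4 = {}"
  proof -
    show "W1 \<inter> W4 = {}"
    proof (rule ccontr)
      assume "\<not> ?thesis"
      then obtain b where b: "b \<in> W1" "b \<in> W4" by blast
      from R1[OF b(1)] R4[OF b(2)] un show False by metis
    qed
    show "W2 \<inter> W4 = {}"
    proof (rule ccontr)
      assume "\<not> ?thesis"
      then obtain b where b: "b \<in> W2" "b \<in> W4" by blast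
      from R2[OF b(1)] R4[OF b(2)] un show False by metis
    qed
    show "W3 \<inter> W4 = {}"
    proof (rule ccontr)
      assume "\<not> ?thesis"
      then obtain b where b: "b \<in> W3" "b \<in> W4" by blast
      from R3[OF b(1)] R4[OF b(2)] un show False by metis
    qed
  qed
  have sub: "W1 \<subseteq> w" "W2 \<subseteq> w" "W3 \<subseteq> w"
  proof -
    show "W1 \<subseteq> w" unfolding W1_def by (rule wedges_subset[OF xs(1)])
    show "W2 \<subseteq> w" unfolding W2_def using branch_subset[OF e(1)] I(1) by blast
    show "W3 \<subseteq> w" unfolding W3_def using branch_subset[OF e'(1)] J(1) by blast
  qed
  have m1: "W1 \<in> path_ev xs" unfolding W1_def by (rule wedges_in_path_ev, rule distinct_wedges[OF u xs(1,2) lenL])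
  have m2: "W2 \<in> children_ev D n (Suc g) (D - 1) (hd xs)"
    using branches_in_occ[OF e(1) I(1)] I(2) e(2) xs(2) by (simp add: W2_def)
  have m3: "W3 \<in> children_ev D n (Suc g) (D - 1) (last xs)"
    using branches_in_occ[OF e'(1) J(1)] J(2) e'(2) xs(3) by (simp add: W3_def)
  have m4: "W4 \<in> children_ev D n g 1 (hd xs) \<union> children_ev D n g 1 (xs ! 1)" using W4 by blast
  have "W3 \<union> W4 \<in> disj_occ (children_ev D n (Suc g) (D - 1) (last xs)) (children_ev D n g 1 (hd xs) \<union> children_ev D n g 1 (xs ! 1))"
    by (rule disj_occI[OF m3 m4 d34]) auto
  then have "W2 \<union> (W3 \<union> W4) \<in> disj_occ (children_ev D n (Suc g) (D - 1) (hd xs))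
      (disj_occ (children_ev D n (Suc g) (D - 1) (last xs)) (children_ev D n g 1 (hd xs) \<union> children_ev D n g 1 (xs ! 1)))"
    by (rule disj_occI[OF m2]) (use d23 d24 in auto)
  then have "w \<in> overlap_ev D n g xs" unfolding overlap_ev_def
    by (rule disj_occI[OF m1]) (use d12 d13 d14 sub W4(3) in auto)
  then show ?thesis using xs len xsn xr by (intro exI[of _ xs]) auto
qed

section \<open>Second moment of the number of roots\<close>

lemma tree_copy_edges_at:
  assumes inj: "inj_on \<phi> (tree_verts D h)" and t: "t \<in> tree_verts D h"
  shows "{e \<in> tree_copy_edges D h \<phi>. \<phi> t \<in> e} =
     (if length t < h then (\<lambda>i. {\<phi> t, \<phi> (t @ [i])}) ` {..<D} else {}) \<union>
     (if t = [] then {} else {{\<phi> (butlast t), \<phi> t}})" (is "?L = ?R")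
proof (intro equalityI subsetI)
  fix e assume "e \<in> ?L"
  then obtain u i where u: "e = {\<phi> u, \<phi> (u @ [i])}" "length u < h" "set u \<subseteq> {..<D}" "i < D" "\<phi> t = \<phi> u \<or> \<phi> t = \<phi> (u @ [i])"
    by (auto simp: tree_copy_edges_def)
  then have "u \<in> tree_verts D h" "u @ [i] \<in> tree_verts D h" by (auto simp: tree_verts_def)
  then have "t = u \<or> t = u @ [i]" using u(5) inj_onD[OF inj _ t, of u] inj_onD[OF inj _ t, of "u @ [i]"] by auto
  then show "e \<in> ?R" using u by auto
next
  fix e assume e: "e \<in> ?R"
  have tD: "length t \<le> h" "set t \<subseteq> {..<D}" using t by (auto simp: tree_verts_def)
  from e consider i where "length t < h" "i < D" "e = {\<phi> t, \<phi> (t @ [i])}" | "t \<noteq> []" "e = {\<phi> (butlast t), \<phi> t}"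
    by (auto split: if_splits)
  then show "e \<in> ?L"
  proof cases
    case 1
    then show ?thesis using tD unfolding tree_copy_edges_def by blast
  next
    case 2
    have "last t < D" using tD(2) last_in_set[OF 2(1)] by blast
    moreover have "t = butlast t @ [last t]" "length (butlast t) < h" "set (butlast t) \<subseteq> {..<D}"
      using tD 2 by (auto dest: in_set_butlastD simp: less_le_trans[OF _ tD(1)])
    ultimately have "e \<in> tree_copy_edges D h \<phi>" using 2 unfolding tree_copy_edges_def
      by (intro CollectI exI[of _ "butlast t"] exI[of _ "last t"]) auto
    then show ?thesis using 2 by auto
  qed
qed

text \<open>Serves to recognise the root: for h > 0 and D >= 2 it is the only vertex of degree D in
  the copy, since inner vertices have degree D + 1 and leaves degree 1.\<close>

lemma card_tree_copy_edges_at: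
  assumes inj: "inj_on \<phi> (tree_verts D h)" and t: "t \<in> tree_verts D h"
  shows "card {e \<in> tree_copy_edges D h \<phi>. \<phi> t \<in> e} = (if length t < h then D else 0) + (if t = [] then 0 else 1)"
proof -
  have tD: "length t \<le> h" "set t \<subseteq> {..<D}" using t by (auto simp: tree_verts_def)
  have ch: "t @ [i] \<in> tree_verts D h" if "length t < h" "i < D" for i using that tD by (auto simp: tree_verts_def)
  have ne: "\<phi> (t @ [i]) \<noteq> \<phi> t" if "length t < h" "i < D" for i
    using inj_onD[OF inj _ ch[OF that] t] by auto
  have inj2: "inj_on (\<lambda>i. {\<phi> t, \<phi> (t @ [i])}) {..<D}" if l: "length t < h"
  proof (rule inj_onI)
    fix i j assume ij: "i \<in> {..<D}" "j \<in> {..<D}" "{\<phi> t, \<phi> (t @ [i])} = {\<phi> t, \<phi> (t @ [j])}"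
    then have "\<phi> (t @ [i]) = \<phi> (t @ [j])" using ne[OF l, of i] ne[OF l, of j] by (auto simp: doubleton_eq_iff)
    then have "t @ [i] = t @ [j]" using inj_onD[OF inj _ ch[OF l, of i] ch[OF l, of j]] ij by auto
    then show "i = j" by simp
  qed
  have dis: "{\<phi> (butlast t), \<phi> t} \<notin> (\<lambda>i. {\<phi> t, \<phi> (t @ [i])}) ` {..<D}" if l: "length t < h" "t \<noteq> []"
  proof
    assume "{\<phi> (butlast t), \<phi> t} \<in> (\<lambda>i. {\<phi> t, \<phi> (t @ [i])}) ` {..<D}"
    then obtain i where i: "i < D" "{\<phi> (butlast t), \<phi> t} = {\<phi> t, \<phi> (t @ [i])}" by auto
    then have "\<phi> (butlast t) = \<phi> (t @ [i])" using ne[OF l(1) i(1)] by (auto simp: doubleton_eq_iff)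
    moreover have "butlast t \<in> tree_verts D h" using tD by (auto simp: tree_verts_def dest: in_set_butlastD)
    ultimately have "butlast t = t @ [i]" by (rule inj_onD[OF inj _ _ ch[OF l(1) i(1)]])
    then have "length (butlast t) = length (t @ [i])" by (rule arg_cong)
    then show False by simp
  qed
  show ?thesis unfolding tree_copy_edges_at[OF assms]
    using inj2 dis by (auto simp: card_image)
qed

lemma tree_copy_edges_root:
  assumes "2 \<le> D" "0 < h" and inj: "inj_on \<phi> (tree_verts D h)" "inj_on \<phi>' (tree_verts D h)"
    and eq: "tree_copy_edges D h \<phi> = tree_copy_edges D h \<phi>'"
  shows "\<phi> [] = \<phi>' []"
proof -
  have c: "card {e \<in> tree_copy_edges D h \<phi>. \<phi> [] \<in> e} = D"
    using card_tree_copy_edges_at[OF inj(1), of "[]"] assms by simp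
  then have "{e \<in> tree_copy_edges D h \<phi>. \<phi> [] \<in> e} \<noteq> {}" using assms(1) by (auto simp del: Collect_empty_eq)
  then obtain e where "e \<in> tree_copy_edges D h \<phi>'" "\<phi> [] \<in> e" using eq by auto
  then obtain t where t: "t \<in> tree_verts D h" "\<phi> [] = \<phi>' t"
  proof -
    obtain u i where "e = {\<phi>' u, \<phi>' (u @ [i])}" "length u < h" "set u \<subseteq> {..<D}" "i < D"
      using \<open>e \<in> tree_copy_edges D h \<phi>'\<close> by (auto simp: tree_copy_edges_def)
    moreover from this have "u \<in> tree_verts D h" "u @ [i] \<in> tree_verts D h" by (auto simp: tree_verts_def)
    ultimately show ?thesis using \<open>\<phi> [] \<in> e\<close> that by auto
  qed
  have "D = (if length t < h then D else 0) + (if t = [] then 0 else 1)"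
    using card_tree_copy_edges_at[OF inj(2) t(1)] c eq t(2) by simp
  then have "t = []" using assms(1) by (auto split: if_splits)
  then show ?thesis using t by simp
qed

lemma roots_le_num_tree_copies:
  assumes "2 \<le> D" "0 < h"
  shows "card {v. \<exists>\<phi>. emb D h n (Collect G) \<phi> \<and> \<phi> [] = v} \<le> num_tree_copies D h n G"
proof -
  let ?R = "{v. \<exists>\<phi>. emb D h n (Collect G) \<phi> \<and> \<phi> [] = v}"
  let ?F = "{F. \<exists>phi. tree_embedding D h n G phi \<and> F = tree_copy_edges D h phi}"
  define f where "f v = (SOME \<phi>. emb D h n (Collect G) \<phi> \<and> \<phi> [] = v)" for v
  have f: "emb D h n (Collect G) (f v)" "f v [] = v" if "v \<in> ?R" for v
    using someI_ex[of "\<lambda>\<phi>. emb D h n (Collect G) \<phi> \<and> \<phi> [] = v"] that by (auto simp: f_def)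
  have "inj_on (\<lambda>v. tree_copy_edges D h (f v)) ?R"
  proof (rule inj_onI)
    fix v v' assume v: "v \<in> ?R" "v' \<in> ?R" "tree_copy_edges D h (f v) = tree_copy_edges D h (f v')"
    have "f v [] = f v' []"
      by (rule tree_copy_edges_root[OF assms _ _ v(3)]) (use f(1)[OF v(1)] f(1)[OF v(2)] in \<open>auto simp: emb_def\<close>)
    then show "v = v'" using f(2)[OF v(1)] f(2)[OF v(2)] by simp
  qed
  moreover have "(\<lambda>v. tree_copy_edges D h (f v)) ` ?R \<subseteq> ?F"
    using f(1) by (auto simp: tree_embedding_iff_emb)
  moreover have "finite ?F"
  proof (rule finite_subset)
    show "?F \<subseteq> Pow (Pow {..<n})"
    proof
      fix F assume "F \<in> ?F"
      then obtain \<phi> where \<phi>: "tree_embedding D h n G \<phi>" "F = tree_copy_edges D h \<phi>" by blast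
      have "\<phi> u < n" if "u \<in> tree_verts D h" for u using \<phi>(1) that by (auto simp: tree_embedding_def image_subset_iff)
      moreover have "u \<in> tree_verts D h" "u @ [i] \<in> tree_verts D h" if "length u < h" "set u \<subseteq> {..<D}" "i < D" for u i
        using that by (auto simp: tree_verts_def)
      ultimately show "F \<in> Pow (Pow {..<n})" unfolding \<phi>(2) tree_copy_edges_def by auto
    qed
  qed simp
  ultimately show ?thesis unfolding num_tree_copies_def by (rule card_inj_on_le)
qed

section \<open>Moment bounds in the random graph\<close>

lemma prob_gnp: "measure_pmf.prob (gnp n p) {G. P (Collect G)} = measure_pmf.prob (random_subset (all_edges n) p) {w. P w}"
  by (simp add: gnp_def random_subset_def all_edges_def vimage_def)

lemma prob_contains_tree_le:
  assumes "0 < lam" "2 * lam \<le> real n"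
  shows "measure_pmf.prob (gnp n (lam / real n)) {G. contains_tree D h n G} \<le> real n * perc D (lam_up lam n) h"
proof -
  let ?M = "random_subset (all_edges n) (lam / real n)"
  have "measure_pmf.prob (gnp n (lam / real n)) {G. contains_tree D h n G} = measure_pmf.prob ?M {w. \<exists>\<phi>. emb D h n w \<phi>}"
    using prob_gnp[of n "lam / real n" "\<lambda>w. \<exists>\<phi>. emb D h n w \<phi>"] by (simp add: contains_tree_def tree_embedding_iff_emb)
  also have "\<dots> \<le> measure_pmf.prob ?M (\<Union>v<n. tree_ev D n h v)"
  proof (rule measure_pmf.finite_measure_mono)
    show "{w. \<exists>\<phi>. emb D h n w \<phi>} \<subseteq> (\<Union>v<n. tree_ev D n h v)"
      using emb_tree_ev emb_less[where u = "[]"] by fastforce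
  qed simp
  also have "\<dots> \<le> (\<Sum>v<n. measure_pmf.prob ?M (tree_ev D n h v))"
    by (rule measure_pmf.finite_measure_subadditive_finite) auto
  also have "\<dots> \<le> (\<Sum>v<n. perc D (lam_up lam n) h)"
    by (intro sum_mono prob_tree_ev_le assms) simp
  finally show ?thesis by simp
qed

lemma prob_overlap_ev_le:
  assumes "0 < lam" "2 * lam \<le> real n"
  shows "measure_pmf.prob (random_subset (all_edges n) (lam / real n)) (overlap_ev D n g xs) \<le>
    (lam / real n) ^ (length xs - 1) * ((psi (D - 1) (lam_up lam n * perc D (lam_up lam n) (Suc g)))\<^sup>2 *
      (2 * (lam_up lam n * perc D (lam_up lam n) g)))"
proof -
  let ?p = "lam / real n"
  let ?P = "measure_pmf.prob (random_subset (all_edges n) ?p)"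
  have n: "0 < real n" using assms by linarith
  have p: "0 \<le> ?p" "?p \<le> 1" using assms n by (auto simp: divide_le_eq)
  have lu: "0 \<le> lam_up lam n" using assms by (auto simp: lam_up_def)
  note BK = van_den_Berg_Kesten[OF finite_all_edges p]
  let ?c = "psi (D - 1) (lam_up lam n * perc D (lam_up lam n) (Suc g))"
  let ?y = "lam_up lam n * perc D (lam_up lam n) g"
  have ch: "?P (children_ev D n k j v) \<le> psi j (lam_up lam n * perc D (lam_up lam n) k)" for k j v
    by (rule prob_children_le[OF assms finite_all_edges]) (use perc_bounds[OF lu] prob_tree_ev_le[OF assms finite_all_edges] in auto)
  have y0: "0 \<le> ?y" using lu perc_bounds[OF lu, of D g] by simp
  have c0: "0 \<le> ?c" using lu perc_bounds[OF lu, of D "Suc g"] by (intro psi_nonneg) simp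
  have "?P (children_ev D n g 1 (hd xs) \<union> children_ev D n g 1 (xs ! 1)) \<le> ?P (children_ev D n g 1 (hd xs)) + ?P (children_ev D n g 1 (xs ! 1))"
    by (rule measure_Un_le) auto
  also have "\<dots> \<le> ?y + ?y"
    by (intro add_mono order_trans[OF ch]) (use psi_upper[OF y0, of 1] in auto)
  finally have e: "?P (children_ev D n g 1 (hd xs) \<union> children_ev D n g 1 (xs ! 1)) \<le> 2 * ?y" by simp
  let ?X = "children_ev D n g 1 (hd xs) \<union> children_ev D n g 1 (xs ! 1)"
  have "?P (overlap_ev D n g xs) \<le> ?P (path_ev xs) * (?P (children_ev D n (Suc g) (D - 1) (hd xs)) *
      (?P (children_ev D n (Suc g) (D - 1) (last xs)) * ?P ?X))"
    unfolding overlap_ev_def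
    by (intro order_trans[OF BK] mult_left_mono upclosed_path_ev upclosed_disj_occ upclosed_occ upclosed_Un) auto
  also have "\<dots> \<le> ?p ^ (length xs - 1) * (?c * (?c * (2 * ?y)))"
    using p c0 y0 by (intro mult_mono prob_path_ev_le ch e mult_nonneg_nonneg) auto
  finally show ?thesis by (simp add: power2_eq_square mult_ac)
qed

text \<open>The radius is 3h because following the path to the root of an overlapping copy takes up
  to 2h steps, and descending in that copy up to h more.\<close>

definition good_root :: "nat \<Rightarrow> nat \<Rightarrow> nat \<Rightarrow> nat \<Rightarrow> (nat \<times> nat) set set" where
  "good_root D h n v = {w. (\<exists>\<phi>. emb D h n w \<phi> \<and> \<phi> [] = v) \<and> uniq w (3 * h) v}"

text \<open>z = v gives the first term, disjoint copies the second, overlapping copies the third.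
  Summing over z and over the paths with k edges from \<open>v\<close> to z means summing over all
  n^k continuations of \<open>v\<close>; each path costs (lam / n)^k, which leaves lam^k.\<close>

lemma second_moment_row:
  assumes lam: "0 < lam" "2 * lam \<le> real n" and D: "2 \<le> D" and v: "v < n"
  defines "Q \<equiv> perc D (lam_up lam n)"
  shows "(\<Sum>z<n. measure_pmf.prob (random_subset (all_edges n) (lam / real n))
            (good_root D (Suc (Suc g)) n v \<inter> good_root D (Suc (Suc g)) n z)) \<le>
     Q (Suc (Suc g)) + real n * (Q (Suc (Suc g)))\<^sup>2 +
     (\<Sum>k = 1..2 * Suc (Suc g). lam ^ k) * ((psi (D - 1) (lam_up lam n * Q (Suc g)))\<^sup>2 * (2 * (lam_up lam n * Q g)))"
proof -
  let ?h = "Suc (Suc g)"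
  let ?p = "lam / real n"
  let ?M = "random_subset (all_edges n) ?p"
  let ?P = "measure_pmf.prob ?M"
  let ?A = "good_root D ?h n"
  define B where "B = (psi (D - 1) (lam_up lam n * Q (Suc g)))\<^sup>2 * (2 * (lam_up lam n * Q g))"
  have n: "0 < real n" using lam by linarith
  have p: "0 \<le> ?p" "?p \<le> 1" using lam n by (auto simp: divide_le_eq)
  have "0 \<le> lam_up lam n" using lam by (auto simp: lam_up_def)
  then have Q0: "0 \<le> Q ?h" unfolding Q_def by (rule perc_nonneg)
  define Y where "Y k = {ys. set ys \<subseteq> {..<n} \<and> length ys = k}" for k
  have finY: "finite (Y k)" for k unfolding Y_def by (rule finite_lists_length_eq) simp
  have cY: "card (Y k) = n ^ k" for k unfolding Y_def using card_lists_length_eq[of "{..<n}" k] by simp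
  let ?F = "\<lambda>ys. ?P (overlap_ev D n g (v # ys))"
  have tr: "?P (tree_ev D n ?h z) \<le> Q ?h" for z unfolding Q_def by (rule prob_tree_ev_le[OF lam finite_all_edges])
  have At: "?A z \<subseteq> tree_ev D n ?h z" for z by (auto simp: good_root_def simp del: tree_ev.simps dest!: emb_tree_ev)
  have diag: "?P (?A v \<inter> ?A v) \<le> Q ?h"
    by (rule order_trans[OF measure_pmf.finite_measure_mono tr[of v]]) (use At[of v] in blast, simp)
  have off: "?P (?A v \<inter> ?A z) \<le> (Q ?h)\<^sup>2 + (\<Sum>k = 1..2 * ?h. \<Sum>ys\<in>{ys\<in>Y k. last ys = z}. ?F ys)" if z: "z \<noteq> v" for z
  proof -
    let ?O = "\<Union>k\<in>{1..2 * ?h}. \<Union>ys\<in>{ys\<in>Y k. last ys = z}. overlap_ev D n g (v # ys)"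
    let ?J = "disj_occ (tree_ev D n ?h v) (tree_ev D n ?h z)"
    have "?P (?A v \<inter> ?A z) \<le> ?P (?J \<union> ?O)"
    proof (rule measure_pmf.finite_measure_mono_AE)
      show "AE w in measure_pmf ?M. w \<in> ?A v \<inter> ?A z \<longrightarrow> w \<in> ?J \<union> ?O"
      proof (rule AE_pmfI, rule impI)
        fix w assume wM: "w \<in> set_pmf ?M" and w: "w \<in> ?A v \<inter> ?A z"
        from w obtain \<phi> \<phi>' where e: "emb D ?h n w \<phi>" "\<phi> [] = v" "emb D ?h n w \<phi>'" "\<phi>' [] = z" and u: "uniq w (3 * ?h) v"
          by (auto simp: good_root_def)
        show "w \<in> ?J \<union> ?O"
        proof (cases "\<phi> ` tree_verts D ?h \<inter> \<phi>' ` tree_verts D ?h = {}")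
          case True
          then show ?thesis using disjoint_embs[OF e(1,3) True] e by simp
        next
          case False
          from overlapping_embs[OF D u set_pmf_random_subset[OF finite_all_edges wM] e z[symmetric] False]
          obtain xs where xs: "hd xs = v" "last xs = z" "2 \<le> length xs" "length xs \<le> Suc (2 * ?h)" "set xs \<subseteq> {..<n}" "w \<in> overlap_ev D n g xs"
            by blast
          obtain ys where ys: "xs = v # ys" "ys \<noteq> []" using xs by (cases xs; cases "tl xs") auto
          have "ys \<in> {ys\<in>Y (length ys). last ys = z}" "length ys \<in> {1..2 * ?h}"
            using xs ys by (auto simp: Y_def Suc_le_eq)
          then show ?thesis using xs(6) ys(1) by blast
        qed
      qed
    qed simp
    also have "\<dots> \<le> ?P ?J + ?P ?O" by (rule measure_Un_le) auto
    also have "?P ?J \<le> ?P (tree_ev D n ?h v) * ?P (tree_ev D n ?h z)"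
      by (rule van_den_Berg_Kesten[OF finite_all_edges p]) auto
    also have "\<dots> \<le> Q ?h * Q ?h" using tr Q0 by (intro mult_mono) auto
    also have "?P ?O \<le> (\<Sum>k = 1..2 * ?h. ?P (\<Union>ys\<in>{ys\<in>Y k. last ys = z}. overlap_ev D n g (v # ys)))"
      by (rule measure_pmf.finite_measure_subadditive_finite) auto
    also have "\<dots> \<le> (\<Sum>k = 1..2 * ?h. \<Sum>ys\<in>{ys\<in>Y k. last ys = z}. ?F ys)"
      using finY by (intro sum_mono measure_pmf.finite_measure_subadditive_finite) auto
    finally show ?thesis by (simp add: power2_eq_square)
  qed
  have nn: "0 \<le> (\<Sum>k = 1..2 * ?h. \<Sum>ys\<in>{ys\<in>Y k. last ys = z}. ?F ys)" for z by (intro sum_nonneg) auto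
  have "(\<Sum>z<n. ?P (?A v \<inter> ?A z)) = ?P (?A v \<inter> ?A v) + (\<Sum>z\<in>{..<n} - {v}. ?P (?A v \<inter> ?A z))"
    using v by (subst sum.remove[of _ v]) auto
  also have "\<dots> \<le> Q ?h + (\<Sum>z\<in>{..<n} - {v}. (Q ?h)\<^sup>2 + (\<Sum>k = 1..2 * ?h. \<Sum>ys\<in>{ys\<in>Y k. last ys = z}. ?F ys))"
    using diag off by (intro add_mono sum_mono) auto
  also have "\<dots> \<le> Q ?h + (\<Sum>z<n. (Q ?h)\<^sup>2 + (\<Sum>k = 1..2 * ?h. \<Sum>ys\<in>{ys\<in>Y k. last ys = z}. ?F ys))"
    using nn by (intro add_left_mono sum_mono2) (auto intro!: add_nonneg_nonneg)
  also have "\<dots> = Q ?h + real n * (Q ?h)\<^sup>2 + (\<Sum>k = 1..2 * ?h. \<Sum>z<n. \<Sum>ys\<in>{ys\<in>Y k. last ys = z}. ?F ys)"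
    by (simp add: sum.distrib sum.swap[of _ "{..<n}"] del: sum.cl_ivl_Suc)
  finally have main: "(\<Sum>z<n. ?P (?A v \<inter> ?A z)) \<le> Q ?h + real n * (Q ?h)\<^sup>2 +
      (\<Sum>k = 1..2 * ?h. \<Sum>z<n. \<Sum>ys\<in>{ys\<in>Y k. last ys = z}. ?F ys)" .
  have "(\<Sum>k = 1..2 * ?h. \<Sum>z<n. \<Sum>ys\<in>{ys\<in>Y k. last ys = z}. ?F ys) \<le> (\<Sum>k = 1..2 * ?h. lam ^ k * B)"
  proof (rule sum_mono)
    fix k assume k: "k \<in> {1..2 * ?h}"
    have "(\<Sum>z<n. \<Sum>ys\<in>{ys\<in>Y k. last ys = z}. ?F ys) = (\<Sum>ys\<in>Y k. ?F ys)"
    proof (rule sum.group[OF finY])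
      show "last ` Y k \<subseteq> {..<n}"
      proof
        fix x assume "x \<in> last ` Y k"
        then obtain ys where ys: "ys \<in> Y k" "x = last ys" by blast
        then have "ys \<noteq> []" using k by (auto simp: Y_def)
        then have "last ys \<in> set ys" by simp
        then show "x \<in> {..<n}" using ys unfolding Y_def by blast
      qed
    qed simp
    also have "\<dots> \<le> (\<Sum>ys\<in>Y k. ?p ^ k * B)"
    proof (rule sum_mono)
      fix ys assume "ys \<in> Y k"
      then show "?F ys \<le> ?p ^ k * B"
        using prob_overlap_ev_le[OF lam, of D g "v # ys"] by (simp add: Y_def B_def Q_def)
    qed
    also have "\<dots> = (real n ^ k * ?p ^ k) * B" by (simp add: cY)
    also have "real n ^ k * ?p ^ k = lam ^ k" using n by (simp flip: power_mult_distrib)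
    finally show "(\<Sum>z<n. \<Sum>ys\<in>{ys\<in>Y k. last ys = z}. ?F ys) \<le> lam ^ k * B" .
  qed
  from order_trans[OF main add_left_mono[OF this]] show ?thesis unfolding sum_distrib_right B_def .
qed

lemma prob_half_mean:
  fixes A :: "nat \<Rightarrow> 'a set" and M :: "'a pmf" and n :: nat
  assumes fin: "finite (set_pmf M)"
  defines "mu \<equiv> (\<Sum>v<n. measure_pmf.prob M (A v))"
  assumes mu: "0 < mu"
  shows "measure_pmf.prob M {w. real (card {v. v < n \<and> w \<in> A v}) < mu / 2} \<le>
    4 * ((\<Sum>v<n. \<Sum>z<n. measure_pmf.prob M (A v \<inter> A z)) / mu\<^sup>2 - 1)"
proof -
  let ?X = "\<lambda>w. \<Sum>v<n. indicat_real (A v) w"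
  have X: "real (card {v. v < n \<and> w \<in> A v}) = ?X w" for w
  proof -
    have "?X w = real (card ({..<n} \<inter> {v. w \<in> A v}))" by (simp add: indicator_def sum.If_cases)
    also have "{..<n} \<inter> {v. w \<in> A v} = {v. v < n \<and> w \<in> A v}" by auto
    finally show ?thesis by simp
  qed
  have int: "integrable (measure_pmf M) f" for f :: "'a \<Rightarrow> real" by (rule integrable_measure_pmf_finite[OF fin])
  have EX: "measure_pmf.expectation M ?X = mu"
    unfolding mu_def by (subst Bochner_Integration.integral_sum) (auto intro: int)
  have "measure_pmf.expectation M (\<lambda>w. (?X w)\<^sup>2) = measure_pmf.expectation M (\<lambda>w. \<Sum>v<n. \<Sum>z<n. indicat_real (A v \<inter> A z) w)"
    by (simp add: power2_eq_square sum_product indicator_inter_arith)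
  also have "\<dots> = (\<Sum>v<n. \<Sum>z<n. measure_pmf.prob M (A v \<inter> A z))"
    by (subst Bochner_Integration.integral_sum, rule int, subst Bochner_Integration.integral_sum, rule int) simp
  finally have EX2: "measure_pmf.expectation M (\<lambda>w. (?X w)\<^sup>2) = (\<Sum>v<n. \<Sum>z<n. measure_pmf.prob M (A v \<inter> A z))" .
  have var: "measure_pmf.variance M ?X = (\<Sum>v<n. \<Sum>z<n. measure_pmf.prob M (A v \<inter> A z)) - mu\<^sup>2"
    by (subst measure_pmf.variance_eq) (auto intro: int simp: EX EX2)
  have dev: "mu / 2 \<le> \<bar>?X w - mu\<bar>" if "?X w < mu / 2" for w using that mu by linarith
  have "measure_pmf.prob M {w. ?X w < mu / 2} \<le> measure_pmf.prob M {w \<in> space (measure_pmf M). mu / 2 \<le> \<bar>?X w - measure_pmf.expectation M ?X\<bar>}"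
    unfolding EX
  proof (rule measure_pmf.finite_measure_mono)
    show "{w. ?X w < mu / 2} \<subseteq> {w \<in> space (measure_pmf M). mu / 2 \<le> \<bar>?X w - mu\<bar>}"
      by (rule subsetI, unfold mem_Collect_eq, rule conjI) (simp, rule dev)
  qed simp
  also have "\<dots> \<le> measure_pmf.variance M ?X / (mu / 2)\<^sup>2"
    by (rule measure_pmf.Chebyshev_inequality) (auto intro: int simp: mu)
  also have "\<dots> = 4 * ((\<Sum>v<n. \<Sum>z<n. measure_pmf.prob M (A v \<inter> A z)) / mu\<^sup>2 - 1)"
    unfolding var using mu by (simp add: field_simps)
  finally show ?thesis by (simp add: X)
qed

section \<open>Asymptotics\<close>

lemma subcritical:
  assumes "0 < lam" "lam \<le> lam'" "\<And>p. 0 < p \<Longrightarrow> p \<le> 1 \<Longrightarrow> psi D (lam' * p) < p" "0 < p" "p \<le> 1"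
  shows "psi D (lam * p) < p"
proof -
  have "psi D (lam * p) \<le> psi D (lam' * p)" using assms by (intro psi_mono mult_right_mono) auto
  also have "\<dots> < p" by (rule assms(3)[OF assms(4,5)])
  finally show ?thesis .
qed

section \<open>No copies beyond \<open>h_bar\<close>\<close>

lemma prob_contains_tree_tendsto_0:
  assumes D: "2 \<le> D" and lam: "0 < lam" "lam < lam'" and sub: "\<And>p. 0 < p \<Longrightarrow> p \<le> 1 \<Longrightarrow> psi D (lam' * p) < p"
  shows "\<exists>C::nat. \<forall>h::nat \<Rightarrow> nat. (\<forall>\<^sub>F n in sequentially. 0 < h n \<and> h n \<ge> h_bar D lam n + C) \<longrightarrow>
            (\<lambda>n. measure_pmf.prob (gnp n (lam / real n)) {G. contains_tree D (h n) n G}) \<longlonglongrightarrow> 0"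
proof -
  have lam'0: "0 < lam'" using lam by simp
  obtain h0 where h0: "\<And>k. perc D lam' (h0 + k) \<le> exp (- (real D ^ k))"
    using perc_double_exp[OF lam'0 D sub] by blast
  obtain c where c: "0 < c" "\<And>h. exp (- c * real D ^ h) \<le> perc D lam h"
    using perc_lower[OF lam(1) D] by blast
  \<comment> \<open>By D^m >= 2^m >= m >= 2 c, the \<open>m\<close> extra levels turn ln n < c D^h
    into 2 ln n <= D^(h+m). This gives a probability of at most 1/n^2, which survives the union
    bound over n roots. The \<open>h0\<close> further levels are the delay before the decay sets
    in.\<close>
  obtain m :: nat where m: "2 * c \<le> real m" using real_arch_simple by blast
  have lim: "perc D lam \<longlonglongrightarrow> 0"
    by (rule perc_tendsto_0[OF lam(1)]) (use subcritical[OF lam(1) less_imp_le[OF lam(2)] sub] in blast)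
  have lam_up_lim: "lam_up lam \<longlonglongrightarrow> lam" unfolding lam_up_def by real_asymp
  have ev: "\<forall>\<^sub>F n in sequentially. lam_up lam n < lam'" by (rule order_tendstoD(2)[OF lam_up_lim lam(2)])
  have ev2: "\<forall>\<^sub>F n in sequentially. 2 * lam \<le> real n" by real_asymp
  show ?thesis
  proof (intro exI[of _ "h0 + m"] allI impI)
    fix h :: "nat \<Rightarrow> nat" assume h: "\<forall>\<^sub>F n in sequentially. 0 < h n \<and> h n \<ge> h_bar D lam n + (h0 + m)"
    have bound: "\<forall>\<^sub>F n in sequentially. measure_pmf.prob (gnp n (lam / real n)) {G. contains_tree D (h n) n G} \<le> 1 / real n"
      using h ev ev2 eventually_gt_at_top[of 1]
    proof eventually_elim
      case (elim n)
      have n: "1 < real n" using elim by simp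
      let ?S = "{h::nat. 0 < h \<and> p_tree D lam h < 1 / real n}"
      have "\<forall>\<^sub>F h in sequentially. perc D lam h < 1 / real n" by (rule order_tendstoD(2)[OF lim]) (use n in simp)
      then obtain N where "\<And>k. k \<ge> N \<Longrightarrow> perc D lam k < 1 / real n" by (auto simp: eventually_sequentially)
      then have "Suc N \<in> ?S" by (simp add: p_tree_eq_perc lam(1) del: perc.simps)
      \<comment> \<open>The infimum is attained because the set is nonempty, p_h tending to
        0.\<close>
      then have "h_bar D lam n \<in> ?S" unfolding h_bar_def using Inf_nat_def1[of ?S] by blast
      then have "perc D lam (h_bar D lam n) < 1 / real n" by (simp add: p_tree_eq_perc lam(1))
      then have "exp (- c * real D ^ h_bar D lam n) < exp (- ln (real n))"
        using le_less_trans[OF c(2)] n by (simp add: exp_minus inverse_eq_divide)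
      then have key: "ln (real n) < c * real D ^ h_bar D lam n" by simp
      have Dm: "2 * c \<le> real D ^ m"
      proof -
        have "real m \<le> real (2 ^ m)" using less_exp[of m] by (intro of_nat_mono) simp
        also have "\<dots> \<le> real D ^ m" using D by (simp add: power_mono)
        finally show ?thesis using m by linarith
      qed
      have "2 * ln (real n) \<le> 2 * (c * real D ^ h_bar D lam n)" using key by simp
      also have "\<dots> = 2 * c * real D ^ h_bar D lam n" by simp
      also have "\<dots> \<le> real D ^ m * real D ^ h_bar D lam n" using Dm by (intro mult_right_mono) auto
      also have "\<dots> = real D ^ (h_bar D lam n + m)" by (simp add: power_add)
      finally have key2: "2 * ln (real n) \<le> real D ^ (h_bar D lam n + m)" .
      have lu0: "0 \<le> lam_up lam n" using lam n by (simp add: lam_up_def)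
      have "perc D (lam_up lam n) (h n) \<le> perc D lam' (h n)"
        using lu0 elim by (intro perc_mono_lam) auto
      also have "\<dots> \<le> perc D lam' (h0 + (h_bar D lam n + m))"
        using elim lam'0 by (intro perc_antimono) auto
      also have "\<dots> \<le> exp (- (real D ^ (h_bar D lam n + m)))" by (rule h0)
      also have "\<dots> \<le> exp (- (2 * ln (real n)))" using key2 by simp
      also have "\<dots> = 1 / (real n)\<^sup>2"
        using n by (simp add: exp_minus inverse_eq_divide exp_double)
      finally have pc: "perc D (lam_up lam n) (h n) \<le> 1 / (real n)\<^sup>2" .
      have "measure_pmf.prob (gnp n (lam / real n)) {G. contains_tree D (h n) n G} \<le> real n * perc D (lam_up lam n) (h n)"
        by (rule prob_contains_tree_le[OF lam(1)]) (use elim in simp)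
      also have "\<dots> \<le> real n * (1 / (real n)\<^sup>2)" using pc by (intro mult_left_mono) auto
      also have "\<dots> = 1 / real n" using n by (simp add: power2_eq_square)
      finally show ?case .
    qed
    show "(\<lambda>n. measure_pmf.prob (gnp n (lam / real n)) {G. contains_tree D (h n) n G}) \<longlonglongrightarrow> 0"
      by (rule tendsto_sandwich[OF _ bound tendsto_const lim_1_over_n]) (simp add: always_eventually)
  qed
qed

section \<open>Many copies up to \<open>h_low\<close>\<close>

text \<open>On natural numbers \<open>Sup\<close> is a maximum only for finite nonempty sets. The
  set is finite because p_h tends to 0, and it contains \<open>Suc K\<close> for large n because ln
  n / n falls below a fixed positive value; hence \<open>h_low\<close> also tends to
  infinity.\<close>

lemma h_low_props:
  assumes D: "2 \<le> D" and lam: "0 < lam" and lim: "perc D lam \<longlonglongrightarrow> 0"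
  shows "\<forall>\<^sub>F n in sequentially. K \<le> h_low D lam n \<and> 0 < h_low D lam n \<and> ln (real n) / real n < perc D lam (h_low D lam n)"
proof -
  have l: "(\<lambda>n::nat. ln (real n) / real n) \<longlonglongrightarrow> 0" by real_asymp
  have "\<forall>\<^sub>F n in sequentially. ln (real n) / real n < perc D lam (Suc K)"
    by (rule order_tendstoD(2)[OF l perc_pos[OF lam D]])
  then show ?thesis using eventually_gt_at_top[of 1]
  proof eventually_elim
    case (elim n)
    let ?S = "{h::nat. 0 < h \<and> p_tree D lam h > ln (real n) / real n}"
    have mem: "Suc K \<in> ?S" using elim by (simp add: p_tree_eq_perc lam del: perc.simps)
    have "0 < ln (real n) / real n" using elim by simp
    from order_tendstoD(2)[OF lim this] obtain N where N: "\<And>k. k \<ge> N \<Longrightarrow> perc D lam k < ln (real n) / real n"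
      by (auto simp: eventually_sequentially)
    have "?S \<subseteq> {..<N}"
    proof
      fix k assume "k \<in> ?S"
      then have "\<not> N \<le> k" using N[of k] by (auto simp: p_tree_eq_perc lam)
      then show "k \<in> {..<N}" by simp
    qed
    then have fin: "finite ?S" by (rule finite_subset) simp
    have eq: "h_low D lam n = Max ?S" unfolding h_low_def Sup_nat_def using mem by auto
    have "h_low D lam n \<in> ?S" unfolding eq using Max_in[OF fin] mem by blast
    moreover have "Suc K \<le> h_low D lam n" unfolding eq using Max_ge[OF fin mem] .
    ultimately show ?case by (auto simp: p_tree_eq_perc lam)
  qed
qed

text \<open>The 2 (D - 1) branches of an overlapping pair are compared with the D branches of a
  single copy: x^(2D-2) = x^(D-2) x^D, and on bounded x the power x^D is at most a constant times
  \<open>psi D x\<close>.\<close>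

lemma psi_square_le:
  assumes "2 \<le> D" "0 \<le> x" "x \<le> b"
  shows "(psi (D - 1) x)\<^sup>2 \<le> (1 + b) ^ D * fact D * exp b * psi D x"
proof -
  have b: "0 \<le> b" using assms by simp
  have "(psi (D - 1) x)\<^sup>2 \<le> (x ^ (D - 1))\<^sup>2"
    using psi_upper_power[OF assms(2)] psi_nonneg[OF assms(2)] by (intro power_mono)
  also have "\<dots> = x ^ (D - 2) * x ^ D"
  proof -
    obtain e where "D = Suc (Suc e)" using assms(1) by (metis add_2_eq_Suc le_Suc_ex)
    then show ?thesis by (simp add: power2_eq_square mult_ac)
  qed
  also have "\<dots> \<le> (1 + b) ^ D * x ^ D"
  proof (rule mult_right_mono)
    have "x ^ (D - 2) \<le> (1 + b) ^ (D - 2)" using assms by (intro power_mono) auto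
    also have "\<dots> \<le> (1 + b) ^ D" using b by (intro power_increasing) auto
    finally show "x ^ (D - 2) \<le> (1 + b) ^ D" .
  qed (use assms in simp)
  also have "x ^ D \<le> fact D * exp b * psi D x"
  proof -
    have "x ^ D / fact D * exp (- b) \<le> x ^ D / fact D * exp (- x)" using assms by (intro mult_left_mono) auto
    also have "\<dots> \<le> psi D x" by (rule psi_lower[OF assms(2)])
    finally show ?thesis by (simp add: exp_minus field_simps)
  qed
  then have "(1 + b) ^ D * x ^ D \<le> (1 + b) ^ D * (fact D * exp b * psi D x)" using b by (intro mult_left_mono) auto
  finally show ?thesis by (simp add: mult_ac)
qed

text \<open>For fixed n, \<open>b\<close> is the relative loss in the mean, \<open>a\<close> the
  relative increase of p caused by \<open>lam_up\<close>, and \<open>c\<close> the relative weight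
  of overlapping pairs. The bound tends to 1 if a and b tend to 1 and c to 0. Copies of the smaller
  depth \<open>h'\<close> arise by truncation.\<close>

lemma prob_copies_ge:
  assumes lam: "0 < lam" "2 * lam \<le> real n" and D: "2 \<le> D" and h': "0 < h'" "h' \<le> h"
    and low: "\<And>v. v < n \<Longrightarrow> b * p \<le> measure_pmf.prob (random_subset (all_edges n) (lam / real n)) (good_root D h n v)"
    and row: "\<And>v. v < n \<Longrightarrow> (\<Sum>z<n. measure_pmf.prob (random_subset (all_edges n) (lam / real n)) (good_root D h n v \<inter> good_root D h n z)) \<le>
       p * (a + real n * p * a\<^sup>2 + a * c)"
    and pos: "0 < b" "0 \<le> a" "0 \<le> c" and np: "0 < ln (real n)" "ln (real n) \<le> real n * p"
  shows "1 - 4 * ((a / ln (real n) + a\<^sup>2 + a * c / ln (real n)) / b\<^sup>2 - 1) \<le>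
     measure_pmf.prob (gnp n (lam / real n)) {G. real (num_tree_copies D h' n G) \<ge> b * ln (real n) / 2}"
proof -
  let ?M = "random_subset (all_edges n) (lam / real n)"
  let ?A = "good_root D h n"
  define mu where "mu = (\<Sum>v<n. measure_pmf.prob ?M (?A v))"
  define m where "m = real n * p"
  let ?l = "ln (real n)"
  have m: "0 < m" "?l \<le> m" using np by (auto simp: m_def)
  have n: "0 < real n" using lam by linarith
  have "b * m = (\<Sum>v<n. b * p)" by (simp add: m_def)
  also have "\<dots> \<le> mu" unfolding mu_def using low by (intro sum_mono) auto
  finally have mu: "b * m \<le> mu" .
  have mu0: "0 < mu" using mu m pos by (meson less_le_trans mult_pos_pos)
  let ?E2 = "\<Sum>v<n. \<Sum>z<n. measure_pmf.prob ?M (?A v \<inter> ?A z)"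
  have E2: "?E2 \<le> m * (a + m * a\<^sup>2 + a * c)"
  proof -
    have "?E2 \<le> (\<Sum>v<n. p * (a + real n * p * a\<^sup>2 + a * c))" using row by (intro sum_mono) auto
    also have "\<dots> = m * (a + m * a\<^sup>2 + a * c)" by (simp add: m_def)
    finally show ?thesis .
  qed
  have "?E2 / mu\<^sup>2 \<le> (m * (a + m * a\<^sup>2 + a * c)) / (b * m)\<^sup>2"
    using E2 mu m pos by (intro frac_le power_mono) auto
  also have "\<dots> = (a / m + a\<^sup>2 + a * c / m) / b\<^sup>2"
    using m pos by (simp add: field_simps power2_eq_square)
  also have "\<dots> \<le> (a / ?l + a\<^sup>2 + a * c / ?l) / b\<^sup>2"
    using m np pos by (intro divide_right_mono add_mono divide_left_mono) auto
  finally have ratio: "?E2 / mu\<^sup>2 \<le> (a / ?l + a\<^sup>2 + a * c / ?l) / b\<^sup>2" .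
  let ?N = "\<lambda>w. card {v. v < n \<and> w \<in> ?A v}"
  have "measure_pmf.prob ?M {w. real (?N w) < mu / 2} \<le> 4 * (?E2 / mu\<^sup>2 - 1)"
    unfolding mu_def by (rule prob_half_mean) (use mu0 in \<open>simp_all add: mu_def finite_set_pmf_random_subset\<close>)
  also have "\<dots> \<le> 4 * ((a / ?l + a\<^sup>2 + a * c / ?l) / b\<^sup>2 - 1)"
    by (intro mult_left_mono diff_right_mono ratio) simp
  finally have bad: "measure_pmf.prob ?M {w. real (?N w) < mu / 2} \<le> 4 * ((a / ?l + a\<^sup>2 + a * c / ?l) / b\<^sup>2 - 1)" .
  have "{w. \<not> real (?N w) < mu / 2} = UNIV - {w. real (?N w) < mu / 2}" by auto
  then have "measure_pmf.prob ?M {w. \<not> real (?N w) < mu / 2} = 1 - measure_pmf.prob ?M {w. real (?N w) < mu / 2}"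
    using measure_pmf.prob_compl[of "{w. real (?N w) < mu / 2}" ?M] by simp
  then have "1 - 4 * ((a / ?l + a\<^sup>2 + a * c / ?l) / b\<^sup>2 - 1) \<le> measure_pmf.prob ?M {w. \<not> real (?N w) < mu / 2}"
    using bad by simp
  also have "\<dots> = measure_pmf.prob (gnp n (lam / real n)) {G. \<not> real (?N (Collect G)) < mu / 2}"
    by (rule prob_gnp[symmetric])
  also have "\<dots> \<le> measure_pmf.prob (gnp n (lam / real n)) {G. real (num_tree_copies D h' n G) \<ge> b * ?l / 2}"
  proof (rule measure_pmf.finite_measure_mono)
    show "{G. \<not> real (?N (Collect G)) < mu / 2} \<subseteq> {G. real (num_tree_copies D h' n G) \<ge> b * ?l / 2}"
    proof
      fix G assume "G \<in> {G. \<not> real (?N (Collect G)) < mu / 2}"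
      then have G: "mu / 2 \<le> real (?N (Collect G))" by simp
      let ?R = "{v. \<exists>\<phi>. emb D h' n (Collect G) \<phi> \<and> \<phi> [] = v}"
      have "?R \<subseteq> {..<n}" using emb_less[where u = "[]"] by fastforce
      then have finR: "finite ?R" by (rule finite_subset) simp
      have "{v. v < n \<and> Collect G \<in> ?A v} \<subseteq> ?R"
        using emb_mono[OF _ h'(2)] by (fastforce simp: good_root_def)
      then have "?N (Collect G) \<le> card ?R" by (rule card_mono[OF finR])
      also have "\<dots> \<le> num_tree_copies D h' n G" by (rule roots_le_num_tree_copies[OF D h'(1)])
      finally have "mu / 2 \<le> real (num_tree_copies D h' n G)" using G by linarith
      moreover have "b * ?l \<le> b * m" using m pos by (intro mult_left_mono) auto
      ultimately show "G \<in> {G. real (num_tree_copies D h' n G) \<ge> b * ?l / 2}" using mu by simp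
    qed
  qed simp
  finally show ?thesis .
qed

text \<open>Bernoulli's inequality handles the labels, and ln (1 - x) >= - x - 2 x^2 the factor (1 -
  lam/n)^n exp lam. The bound is 1 - o(1) as soon as s^2 = o(n).\<close>

lemma labelling_factor_ge:
  assumes "0 < lam" "2 * lam \<le> real n" "real s ^ 2 \<le> real n" "s \<le> n"
  shows "(1 - (real s)\<^sup>2 / real n) * (1 - 2 * lam\<^sup>2 * real s / real n) \<le> ((1 - real s / real n) * (1 - lam / real n) ^ n * exp lam) ^ s"
proof -
  have n: "0 < real n" using assms by linarith
  define x where "x = lam / real n"
  have x: "0 \<le> x" "x \<le> 1 / 2" using assms n by (auto simp: x_def field_simps)
  have "1 + real s * (- (real s / real n)) \<le> (1 + - (real s / real n)) ^ s"
    by (rule Bernoulli_inequality) (use assms n in auto)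
  then have 1: "1 - (real s)\<^sup>2 / real n \<le> (1 - real s / real n) ^ s" by (simp add: power2_eq_square)
  have "- x - 2 * x\<^sup>2 \<le> ln (1 - x)" by (rule ln_one_minus_pos_lower_bound[OF x])
  then have "exp (- x - 2 * x\<^sup>2) \<le> 1 - x" using x by (subst (asm) ln_ge_iff) auto
  then have "exp (- x - 2 * x\<^sup>2) ^ n \<le> (1 - x) ^ n" by (intro power_mono) auto
  moreover have "exp (- x - 2 * x\<^sup>2) ^ n = exp (- lam - 2 * lam\<^sup>2 / real n)"
    using n by (simp add: x_def field_simps power2_eq_square flip: exp_of_nat_mult)
  ultimately have "exp (- lam - 2 * lam\<^sup>2 / real n) * exp lam \<le> (1 - x) ^ n * exp lam" by (intro mult_right_mono) auto
  then have "exp (- (2 * lam\<^sup>2 / real n)) \<le> (1 - x) ^ n * exp lam" by (simp flip: exp_add)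
  then have "exp (- (2 * lam\<^sup>2 / real n)) ^ s \<le> ((1 - x) ^ n * exp lam) ^ s" by (intro power_mono) auto
  moreover have "1 - 2 * lam\<^sup>2 * real s / real n \<le> exp (- (2 * lam\<^sup>2 / real n)) ^ s"
    using exp_ge_add_one_self[of "- (2 * lam\<^sup>2 * real s / real n)"] by (simp add: mult_ac flip: exp_of_nat_mult)
  ultimately have 2: "1 - 2 * lam\<^sup>2 * real s / real n \<le> ((1 - x) ^ n * exp lam) ^ s" by linarith
  have "(1 - (real s)\<^sup>2 / real n) * (1 - 2 * lam\<^sup>2 * real s / real n) \<le> (1 - (real s)\<^sup>2 / real n) * ((1 - x) ^ n * exp lam) ^ s"
    using 2 assms n by (intro mult_left_mono) auto
  also have "\<dots> \<le> (1 - real s / real n) ^ s * ((1 - x) ^ n * exp lam) ^ s"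
    using 1 x by (intro mult_right_mono) auto
  finally show ?thesis by (simp add: x_def mult.assoc flip: power_mult_distrib)
qed


lemma prob_many_tree_copies_tendsto_1:
  assumes D: "2 \<le> D" and lam: "0 < lam" "lam < lam'" and sub: "\<And>p. 0 < p \<Longrightarrow> p \<le> 1 \<Longrightarrow> psi D (lam' * p) < p"
    and h: "\<forall>\<^sub>F n in sequentially. 0 < h n \<and> h n \<le> h_low D lam n"
  shows "(\<lambda>n. measure_pmf.prob (gnp n (lam / real n)) {G. real (num_tree_copies D (h n) n G) \<ge> ln (real n) / 4}) \<longlonglongrightarrow> 1"
proof -
  have lam'0: "0 < lam'" using lam by simp
  obtain h0 where h0: "\<And>k. perc D lam' (h0 + k) \<le> exp (- (real D ^ k))"
    using perc_double_exp[OF lam'0 D sub] by blast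
  have lim: "perc D lam \<longlonglongrightarrow> 0"
    by (rule perc_tendsto_0[OF lam(1)]) (use subcritical[OF lam(1) less_imp_le[OF lam(2)] sub] in blast)
  \<comment> \<open>At depth \<open>h_low\<close> the probability exceeds 1/n, so the decay with
    delay \<open>h0\<close> gives D^h <= C1 ln n.\<close>
  define C1 where "C1 = real D ^ h0"
  have C1: "0 < C1" using D by (simp add: C1_def)
  define B where "B = 2 + 2 * lam"
  have B: "1 \<le> B" using lam by (simp add: B_def)
  \<comment> \<open>Yields B^(3h) <= (D^h)^q, so the scale of trees of depth 3h is a power of ln
    n.\<close>
  obtain q where q: "B ^ 3 < 2 ^ q" using real_arch_pow[of 2 "B ^ 3"] by auto
  \<comment> \<open>Bounds the power of 1 + 2 lam / n that \<open>perc_scale\<close>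
    produces.\<close>
  define a where "a n = exp (4 * lam * C1 * ln (real n) / real n)" for n :: nat
  \<comment> \<open>The tail bound for trees with more than s vertices, s being the integer part of
    n^(1/3), relative to p > 1/n; hence the factor n.\<close>
  define eps where "eps n = 2 * real n * exp (- ((real n powr (1/3) - 1) / (B * (C1 * ln (real n)) ^ q)))" for n :: nat
  \<comment> \<open>\<open>b1\<close> and \<open>b2\<close> bound the two factors in
    \<open>labelling_factor_ge\<close>. The exponent 1/3 is below the 1/2 allowed there, and n^(1/3)
    still beats every power of ln n in \<open>eps\<close>.\<close>
  define b1 where "b1 n = 1 - real n powr (-1/3)" for n :: nat
  define b2 where "b2 n = 1 - 2 * lam\<^sup>2 * real n powr (-2/3)" for n :: nat
  define b where "b n = b1 n * b2 n * (1 - eps n)" for n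
  define M where "M = max 2 lam"
  have M: "1 < M" "lam \<le> M" by (auto simp: M_def)
  \<comment> \<open>The constant of \<open>psi_square_le\<close> for arguments up to 2 lam.\<close>
  define C0 where "C0 = (1 + 2 * lam) ^ D * fact D * exp (2 * lam)"
  have C0: "0 \<le> C0" using lam by (simp add: C0_def)
  \<comment> \<open>Number and weight of the connecting paths, of length up to 2H with H = j + h0 +
    2, against the bound for the further subtree of depth H - 2. Replacing \<open>lam\<close> by
    \<open>M\<close> makes the powers increase even if lam < 1.\<close>
  define F where "F j = real (2 * (j + (h0 + 2))) * M ^ (2 * (j + (h0 + 2))) * exp (- (2 ^ j))" for j :: nat
  define c where "c n = C0 * (4 * lam) * F (h_low D lam n - (h0 + 2))" for n
  have a_lim: "a \<longlonglongrightarrow> 1" unfolding a_def by real_asymp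
  have eps_lim: "eps \<longlonglongrightarrow> 0" unfolding eps_def using B C1 by real_asymp
  have b1_lim: "b1 \<longlonglongrightarrow> 1" unfolding b1_def by real_asymp
  have b2_lim: "b2 \<longlonglongrightarrow> 1" unfolding b2_def by real_asymp
  have "b \<longlonglongrightarrow> 1 * 1 * (1 - 0)" unfolding b_def by (intro tendsto_intros b1_lim b2_lim eps_lim)
  then have b_lim: "b \<longlonglongrightarrow> 1" by simp
  have F_lim: "F \<longlonglongrightarrow> 0" unfolding F_def using M(1) by real_asymp
  have "filterlim (\<lambda>n. h_low D lam n - (h0 + 2)) at_top sequentially"
    unfolding filterlim_at_top
  proof
    fix K
    show "\<forall>\<^sub>F n in sequentially. K \<le> h_low D lam n - (h0 + 2)"
      using h_low_props[OF D lam(1) lim, of "K + (h0 + 2)"] by eventually_elim auto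
  qed
  then have "(\<lambda>n. F (h_low D lam n - (h0 + 2))) \<longlonglongrightarrow> 0" by (rule filterlim_compose[OF F_lim])
  then have "c \<longlonglongrightarrow> C0 * (4 * lam) * 0" unfolding c_def by (intro tendsto_intros)
  then have c_lim: "c \<longlonglongrightarrow> 0" by simp
  have ln_lim: "(\<lambda>n::nat. 1 / ln (real n)) \<longlonglongrightarrow> 0" by real_asymp
  define T where "T n = 1 - 4 * ((a n / ln (real n) + (a n)\<^sup>2 + a n * c n / ln (real n)) / (b n)\<^sup>2 - 1)" for n
  have "(\<lambda>n. 1 - 4 * ((a n * (1 / ln (real n)) + (a n)\<^sup>2 + a n * c n * (1 / ln (real n))) / (b n)\<^sup>2 - 1))
      \<longlonglongrightarrow> 1 - 4 * ((1 * 0 + 1\<^sup>2 + 1 * 0 * 0) / 1\<^sup>2 - 1)"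
    by (intro tendsto_intros a_lim b_lim c_lim ln_lim) auto
  then have T_lim: "T \<longlonglongrightarrow> 1" by (simp add: T_def[abs_def])
  have lam_up_lim: "lam_up lam \<longlonglongrightarrow> lam" unfolding lam_up_def by real_asymp
  have ev1: "\<forall>\<^sub>F n in sequentially. lam_up lam n < lam'" by (rule order_tendstoD(2)[OF lam_up_lim lam(2)])
  have ev2: "\<forall>\<^sub>F n in sequentially. 2 * lam \<le> real n" by real_asymp
  have ev3: "\<forall>\<^sub>F n in sequentially. 1/2 < b n" by (rule order_tendstoD(1)[OF b_lim]) simp
  have ev4: "\<forall>\<^sub>F n in sequentially. eps n < 1" by (rule order_tendstoD(2)[OF eps_lim]) simp
  have ev5: "\<forall>\<^sub>F n in sequentially. 0 < b1 n" by (rule order_tendstoD(1)[OF b1_lim]) simp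
  have ev6: "\<forall>\<^sub>F n in sequentially. 0 < b2 n" by (rule order_tendstoD(1)[OF b2_lim]) simp
  have ev7: "\<forall>\<^sub>F n in sequentially. 1 < ln (real n)" by real_asymp
  have lower: "\<forall>\<^sub>F n in sequentially. T n \<le>
      measure_pmf.prob (gnp n (lam / real n)) {G. real (num_tree_copies D (h n) n G) \<ge> ln (real n) / 4}"
    using h ev1 ev2 ev3 ev4 ev5 ev6 ev7 h_low_props[OF D lam(1) lim, of "h0 + 2"]
  proof eventually_elim
    case (elim n)
    let ?l = "ln (real n)"
    let ?M = "random_subset (all_edges n) (lam / real n)"
    \<comment> \<open>The moments are computed at the largest depth only; copies of depth
      \<open>h n\<close> come from truncating those of depth \<open>H\<close>.\<close>
    define H where "H = h_low D lam n"
    define j where "j = H - (h0 + 2)"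
    have "h0 + 2 \<le> H" using elim unfolding H_def by blast
    then have Hj: "H = Suc (Suc (h0 + j))" unfolding j_def by arith
    define p where "p = perc D lam H"
    have n2: "2 * lam \<le> real n" using elim by simp
    have n0: "0 < real n" using n2 lam by linarith
    have l1: "1 < ?l" using elim by simp
    have n1: "1 < real n" using l1 n0 by (metis exp_gt_one exp_ln less_trans zero_less_one)
    have pl: "?l / real n < p" using elim by (simp add: H_def p_def)
    then have np: "?l \<le> real n * p" using n0 by (simp add: field_simps)
    have p1: "1 / real n < p" using pl l1 n0 by (meson divide_strict_right_mono less_trans)
    have p0: "0 < p" using p1 n0 by (meson divide_pos_pos less_trans zero_less_one)
    have DH: "real D ^ H \<le> C1 * ?l"
    proof -
      have "exp (- ?l) = 1 / real n" using n0 by (simp add: exp_minus inverse_eq_divide)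
      also have "\<dots> < perc D lam' H"
        using p1 perc_mono_lam[of lam lam' D H] lam by (simp add: p_def)
      also have "\<dots> \<le> exp (- (real D ^ (j + 2)))" using h0[of "j + 2"] by (simp add: Hj)
      finally have "real D ^ (j + 2) \<le> ?l" by simp
      then have "real D ^ h0 * real D ^ (j + 2) \<le> real D ^ h0 * ?l" by (intro mult_left_mono) auto
      moreover have "real D ^ h0 * real D ^ (j + 2) = real D ^ H" by (simp add: Hj flip: power_add)
      ultimately show ?thesis by (simp add: C1_def)
    qed
    have low: "b n * p \<le> measure_pmf.prob ?M (good_root D H n v)" if v: "v < n" for v
    proof -
      define s where "s = nat \<lfloor>real n powr (1/3)\<rfloor>"
      have pw: "1 \<le> real n powr (1/3)" using n1 by (simp add: ge_one_powr_ge_zero)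
      have s1: "real s \<le> real n powr (1/3)" using pw by (simp add: s_def)
      have s2: "real n powr (1/3) - 1 \<le> real s" unfolding s_def by linarith
      have "(real s)\<^sup>2 \<le> (real n powr (1/3))\<^sup>2" using s1 by (intro power_mono) auto
      also have "\<dots> = real n powr (2/3)" by (simp add: power2_eq_square flip: powr_add)
      finally have sq: "(real s)\<^sup>2 \<le> real n powr (2/3)" .
      have t1: "(real s)\<^sup>2 / real n \<le> real n powr (-1/3)"
      proof -
        have "(real s)\<^sup>2 / real n \<le> real n powr (2/3) / real n powr 1" using sq n0 by (simp add: divide_right_mono)
        also have "\<dots> = real n powr (-1/3)" unfolding powr_diff[symmetric] by simp
        finally show ?thesis .
      qed
      have t2: "real s / real n \<le> real n powr (-2/3)"
      proof -
        have "real s / real n \<le> real n powr (1/3) / real n powr 1" using s1 n0 by (simp add: divide_right_mono)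
        also have "\<dots> = real n powr (-2/3)" unfolding powr_diff[symmetric] by simp
        finally show ?thesis .
      qed
      have pn: "real n powr (2/3) \<le> real n" "real n powr (1/3) \<le> real n"
        using powr_mono[of "2/3" 1 "real n"] powr_mono[of "1/3" 1 "real n"] n1 by auto
      have sqn: "(real s)\<^sup>2 \<le> real n" by (rule order_trans[OF sq pn(1)])
      have sn: "s \<le> n"
      proof -
        have "real s \<le> real n" by (rule order_trans[OF s1 pn(2)])
        then show ?thesis by simp
      qed
      let ?E = "2 * exp (- (real s / (2 + 2 * lam) ^ Suc (3 * H)))"
      have "((1 - real s / real n) * (1 - lam / real n) ^ n * exp lam) ^ s * (perc D lam H - ?E) \<le>
          measure_pmf.prob ?M (good_root D H n v)"
        unfolding good_root_def by (rule prob_emb_uniq_ge[OF lam(1) _ v _ sn]) (use n2 lam in auto)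
      moreover have fac: "b1 n * b2 n \<le> ((1 - real s / real n) * (1 - lam / real n) ^ n * exp lam) ^ s"
      proof -
        have "b1 n * b2 n \<le> (1 - (real s)\<^sup>2 / real n) * (1 - 2 * lam\<^sup>2 * real s / real n)"
        proof (rule mult_mono)
          show "b1 n \<le> 1 - (real s)\<^sup>2 / real n" using t1 by (simp add: b1_def)
          have "2 * lam\<^sup>2 * (real s / real n) \<le> 2 * lam\<^sup>2 * real n powr (-2/3)" using t2 by (intro mult_left_mono) auto
          then show "b2 n \<le> 1 - 2 * lam\<^sup>2 * real s / real n" by (simp add: b2_def)
          show "0 \<le> 1 - (real s)\<^sup>2 / real n" using sqn n0 by simp
        qed (use elim in simp)
        also have "\<dots> \<le> ((1 - real s / real n) * (1 - lam / real n) ^ n * exp lam) ^ s"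
          by (rule labelling_factor_ge[OF lam(1) n2 sqn sn])
        finally show ?thesis .
      qed
      moreover have E: "?E \<le> eps n * p"
      proof -
        have "B ^ Suc (3 * H) = B * (B ^ 3) ^ H" by (simp add: power_mult)
        also have "\<dots> \<le> B * (2 ^ q) ^ H" using q B by (intro mult_left_mono power_mono) auto
        also have "\<dots> \<le> B * (real D ^ q) ^ H" using D B by (intro mult_left_mono power_mono) auto
        also have "\<dots> = B * (real D ^ H) ^ q" by (simp add: mult.commute flip: power_mult)
        also have "\<dots> \<le> B * (C1 * ?l) ^ q" using DH B by (intro mult_left_mono power_mono) auto
        finally have Bb: "B ^ Suc (3 * H) \<le> B * (C1 * ?l) ^ q" .
        have "(real n powr (1/3) - 1) / (B * (C1 * ?l) ^ q) \<le> real s / B ^ Suc (3 * H)"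
          using Bb s2 pw B C1 l1 by (intro frac_le) auto
        then have "?E \<le> 2 * exp (- ((real n powr (1/3) - 1) / (B * (C1 * ?l) ^ q)))" by (simp add: B_def)
        also have "\<dots> = eps n * (1 / real n)" using n0 by (simp add: eps_def)
        also have "\<dots> \<le> eps n * p" using p1 n0 by (intro mult_left_mono) (auto simp: eps_def)
        finally show ?thesis .
      qed
      ultimately have main: "((1 - real s / real n) * (1 - lam / real n) ^ n * exp lam) ^ s * (p - ?E) \<le>
          measure_pmf.prob ?M (good_root D H n v)" by (simp add: p_def)
      have e1: "0 \<le> (1 - eps n) * p" using elim p0 by simp
      have e2: "(1 - eps n) * p \<le> p - ?E" using E by (simp add: algebra_simps)
      have "b n * p = (b1 n * b2 n) * ((1 - eps n) * p)" by (simp add: b_def)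
      also have "\<dots> \<le> ((1 - real s / real n) * (1 - lam / real n) ^ n * exp lam) ^ s * (p - ?E)"
        using elim by (intro mult_mono fac e2 e1 order_trans[OF _ fac]) auto
      finally show ?thesis using main by simp
    qed
    have F0: "0 \<le> F j" using M by (simp add: F_def)
    have cn: "c n = C0 * (4 * lam) * F j" by (simp only: c_def H_def j_def)
    then have c0: "0 \<le> c n" using F0 C0 lam by simp
    have a0: "0 < a n" by (simp add: a_def)
    have row: "(\<Sum>z<n. measure_pmf.prob ?M (good_root D H n v \<inter> good_root D H n z)) \<le>
       p * (a n + real n * p * (a n)\<^sup>2 + a n * c n)" if v: "v < n" for v
    proof -
      define lu where "lu = lam_up lam n"
      define Q where "Q = perc D lu"
      have lu0: "0 \<le> lu" using lam n0 by (simp add: lu_def lam_up_def)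
      have lu2: "lu \<le> 2 * lam"
      proof -
        have "2 * lam / real n \<le> 1" using n2 n0 by simp
        then show ?thesis unfolding lu_def lam_up_def using lam by (intro mult_right_mono) auto
      qed
      have QH: "Q H \<le> a n * p"
      proof -
        let ?t = "1 + 2 * lam / real n"
        have t1: "1 \<le> ?t" using lam n0 by simp
        have "Q H \<le> ?t ^ (2 * D ^ H - 2) * p"
          unfolding Q_def lu_def lam_up_def p_def by (rule perc_scale[OF _ t1 D]) (use lam in simp)
        also have "\<dots> \<le> ?t ^ (2 * D ^ H) * p" using t1 p0 by (intro mult_right_mono power_increasing) auto
        also have "?t ^ (2 * D ^ H) \<le> exp (2 * lam / real n) ^ (2 * D ^ H)"
          using lam n0 by (intro power_mono) (auto intro: add_nonneg_nonneg)
        also have "\<dots> = exp (4 * lam * real D ^ H / real n)" by (simp add: mult_ac flip: exp_of_nat_mult)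
        also have "\<dots> \<le> exp (4 * lam * (C1 * ?l) / real n)"
          using DH lam n0 by (simp add: divide_right_mono)
        also have "\<dots> = a n" by (simp add: a_def mult_ac)
        finally show ?thesis using p0 by simp
      qed
      have Q01: "0 \<le> Q k" "Q k \<le> 1" for k using perc_bounds[OF lu0] by (auto simp: Q_def)
      have psiq: "(psi (D - 1) (lu * Q (Suc (h0 + j))))\<^sup>2 \<le> C0 * (a n * p)"
      proof -
        have "lu * Q (Suc (h0 + j)) \<le> (2 * lam) * 1" using lu2 lu0 Q01 lam by (intro mult_mono) auto
        then have "(psi (D - 1) (lu * Q (Suc (h0 + j))))\<^sup>2 \<le> C0 * psi D (lu * Q (Suc (h0 + j)))"
          unfolding C0_def using lu0 Q01 by (intro psi_square_le[OF D]) auto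
        also have "psi D (lu * Q (Suc (h0 + j))) = Q H" by (simp add: Q_def Hj)
        also have "C0 * Q H \<le> C0 * (a n * p)" using QH C0 by (rule mult_left_mono)
        finally show ?thesis .
      qed
      have Qg: "lu * Q (h0 + j) \<le> 2 * lam * exp (- (2 ^ j))"
      proof (rule mult_mono[OF lu2])
        have "Q (h0 + j) \<le> perc D lam' (h0 + j)" unfolding Q_def using lu0 elim by (intro perc_mono_lam) (auto simp: lu_def)
        also have "\<dots> \<le> exp (- (real D ^ j))" by (rule h0)
        also have "\<dots> \<le> exp (- (2 ^ j))" using D by (simp add: power_mono)
        finally show "Q (h0 + j) \<le> exp (- (2 ^ j))" .
      qed (use lam Q01 in auto)
      have S: "(\<Sum>k = 1..2 * H. lam ^ k) \<le> real (2 * H) * M ^ (2 * H)"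
      proof -
        have "lam ^ k \<le> M ^ (2 * H)" if "k \<in> {1..2 * H}" for k
        proof -
          have "lam ^ k \<le> M ^ k" using lam M by (intro power_mono) auto
          also have "\<dots> \<le> M ^ (2 * H)" using M that by (intro power_increasing) auto
          finally show ?thesis .
        qed
        from sum_bounded_above[of "{1..2 * H}", OF this] show ?thesis by simp
      qed
      have "(\<Sum>z<n. measure_pmf.prob ?M (good_root D H n v \<inter> good_root D H n z)) \<le>
          Q H + real n * (Q H)\<^sup>2 + (\<Sum>k = 1..2 * H. lam ^ k) *
            ((psi (D - 1) (lu * Q (Suc (h0 + j))))\<^sup>2 * (2 * (lu * Q (h0 + j))))"
        using second_moment_row[OF lam(1) n2 D v, of "h0 + j"] unfolding Hj Q_def lu_def .
      also have "\<dots> \<le> a n * p + real n * (a n * p)\<^sup>2 + (real (2 * H) * M ^ (2 * H)) *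
            ((C0 * (a n * p)) * (2 * (2 * lam * exp (- (2 ^ j)))))"
      proof -
        have "(psi (D - 1) (lu * Q (Suc (h0 + j))))\<^sup>2 * (2 * (lu * Q (h0 + j))) \<le> (C0 * (a n * p)) * (2 * (2 * lam * exp (- (2 ^ j))))"
          by (rule mult_mono[OF psiq]) (use Qg C0 a0 p0 lu0 Q01 in auto)
        from mult_mono[OF S this] have "(\<Sum>k = 1..2 * H. lam ^ k) * ((psi (D - 1) (lu * Q (Suc (h0 + j))))\<^sup>2 * (2 * (lu * Q (h0 + j)))) \<le>
            (real (2 * H) * M ^ (2 * H)) * ((C0 * (a n * p)) * (2 * (2 * lam * exp (- (2 ^ j)))))"
          using M lu0 Q01 by simp
        moreover have "real n * (Q H)\<^sup>2 \<le> real n * (a n * p)\<^sup>2" using QH Q01 by (intro mult_left_mono power_mono) auto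
        ultimately show ?thesis using QH by (intro add_mono)
      qed
      also have "\<dots> = p * (a n + real n * p * (a n)\<^sup>2 + a n * c n)"
      proof -
        have "c n = C0 * (4 * lam) * (real (2 * H) * M ^ (2 * H) * exp (- (2 ^ j)))"
          unfolding cn F_def Hj by (simp add: add_ac)
        then show ?thesis by (simp add: power2_eq_square algebra_simps)
      qed
      finally show ?thesis .
    qed
    have bn: "0 < b n" using elim by simp
    have "T n \<le> measure_pmf.prob (gnp n (lam / real n)) {G. real (num_tree_copies D (h n) n G) \<ge> b n * ?l / 2}"
      unfolding T_def
      by (rule prob_copies_ge[OF lam(1) n2 D _ _ low row bn])
         (use elim a0 c0 l1 np in \<open>auto simp: H_def\<close>)
    also have "\<dots> \<le> measure_pmf.prob (gnp n (lam / real n)) {G. real (num_tree_copies D (h n) n G) \<ge> ?l / 4}"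
    proof (rule measure_pmf.finite_measure_mono)
      have "1/2 * ?l \<le> b n * ?l" using elim l1 by (intro mult_right_mono) auto
      then show "{G. real (num_tree_copies D (h n) n G) \<ge> b n * ?l / 2} \<subseteq> {G. real (num_tree_copies D (h n) n G) \<ge> ?l / 4}"
        by auto
    qed simp
    finally show ?case .
  qed
  show ?thesis
    by (rule tendsto_sandwich[OF lower _ T_lim tendsto_const]) (simp add: always_eventually)
qed

theorem theorem9:
  fixes D :: nat and lam :: real
  assumes "D \<ge> 2" and "0 < lam" and "lam < lambda_crit D"
  shows "(\<forall>h::nat \<Rightarrow> nat.
            (\<forall>\<^sub>F n in sequentially. 0 < h n \<and> h n \<le> h_low D lam n) \<longrightarrow>
            (\<exists>f::nat \<Rightarrow> real. filterlim f at_top sequentially \<and>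
               (\<lambda>n. measure_pmf.prob (gnp n (lam / real n))
                      {G. real (num_tree_copies D (h n) n G) \<ge> f n}) \<longlonglongrightarrow> 1))
       \<and> (\<exists>C::nat. \<forall>h::nat \<Rightarrow> nat.
            (\<forall>\<^sub>F n in sequentially. 0 < h n \<and> h n \<ge> h_bar D lam n + C) \<longrightarrow>
            (\<lambda>n. measure_pmf.prob (gnp n (lam / real n))
                   {G. contains_tree D (h n) n G}) \<longlonglongrightarrow> 0)"
proof -
  obtain lam' where lam': "lam < lam'" and sub: "\<And>p. 0 < p \<Longrightarrow> p \<le> 1 \<Longrightarrow> psi D (lam' * p) < p"
    using lambda_crit_D[OF assms(1,3)] by auto
  \<comment> \<open>The witness for \<open>f\<close>: the mean number of roots is at least b ln n,
    Chebyshev's inequality keeps half of it, and eventually b > 1/2.\<close>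
  have "filterlim (\<lambda>n::nat. ln (real n) / 4) at_top sequentially" by real_asymp
  then show ?thesis
    using prob_many_tree_copies_tendsto_1[OF assms(1,2) lam' sub] prob_contains_tree_tendsto_0[OF assms(1,2) lam' sub] by blast
qed

end
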